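(* The free globularly generated double category functor $Q:\mathbf{bCat}^*\to\mathbf{gCat}$ is a free functor with respect to $H^*\restriction_{\mathbf{gCat}}:\mathbf{gCat}\to\mathbf{bCat}^*$; that is, $H^*\restriction_{\mathbf{gCat}}$ is faithful (so that $\mathbf{gCat}$ is a concrete category over $\mathbf{bCat}^*$) and $Q$ is left adjoint to it.
   Context: Double categories. A double category $C$ (possibly weak in the horizontal direction) consists of a category $C_0$ (objects and vertical morphisms), a category $C_1$ (horizontal morphisms and squares; composition in $C_1$ is vertical composition, written $\bullet$), functors $s,t:C_1\to C_0$ (left and right edge), a horizontal identity functor $i:C_0\to C_1$ (its value on a vertical morphism $f$ is the square $i_f$), a horizontal composition functor $*:C_1\times_{C_0}C_1\to C_1$ (the composite of $\Phi$ followed on its right by $\Psi$ is written $\Psi*\Phi$), and invertible globular associator and left/right unitor natural transformations satisfying the usual coherence axioms. A square is globular if its left and right edges are identity vertical morphisms. $HC$ denotes the horizontal bicategory of $C$: 0-cells, 1-cells, 2-cells are the objects, horizontal morphisms, globular squares of $C$. A double functor $F:C\to C'$ is a pair of functors $F_0:C_0\to C_0'$, $F_1:C_1\to C_1'$ commuting with $s,t$ and compatible with $i$ and $*$ up to specified coherent invertible globular squares. Decorated bicategories. A decorated bicategory $\mathcal{B}$ is a bicategory (also written $\mathcal{B}$) together with a category $\mathcal{B}^*$ (the decoration) whose objects are the 0-cells of $\mathcal{B}$. A decorated pseudofunctor $G:\mathcal{B}\to\mathcal{B}'$ is a pseudofunctor together with a functor $G^*:\mathcal{B}^*\to\mathcal{B}'^*$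 agreeing with it on 0-cells. For a double category $C$, $H^*C$ is $HC$ decorated by $C_0$; for a double functor $F$, $H^*F$ is the decorated pseudofunctor given by $F_0$ and the restriction of $F$ to horizontal morphisms and globular squares. $C$ is globularly generated if every square of $C$ can be obtained by vertical and horizontal compositions from globular squares and squares $i_f$. $\mathbf{bCat}^*$ is the category of decorated bicategories and decorated pseudofunctors, $\mathbf{dCat}$ the category of double categories and double functors, $\mathbf{gCat}$ its full subcategory of globularly generated double categories. The free globularly generated double category $Q_{\mathcal{B}}$. Let $\mathbb{G}$ be the collection of formal squares of two kinds: for every 2-cell $\varphi:\alpha\Rightarrow\beta$ of $\mathcal{B}$ with $\alpha,\beta:a\to b$, a square $\varphi$ with top $\alpha$, bottom $\beta$, left edge $id_a$, right edge $id_b$; and for every morphism $f:a\to b$ of $\mathcal{B}^*$, a square $i_f$ with top the identity 1-cell $i_a$, bottom $i_b$, left and right edges $f$. The squares $i_{id_a}$ and $id_{i_a}$ are regarded as equal. Form all formal expressions obtained from $\mathbb{G}$ by formal vertical composition $\Psi\bullet\Phi$ (when the bottom of $\Phi$ equals the top of $\Psi$; left and right edges compose in $\mathcal{B}^*$) and formal parenthesized horizontal composition $\Psi*\Phi$ (when the right edge of $\Phi$ equals the left edge of $\Psi$; tops and bottoms compose as 1-cells of $\mathcal{B}$). Then $Q_{\mathcal{B}}$ has $\mathcal{B}^*$ as category of objects, the 1-cells of $\mathcal{B}$ (with their composition and identities) as horizontal morphisms, and as squares the expressions modulo the smallest equivalence relation compatible with $\bullet$ and $*$ such that: $\bullet$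 is associative and the identity 2-cell $id_\alpha$ is a vertical identity at $\alpha$; (1) $(\Psi_2\bullet\Psi_1)*(\Phi_2\bullet\Phi_1)\sim(\Psi_2*\Phi_2)\bullet(\Psi_1*\Phi_1)$ whenever both sides make sense; (2) for vertically composable 2-cells of $\mathcal{B}$ the formal composite $\psi\bullet\varphi$ is identified with their vertical composite in $\mathcal{B}$, and $i_g\bullet i_f\sim i_{gf}$ for composable $f,g$ in $\mathcal{B}^*$; (3) for horizontally composable 2-cells of $\mathcal{B}$ the formal composite $\psi*\varphi$ is identified with their horizontal composite in $\mathcal{B}$; (4) the left and right unitors of $\mathcal{B}$ are natural with respect to all squares; (5) the associators of $\mathcal{B}$ are natural with respect to all squares. Horizontal identities are the $i_f$; associators and unitors are those of $\mathcal{B}$. $\mathcal{B}$ is a sub-decorated bicategory of $H^*Q_{\mathcal{B}}$; the inclusion $j^{\mathcal{B}}:\mathcal{B}\to H^*Q_{\mathcal{B}}$ is the identity on $\mathcal{B}^*$ and on 1-cells and sends each 2-cell to its class. The functor $Q$. $Q$ sends $\mathcal{B}$ to $Q_{\mathcal{B}}$ and a decorated pseudofunctor $G:\mathcal{B}\to\mathcal{B}'$ to the free double functor $Q_G:Q_{\mathcal{B}}\to Q_{\mathcal{B}'}$, which is the unique double functor with $H^*Q_G\restriction_{\mathcal{B}}=G$ (i.e. $H^*Q_G\circ j^{\mathcal{B}}=j^{\mathcal{B}'}\circ G$). A category equipped with a faithful functor $U$ to $\mathcal{X}$ is a concrete category over $\mathcal{X}$; a free functor with respect to $U$ is a left adjoint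 of $U$. *)

theory Defs
  imports Main "HOL-Library.FuncSet" "HOL-Library.Infinite_Typeclass"
begin

section \<open>Categories, functors, concrete categories and free functors\<close>

text \<open>
  All structures are records with explicit carriers. Their operations are total HOL functions
  whose values outside the carriers are irrelevant. Composites are written in the usual order:
  \<open>Cmp C g f\<close> is \<open>g\<close> after \<open>f\<close>.
\<close>

record ('a, 'm) cat =
  Ob  :: "'a set"
  Ar  :: "'m set"
  Dom :: "'m \<Rightarrow> 'a"
  Cod :: "'m \<Rightarrow> 'a"
  Idn :: "'a \<Rightarrow> 'm"
  Cmp :: "'m \<Rightarrow> 'm \<Rightarrow> 'm"

definition hom :: "('a, 'm) cat \<Rightarrow> 'a \<Rightarrow> 'a \<Rightarrow> 'm set" where
  "hom C a b = {f \<in> Ar C. Dom C f = a \<and> Cod C f = b}"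

definition isos :: "('a, 'm) cat \<Rightarrow> 'a \<Rightarrow> 'a \<Rightarrow> 'm set" where
  "isos C a b = {f \<in> hom C a b. \<exists>g \<in> hom C b a. Cmp C g f = Idn C a \<and> Cmp C f g = Idn C b}"

locale category =
  fixes C :: "('a, 'm) cat"
  assumes Dom_Ob: "f \<in> Ar C \<Longrightarrow> Dom C f \<in> Ob C"
    and Cod_Ob: "f \<in> Ar C \<Longrightarrow> Cod C f \<in> Ob C"
    and Idn_hom: "a \<in> Ob C \<Longrightarrow> Idn C a \<in> hom C a a"
    and Cmp_hom: "f \<in> Ar C \<Longrightarrow> g \<in> Ar C \<Longrightarrow> Dom C g = Cod C f
      \<Longrightarrow> Cmp C g f \<in> hom C (Dom C f) (Cod C g)"
    and Cmp_Idn_right: "f \<in> Ar C \<Longrightarrow> Cmp C f (Idn C (Dom C f)) = f"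
    and Cmp_Idn_left: "f \<in> Ar C \<Longrightarrow> Cmp C (Idn C (Cod C f)) f = f"
    and Cmp_assoc: "f \<in> Ar C \<Longrightarrow> g \<in> Ar C \<Longrightarrow> h \<in> Ar C
      \<Longrightarrow> Dom C g = Cod C f \<Longrightarrow> Dom C h = Cod C g
      \<Longrightarrow> Cmp C (Cmp C h g) f = Cmp C h (Cmp C g f)"

locale cat_functor = dom: category A + cod: category B
  for A :: "('a, 'm) cat" and B :: "('b, 'n) cat" +
  fixes Fo :: "'a \<Rightarrow> 'b" and Fa :: "'m \<Rightarrow> 'n"
  assumes map_Ob: "a \<in> Ob A \<Longrightarrow> Fo a \<in> Ob B"
    and map_hom: "f \<in> Ar A \<Longrightarrow> Fa f \<in> hom B (Fo (Dom A f)) (Fo (Cod A f))"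
    and map_Idn: "a \<in> Ob A \<Longrightarrow> Fa (Idn A a) = Idn B (Fo a)"
    and map_Cmp: "f \<in> Ar A \<Longrightarrow> g \<in> Ar A \<Longrightarrow> Dom A g = Cod A f
      \<Longrightarrow> Fa (Cmp A g f) = Cmp B (Fa g) (Fa f)"

definition faithful :: "('a, 'm) cat \<Rightarrow> ('m \<Rightarrow> 'n) \<Rightarrow> bool" where
  "faithful A Fa \<longleftrightarrow> (\<forall>a \<in> Ob A. \<forall>b \<in> Ob A. inj_on Fa (hom A a b))"

definition concrete_category ::
  "('a, 'm) cat \<Rightarrow> ('x, 'n) cat \<Rightarrow> ('a \<Rightarrow> 'x) \<Rightarrow> ('m \<Rightarrow> 'n) \<Rightarrow> bool" where
  "concrete_category A X Uo Ua \<longleftrightarrow> cat_functor A X Uo Ua \<and> faithful A Ua"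

definition left_adjoint ::
  "('x, 'n) cat \<Rightarrow> ('a, 'm) cat \<Rightarrow> ('x \<Rightarrow> 'a) \<Rightarrow> ('n \<Rightarrow> 'm)
    \<Rightarrow> ('a \<Rightarrow> 'x) \<Rightarrow> ('m \<Rightarrow> 'n) \<Rightarrow> bool" where
  "left_adjoint X A Fo Fa Uo Ua \<longleftrightarrow>
     cat_functor X A Fo Fa \<and> cat_functor A X Uo Ua \<and>
     (\<exists>\<theta>.
        (\<forall>x \<in> Ob X. \<forall>a \<in> Ob A. bij_betw (\<theta> x a) (hom A (Fo x) a) (hom X x (Uo a))) \<and>
        (\<forall>x \<in> Ob X. \<forall>x' \<in> Ob X. \<forall>a \<in> Ob A. \<forall>a' \<in> Ob A.
           \<forall>k \<in> hom X x' x. \<forall>f \<in> hom A (Fo x) a. \<forall>h \<in> hom A a a'.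
             \<theta> x' a' (Cmp A h (Cmp A f (Fa k))) = Cmp X (Ua h) (Cmp X (\<theta> x a f) k)))"

definition full_subcategory :: "('a, 'm) cat \<Rightarrow> 'a set \<Rightarrow> ('a, 'm) cat" where
  "full_subcategory C S = C\<lparr>Ob := Ob C \<inter> S,
     Ar := {f \<in> Ar C. Dom C f \<in> S \<and> Cod C f \<in> S}\<rparr>"

text \<open>
  The category of pairs \<open>(g, f)\<close> of objects and pairs \<open>(\<psi>, \<phi>)\<close> of arrows of \<open>C\<close> that are
  composable in a second direction, as expressed by \<open>P\<close> and \<open>R\<close>.
\<close>

definition composable_pairs ::
  "('a, 'm) cat \<Rightarrow> ('a \<Rightarrow> 'a \<Rightarrow> bool) \<Rightarrow> ('m \<Rightarrow> 'm \<Rightarrow> bool) \<Rightarrow> ('a \<times> 'a, 'm \<times> 'm) cat" where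
  "composable_pairs C P R = \<lparr>
     Ob = {(g, f). g \<in> Ob C \<and> f \<in> Ob C \<and> P g f},
     Ar = {(\<psi>, \<phi>). \<psi> \<in> Ar C \<and> \<phi> \<in> Ar C \<and> R \<psi> \<phi>},
     Dom = map_prod (Dom C) (Dom C),
     Cod = map_prod (Cod C) (Cod C),
     Idn = map_prod (Idn C) (Idn C),
     Cmp = (\<lambda>(\<psi>', \<phi>') (\<psi>, \<phi>). (Cmp C \<psi>' \<psi>, Cmp C \<phi>' \<phi>))\<rparr>"


section \<open>Decorated bicategories\<close>

text \<open>
  \<open>Cells B\<close> is the disjoint union of all hom-categories of \<open>B\<close>: its objects are the 1-cells, its
  arrows the 2-cells, its composition the vertical composition \<open>\<psi> \<cdot> \<phi>\<close>. As in a double category,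
  \<open>g \<odot> f\<close> and \<open>\<psi> \<star> \<phi>\<close> require the source 0-cell of the left operand to be the target 0-cell of
  the right one. The associator goes from \<open>(h \<odot> g) \<odot> f\<close> to \<open>h \<odot> (g \<odot> f)\<close>.
\<close>

record ('o, 'h, 't) bicat =
  Cell0 :: "'o set"
  Cells :: "('h, 't) cat"
  src1  :: "'h \<Rightarrow> 'o"
  trg1  :: "'h \<Rightarrow> 'o"
  unit1 :: "'o \<Rightarrow> 'h"
  comp1 :: "'h \<Rightarrow> 'h \<Rightarrow> 'h" (infixl "\<odot>\<index>" 70)
  hcomp2 :: "'t \<Rightarrow> 't \<Rightarrow> 't" (infixl "\<star>\<index>" 70)
  bassoc :: "'h \<Rightarrow> 'h \<Rightarrow> 'h \<Rightarrow> 't"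
  blunit :: "'h \<Rightarrow> 't"
  brunit :: "'h \<Rightarrow> 't"

record ('o, 'h, 't, 'v) decbicat = "('o, 'h, 't) bicat" +
  Deco :: "('o, 'v) cat"

abbreviation Cell1 :: "('o, 'h, 't, 'z) bicat_scheme \<Rightarrow> 'h set" where
  "Cell1 B \<equiv> Ob (Cells B)"

abbreviation Cell2 :: "('o, 'h, 't, 'z) bicat_scheme \<Rightarrow> 't set" where
  "Cell2 B \<equiv> Ar (Cells B)"

abbreviation top2 :: "('o, 'h, 't, 'z) bicat_scheme \<Rightarrow> 't \<Rightarrow> 'h" where
  "top2 B \<equiv> Dom (Cells B)"

abbreviation bot2 :: "('o, 'h, 't, 'z) bicat_scheme \<Rightarrow> 't \<Rightarrow> 'h" where
  "bot2 B \<equiv> Cod (Cells B)"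

abbreviation id2 :: "('o, 'h, 't, 'z) bicat_scheme \<Rightarrow> 'h \<Rightarrow> 't" where
  "id2 B \<equiv> Idn (Cells B)"

abbreviation vcomp2 :: "('o, 'h, 't, 'z) bicat_scheme \<Rightarrow> 't \<Rightarrow> 't \<Rightarrow> 't" (infixl "\<cdot>\<index>" 65) where
  "vcomp2 B \<equiv> Cmp (Cells B)"

definition bicat_pairs ::
  "('o, 'h, 't, 'z) bicat_scheme \<Rightarrow> ('h \<times> 'h, 't \<times> 't) cat" where
  "bicat_pairs B = composable_pairs (Cells B) (\<lambda>g f. src1 B g = trg1 B f)
     (\<lambda>\<psi> \<phi>. src1 B (top2 B \<psi>) = trg1 B (top2 B \<phi>))"

locale bicategory =
  fixes B :: "('o, 'h, 't, 'z) bicat_scheme" (structure)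
  assumes cells: "category (Cells B)"
    and src1_Cell0: "f \<in> Cell1 B \<Longrightarrow> src1 B f \<in> Cell0 B"
    and trg1_Cell0: "f \<in> Cell1 B \<Longrightarrow> trg1 B f \<in> Cell0 B"
    and parallel_src: "\<phi> \<in> Cell2 B \<Longrightarrow> src1 B (bot2 B \<phi>) = src1 B (top2 B \<phi>)"
    and parallel_trg: "\<phi> \<in> Cell2 B \<Longrightarrow> trg1 B (bot2 B \<phi>) = trg1 B (top2 B \<phi>)"
    and unit1_Cell1: "a \<in> Cell0 B \<Longrightarrow> unit1 B a \<in> Cell1 B"
    and src1_unit1: "a \<in> Cell0 B \<Longrightarrow> src1 B (unit1 B a) = a"
    and trg1_unit1: "a \<in> Cell0 B \<Longrightarrow> trg1 B (unit1 B a) = a"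
    and comp_functor: "cat_functor (bicat_pairs B) (Cells B)
      (\<lambda>(g, f). g \<odot> f) (\<lambda>(\<psi>, \<phi>). \<psi> \<star> \<phi>)"
    and src1_comp1: "f \<in> Cell1 B \<Longrightarrow> g \<in> Cell1 B \<Longrightarrow> src1 B g = trg1 B f
      \<Longrightarrow> src1 B (g \<odot> f) = src1 B f"
    and trg1_comp1: "f \<in> Cell1 B \<Longrightarrow> g \<in> Cell1 B \<Longrightarrow> src1 B g = trg1 B f
      \<Longrightarrow> trg1 B (g \<odot> f) = trg1 B g"
    and bassoc_iso: "f \<in> Cell1 B \<Longrightarrow> g \<in> Cell1 B \<Longrightarrow> h \<in> Cell1 B
      \<Longrightarrow> src1 B g = trg1 B f \<Longrightarrow> src1 B h = trg1 B g
      \<Longrightarrow> bassoc B h g f \<in> isos (Cells B) ((h \<odot> g) \<odot> f) (h \<odot> (g \<odot> f))"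
    and blunit_iso: "f \<in> Cell1 B
      \<Longrightarrow> blunit B f \<in> isos (Cells B) (unit1 B (trg1 B f) \<odot> f) f"
    and brunit_iso: "f \<in> Cell1 B
      \<Longrightarrow> brunit B f \<in> isos (Cells B) (f \<odot> unit1 B (src1 B f)) f"
    and bassoc_natural: "\<phi> \<in> Cell2 B \<Longrightarrow> \<psi> \<in> Cell2 B \<Longrightarrow> \<chi> \<in> Cell2 B
      \<Longrightarrow> src1 B (top2 B \<psi>) = trg1 B (top2 B \<phi>) \<Longrightarrow> src1 B (top2 B \<chi>) = trg1 B (top2 B \<psi>)
      \<Longrightarrow> bassoc B (bot2 B \<chi>) (bot2 B \<psi>) (bot2 B \<phi>) \<cdot> ((\<chi> \<star> \<psi>) \<star> \<phi>)
         = (\<chi> \<star> (\<psi> \<star> \<phi>)) \<cdot> bassoc B (top2 B \<chi>) (top2 B \<psi>) (top2 B \<phi>)"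
    and blunit_natural: "\<phi> \<in> Cell2 B
      \<Longrightarrow> blunit B (bot2 B \<phi>) \<cdot> (id2 B (unit1 B (trg1 B (top2 B \<phi>))) \<star> \<phi>)
         = \<phi> \<cdot> blunit B (top2 B \<phi>)"
    and brunit_natural: "\<phi> \<in> Cell2 B
      \<Longrightarrow> brunit B (bot2 B \<phi>) \<cdot> (\<phi> \<star> id2 B (unit1 B (src1 B (top2 B \<phi>))))
         = \<phi> \<cdot> brunit B (top2 B \<phi>)"
    and pentagon: "f \<in> Cell1 B \<Longrightarrow> g \<in> Cell1 B \<Longrightarrow> h \<in> Cell1 B \<Longrightarrow> k \<in> Cell1 B
      \<Longrightarrow> src1 B g = trg1 B f \<Longrightarrow> src1 B h = trg1 B g \<Longrightarrow> src1 B k = trg1 B h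
      \<Longrightarrow> (id2 B k \<star> bassoc B h g f) \<cdot> bassoc B k (h \<odot> g) f \<cdot> (bassoc B k h g \<star> id2 B f)
         = bassoc B k h (g \<odot> f) \<cdot> bassoc B (k \<odot> h) g f"
    and triangle: "f \<in> Cell1 B \<Longrightarrow> g \<in> Cell1 B \<Longrightarrow> src1 B g = trg1 B f
      \<Longrightarrow> (id2 B g \<star> blunit B f) \<cdot> bassoc B g (unit1 B (src1 B g)) f = brunit B g \<star> id2 B f"

locale decorated_bicategory = bicategory B + deco: category "Deco B"
  for B :: "('o, 'h, 't, 'v, 'z) decbicat_scheme" (structure) +
  assumes Ob_Deco: "Ob (Deco B) = Cell0 B"

text \<open>
  Pseudofunctors and double functors are compared by equality of all their data, including the
  comparison cells; their maps are therefore required to be \<^term>\<open>undefined\<close> off the carriers.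
\<close>

record ('o, 'h, 't, 'p, 'k, 'u) pseudofun =
  map0 :: "'o \<Rightarrow> 'p"
  map1 :: "'h \<Rightarrow> 'k"
  map2 :: "'t \<Rightarrow> 'u"
  pcomp :: "'h \<Rightarrow> 'h \<Rightarrow> 'u"
  punit :: "'o \<Rightarrow> 'u"

record ('o, 'h, 't, 'p, 'k, 'u, 'v, 'w) decpseudofun = "('o, 'h, 't, 'p, 'k, 'u) pseudofun" +
  mapD :: "'v \<Rightarrow> 'w"

locale pseudofunctor = dom: bicategory B + cod: bicategory B'
  for B :: "('o, 'h, 't, 'z) bicat_scheme" (structure)
    and B' :: "('p, 'k, 'u, 'y) bicat_scheme" +
  fixes G :: "('o, 'h, 't, 'p, 'k, 'u, 'x) pseudofun_scheme"
  assumes map0_Cell0: "a \<in> Cell0 B \<Longrightarrow> map0 G a \<in> Cell0 B'"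
    and map12: "cat_functor (Cells B) (Cells B') (map1 G) (map2 G)"
    and src1_map1: "f \<in> Cell1 B \<Longrightarrow> src1 B' (map1 G f) = map0 G (src1 B f)"
    and trg1_map1: "f \<in> Cell1 B \<Longrightarrow> trg1 B' (map1 G f) = map0 G (trg1 B f)"
    and pcomp_iso: "f \<in> Cell1 B \<Longrightarrow> g \<in> Cell1 B \<Longrightarrow> src1 B g = trg1 B f
      \<Longrightarrow> pcomp G g f \<in> isos (Cells B') (map1 G g \<odot>\<^bsub>B'\<^esub> map1 G f) (map1 G (g \<odot> f))"
    and punit_iso: "a \<in> Cell0 B
      \<Longrightarrow> punit G a \<in> isos (Cells B') (unit1 B' (map0 G a)) (map1 G (unit1 B a))"
    and pcomp_natural: "\<phi> \<in> Cell2 B \<Longrightarrow> \<psi> \<in> Cell2 B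
      \<Longrightarrow> src1 B (top2 B \<psi>) = trg1 B (top2 B \<phi>)
      \<Longrightarrow> pcomp G (bot2 B \<psi>) (bot2 B \<phi>) \<cdot>\<^bsub>B'\<^esub> (map2 G \<psi> \<star>\<^bsub>B'\<^esub> map2 G \<phi>)
         = map2 G (\<psi> \<star> \<phi>) \<cdot>\<^bsub>B'\<^esub> pcomp G (top2 B \<psi>) (top2 B \<phi>)"
    and bassoc_coherent: "f \<in> Cell1 B \<Longrightarrow> g \<in> Cell1 B \<Longrightarrow> h \<in> Cell1 B
      \<Longrightarrow> src1 B g = trg1 B f \<Longrightarrow> src1 B h = trg1 B g
      \<Longrightarrow> map2 G (bassoc B h g f) \<cdot>\<^bsub>B'\<^esub> pcomp G (h \<odot> g) f
           \<cdot>\<^bsub>B'\<^esub> (pcomp G h g \<star>\<^bsub>B'\<^esub> id2 B' (map1 G f))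
         = pcomp G h (g \<odot> f) \<cdot>\<^bsub>B'\<^esub> (id2 B' (map1 G h) \<star>\<^bsub>B'\<^esub> pcomp G g f)
           \<cdot>\<^bsub>B'\<^esub> bassoc B' (map1 G h) (map1 G g) (map1 G f)"
    and blunit_coherent: "f \<in> Cell1 B
      \<Longrightarrow> map2 G (blunit B f) \<cdot>\<^bsub>B'\<^esub> pcomp G (unit1 B (trg1 B f)) f
           \<cdot>\<^bsub>B'\<^esub> (punit G (trg1 B f) \<star>\<^bsub>B'\<^esub> id2 B' (map1 G f))
         = blunit B' (map1 G f)"
    and brunit_coherent: "f \<in> Cell1 B
      \<Longrightarrow> map2 G (brunit B f) \<cdot>\<^bsub>B'\<^esub> pcomp G f (unit1 B (src1 B f))
           \<cdot>\<^bsub>B'\<^esub> (id2 B' (map1 G f) \<star>\<^bsub>B'\<^esub> punit G (src1 B f))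
         = brunit B' (map1 G f)"
    and map0_ext: "map0 G \<in> extensional (Cell0 B)"
    and map1_ext: "map1 G \<in> extensional (Cell1 B)"
    and map2_ext: "map2 G \<in> extensional (Cell2 B)"
    and pcomp_ext: "case_prod (pcomp G) \<in> extensional (Ob (bicat_pairs B))"
    and punit_ext: "punit G \<in> extensional (Cell0 B)"

locale decorated_pseudofunctor =
  pseudofunctor B B' G + domD: decorated_bicategory B + codD: decorated_bicategory B'
  for B :: "('o, 'h, 't, 'v, 'z) decbicat_scheme" (structure)
    and B' :: "('p, 'k, 'u, 'w, 'y) decbicat_scheme"
    and G :: "('o, 'h, 't, 'p, 'k, 'u, 'v, 'w, 'x) decpseudofun_scheme" +
  assumes decoration: "cat_functor (Deco B) (Deco B') (map0 G) (mapD G)"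
    and mapD_ext: "mapD G \<in> extensional (Ar (Deco B))"

definition id_dpf ::
  "('o, 'h, 't, 'v) decbicat \<Rightarrow> ('o, 'h, 't, 'o, 'h, 't, 'v, 'v) decpseudofun" where
  "id_dpf B = \<lparr>
     map0 = (\<lambda>a \<in> Cell0 B. a),
     map1 = (\<lambda>f \<in> Cell1 B. f),
     map2 = (\<lambda>\<phi> \<in> Cell2 B. \<phi>),
     pcomp = curry (\<lambda>(g, f) \<in> Ob (bicat_pairs B). id2 B (g \<odot>\<^bsub>B\<^esub> f)),
     punit = (\<lambda>a \<in> Cell0 B. id2 B (unit1 B a)),
     mapD = (\<lambda>f \<in> Ar (Deco B). f)\<rparr>"

text \<open>Composite of \<open>G: B \<rightarrow> B'\<close> and \<open>G': B' \<rightarrow> B''\<close>.\<close>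

definition comp_dpf ::
  "('o, 'h, 't, 'v) decbicat \<Rightarrow> ('p, 'k, 'u, 'w) decbicat
    \<Rightarrow> ('o1, 'h1, 't1, 'p, 'k, 'u, 'v1, 'w) decpseudofun
    \<Rightarrow> ('o, 'h, 't, 'o1, 'h1, 't1, 'v, 'v1) decpseudofun
    \<Rightarrow> ('o, 'h, 't, 'p, 'k, 'u, 'v, 'w) decpseudofun" where
  "comp_dpf B B'' G' G = \<lparr>
     map0 = compose (Cell0 B) (map0 G') (map0 G),
     map1 = compose (Cell1 B) (map1 G') (map1 G),
     map2 = compose (Cell2 B) (map2 G') (map2 G),
     pcomp = curry (\<lambda>(g, f) \<in> Ob (bicat_pairs B).
       map2 G' (pcomp G g f) \<cdot>\<^bsub>B''\<^esub> pcomp G' (map1 G g) (map1 G f)),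
     punit = (\<lambda>a \<in> Cell0 B. map2 G' (punit G a) \<cdot>\<^bsub>B''\<^esub> punit G' (map0 G a)),
     mapD = compose (Ar (Deco B)) (mapD G') (mapD G)\<rparr>"


section \<open>Double categories\<close>

text \<open>
  \<open>Ver D\<close> is the category of objects and vertical morphisms, \<open>Sqr D\<close> the category of horizontal
  morphisms and squares. Field names ending in \<open>H\<close> and \<open>S\<close> are the object and arrow
  part of the functors giving left edge, right edge, horizontal identity and horizontal
  composition; \<open>\<Psi> \<bullet> \<Phi>\<close> is vertical composition, \<open>g \<otimes> f\<close> and \<open>\<Psi> \<ast> \<Phi>\<close> horizontal composition with
  the right operand on the left-hand side of the picture.
\<close>

record ('o, 'v, 'h, 's) dblcat =
  Ver :: "('o, 'v) cat"
  Sqr :: "('h, 's) cat"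
  lftH :: "'h \<Rightarrow> 'o"
  lftS :: "'s \<Rightarrow> 'v"
  rgtH :: "'h \<Rightarrow> 'o"
  rgtS :: "'s \<Rightarrow> 'v"
  hidH :: "'o \<Rightarrow> 'h"
  hidS :: "'v \<Rightarrow> 's"
  hcmpH :: "'h \<Rightarrow> 'h \<Rightarrow> 'h" (infixl "\<otimes>\<index>" 70)
  hcmpS :: "'s \<Rightarrow> 's \<Rightarrow> 's" (infixl "\<ast>\<index>" 70)
  assoc :: "'h \<Rightarrow> 'h \<Rightarrow> 'h \<Rightarrow> 's"
  lunit :: "'h \<Rightarrow> 's"
  runit :: "'h \<Rightarrow> 's"

abbreviation obj :: "('o, 'v, 'h, 's) dblcat \<Rightarrow> 'o set" where
  "obj D \<equiv> Ob (Ver D)"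

abbreviation ver :: "('o, 'v, 'h, 's) dblcat \<Rightarrow> 'v set" where
  "ver D \<equiv> Ar (Ver D)"

abbreviation hor :: "('o, 'v, 'h, 's) dblcat \<Rightarrow> 'h set" where
  "hor D \<equiv> Ob (Sqr D)"

abbreviation sqr :: "('o, 'v, 'h, 's) dblcat \<Rightarrow> 's set" where
  "sqr D \<equiv> Ar (Sqr D)"

abbreviation sqtop :: "('o, 'v, 'h, 's) dblcat \<Rightarrow> 's \<Rightarrow> 'h" where
  "sqtop D \<equiv> Dom (Sqr D)"

abbreviation sqbot :: "('o, 'v, 'h, 's) dblcat \<Rightarrow> 's \<Rightarrow> 'h" where
  "sqbot D \<equiv> Cod (Sqr D)"

abbreviation vid :: "('o, 'v, 'h, 's) dblcat \<Rightarrow> 'h \<Rightarrow> 's" where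
  "vid D \<equiv> Idn (Sqr D)"

abbreviation vcmp :: "('o, 'v, 'h, 's) dblcat \<Rightarrow> 's \<Rightarrow> 's \<Rightarrow> 's" (infixl "\<bullet>\<index>" 65) where
  "vcmp D \<equiv> Cmp (Sqr D)"

definition globular :: "('o, 'v, 'h, 's) dblcat \<Rightarrow> 's set" where
  "globular D = {\<Phi> \<in> sqr D. lftS D \<Phi> \<in> Idn (Ver D) ` obj D \<and> rgtS D \<Phi> \<in> Idn (Ver D) ` obj D}"

text \<open>The pullback of the right-edge functor along the left-edge functor.\<close>

definition dbl_pairs :: "('o, 'v, 'h, 's) dblcat \<Rightarrow> ('h \<times> 'h, 's \<times> 's) cat" where
  "dbl_pairs D = composable_pairs (Sqr D) (\<lambda>g f. lftH D g = rgtH D f)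
     (\<lambda>\<Psi> \<Phi>. lftS D \<Psi> = rgtS D \<Phi>)"

locale double_category =
  fixes D :: "('o, 'v, 'h, 's) dblcat" (structure)
  assumes lft: "cat_functor (Sqr D) (Ver D) (lftH D) (lftS D)"
    and rgt: "cat_functor (Sqr D) (Ver D) (rgtH D) (rgtS D)"
    and hid: "cat_functor (Ver D) (Sqr D) (hidH D) (hidS D)"
    and hcmp: "cat_functor (dbl_pairs D) (Sqr D) (\<lambda>(g, f). g \<otimes> f) (\<lambda>(\<Psi>, \<Phi>). \<Psi> \<ast> \<Phi>)"
    and lftH_hidH: "a \<in> obj D \<Longrightarrow> lftH D (hidH D a) = a"
    and rgtH_hidH: "a \<in> obj D \<Longrightarrow> rgtH D (hidH D a) = a"
    and lftS_hidS: "u \<in> ver D \<Longrightarrow> lftS D (hidS D u) = u"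
    and rgtS_hidS: "u \<in> ver D \<Longrightarrow> rgtS D (hidS D u) = u"
    and lftH_hcmpH: "f \<in> hor D \<Longrightarrow> g \<in> hor D \<Longrightarrow> lftH D g = rgtH D f
      \<Longrightarrow> lftH D (g \<otimes> f) = lftH D f"
    and rgtH_hcmpH: "f \<in> hor D \<Longrightarrow> g \<in> hor D \<Longrightarrow> lftH D g = rgtH D f
      \<Longrightarrow> rgtH D (g \<otimes> f) = rgtH D g"
    and lftS_hcmpS: "\<Phi> \<in> sqr D \<Longrightarrow> \<Psi> \<in> sqr D \<Longrightarrow> lftS D \<Psi> = rgtS D \<Phi>
      \<Longrightarrow> lftS D (\<Psi> \<ast> \<Phi>) = lftS D \<Phi>"
    and rgtS_hcmpS: "\<Phi> \<in> sqr D \<Longrightarrow> \<Psi> \<in> sqr D \<Longrightarrow> lftS D \<Psi> = rgtS D \<Phi>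
      \<Longrightarrow> rgtS D (\<Psi> \<ast> \<Phi>) = rgtS D \<Psi>"
    and assoc_iso: "f \<in> hor D \<Longrightarrow> g \<in> hor D \<Longrightarrow> h \<in> hor D
      \<Longrightarrow> lftH D g = rgtH D f \<Longrightarrow> lftH D h = rgtH D g
      \<Longrightarrow> assoc D h g f \<in> globular D \<inter> isos (Sqr D) ((h \<otimes> g) \<otimes> f) (h \<otimes> (g \<otimes> f))"
    and lunit_iso: "f \<in> hor D
      \<Longrightarrow> lunit D f \<in> globular D \<inter> isos (Sqr D) (hidH D (rgtH D f) \<otimes> f) f"
    and runit_iso: "f \<in> hor D
      \<Longrightarrow> runit D f \<in> globular D \<inter> isos (Sqr D) (f \<otimes> hidH D (lftH D f)) f"
    and assoc_natural: "\<Phi> \<in> sqr D \<Longrightarrow> \<Psi> \<in> sqr D \<Longrightarrow> \<Theta> \<in> sqr D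
      \<Longrightarrow> lftS D \<Psi> = rgtS D \<Phi> \<Longrightarrow> lftS D \<Theta> = rgtS D \<Psi>
      \<Longrightarrow> assoc D (sqbot D \<Theta>) (sqbot D \<Psi>) (sqbot D \<Phi>) \<bullet> ((\<Theta> \<ast> \<Psi>) \<ast> \<Phi>)
         = (\<Theta> \<ast> (\<Psi> \<ast> \<Phi>)) \<bullet> assoc D (sqtop D \<Theta>) (sqtop D \<Psi>) (sqtop D \<Phi>)"
    and lunit_natural: "\<Phi> \<in> sqr D
      \<Longrightarrow> lunit D (sqbot D \<Phi>) \<bullet> (hidS D (rgtS D \<Phi>) \<ast> \<Phi>) = \<Phi> \<bullet> lunit D (sqtop D \<Phi>)"
    and runit_natural: "\<Phi> \<in> sqr D
      \<Longrightarrow> runit D (sqbot D \<Phi>) \<bullet> (\<Phi> \<ast> hidS D (lftS D \<Phi>)) = \<Phi> \<bullet> runit D (sqtop D \<Phi>)"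
    and pentagon: "f \<in> hor D \<Longrightarrow> g \<in> hor D \<Longrightarrow> h \<in> hor D \<Longrightarrow> k \<in> hor D
      \<Longrightarrow> lftH D g = rgtH D f \<Longrightarrow> lftH D h = rgtH D g \<Longrightarrow> lftH D k = rgtH D h
      \<Longrightarrow> (vid D k \<ast> assoc D h g f) \<bullet> assoc D k (h \<otimes> g) f \<bullet> (assoc D k h g \<ast> vid D f)
         = assoc D k h (g \<otimes> f) \<bullet> assoc D (k \<otimes> h) g f"
    and triangle: "f \<in> hor D \<Longrightarrow> g \<in> hor D \<Longrightarrow> lftH D g = rgtH D f
      \<Longrightarrow> (vid D g \<ast> lunit D f) \<bullet> assoc D g (hidH D (lftH D g)) f = runit D g \<ast> vid D f"

inductive_set gen_sqr :: "('o, 'v, 'h, 's) dblcat \<Rightarrow> 's set"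
  for D :: "('o, 'v, 'h, 's) dblcat" (structure) where
  glob: "\<Phi> \<in> globular D \<Longrightarrow> \<Phi> \<in> gen_sqr D"
| hid: "u \<in> ver D \<Longrightarrow> hidS D u \<in> gen_sqr D"
| vcmp: "\<Phi> \<in> gen_sqr D \<Longrightarrow> \<Psi> \<in> gen_sqr D \<Longrightarrow> sqtop D \<Psi> = sqbot D \<Phi> \<Longrightarrow> \<Psi> \<bullet> \<Phi> \<in> gen_sqr D"
| hcmp: "\<Phi> \<in> gen_sqr D \<Longrightarrow> \<Psi> \<in> gen_sqr D \<Longrightarrow> lftS D \<Psi> = rgtS D \<Phi> \<Longrightarrow> \<Psi> \<ast> \<Phi> \<in> gen_sqr D"

definition globularly_generated :: "('o, 'v, 'h, 's) dblcat \<Rightarrow> bool" where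
  "globularly_generated D \<longleftrightarrow> sqr D \<subseteq> gen_sqr D"

record ('o, 'v, 'h, 's, 'p, 'w, 'k, 'r) dblfun =
  dobj :: "'o \<Rightarrow> 'p"
  dver :: "'v \<Rightarrow> 'w"
  dhor :: "'h \<Rightarrow> 'k"
  dsqr :: "'s \<Rightarrow> 'r"
  dcomp :: "'h \<Rightarrow> 'h \<Rightarrow> 'r"
  dunit :: "'o \<Rightarrow> 'r"

locale double_functor = dom: double_category D + cod: double_category D'
  for D :: "('o, 'v, 'h, 's) dblcat" (structure) and D' :: "('p, 'w, 'k, 'r) dblcat" +
  fixes F :: "('o, 'v, 'h, 's, 'p, 'w, 'k, 'r) dblfun"
  assumes F0: "cat_functor (Ver D) (Ver D') (dobj F) (dver F)"
    and F1: "cat_functor (Sqr D) (Sqr D') (dhor F) (dsqr F)"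
    and lftH_dhor: "f \<in> hor D \<Longrightarrow> lftH D' (dhor F f) = dobj F (lftH D f)"
    and rgtH_dhor: "f \<in> hor D \<Longrightarrow> rgtH D' (dhor F f) = dobj F (rgtH D f)"
    and lftS_dsqr: "\<Phi> \<in> sqr D \<Longrightarrow> lftS D' (dsqr F \<Phi>) = dver F (lftS D \<Phi>)"
    and rgtS_dsqr: "\<Phi> \<in> sqr D \<Longrightarrow> rgtS D' (dsqr F \<Phi>) = dver F (rgtS D \<Phi>)"
    and dcomp_iso: "f \<in> hor D \<Longrightarrow> g \<in> hor D \<Longrightarrow> lftH D g = rgtH D f
      \<Longrightarrow> dcomp F g f
         \<in> globular D' \<inter> isos (Sqr D') (dhor F g \<otimes>\<^bsub>D'\<^esub> dhor F f) (dhor F (g \<otimes> f))"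
    and dunit_iso: "a \<in> obj D
      \<Longrightarrow> dunit F a \<in> globular D' \<inter> isos (Sqr D') (hidH D' (dobj F a)) (dhor F (hidH D a))"
    and dcomp_natural: "\<Phi> \<in> sqr D \<Longrightarrow> \<Psi> \<in> sqr D \<Longrightarrow> lftS D \<Psi> = rgtS D \<Phi>
      \<Longrightarrow> dcomp F (sqbot D \<Psi>) (sqbot D \<Phi>) \<bullet>\<^bsub>D'\<^esub> (dsqr F \<Psi> \<ast>\<^bsub>D'\<^esub> dsqr F \<Phi>)
         = dsqr F (\<Psi> \<ast> \<Phi>) \<bullet>\<^bsub>D'\<^esub> dcomp F (sqtop D \<Psi>) (sqtop D \<Phi>)"
    and dunit_natural: "u \<in> ver D
      \<Longrightarrow> dunit F (Cod (Ver D) u) \<bullet>\<^bsub>D'\<^esub> hidS D' (dver F u)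
         = dsqr F (hidS D u) \<bullet>\<^bsub>D'\<^esub> dunit F (Dom (Ver D) u)"
    and assoc_coherent: "f \<in> hor D \<Longrightarrow> g \<in> hor D \<Longrightarrow> h \<in> hor D
      \<Longrightarrow> lftH D g = rgtH D f \<Longrightarrow> lftH D h = rgtH D g
      \<Longrightarrow> dsqr F (assoc D h g f) \<bullet>\<^bsub>D'\<^esub> dcomp F (h \<otimes> g) f
           \<bullet>\<^bsub>D'\<^esub> (dcomp F h g \<ast>\<^bsub>D'\<^esub> vid D' (dhor F f))
         = dcomp F h (g \<otimes> f) \<bullet>\<^bsub>D'\<^esub> (vid D' (dhor F h) \<ast>\<^bsub>D'\<^esub> dcomp F g f)
           \<bullet>\<^bsub>D'\<^esub> assoc D' (dhor F h) (dhor F g) (dhor F f)"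
    and lunit_coherent: "f \<in> hor D
      \<Longrightarrow> dsqr F (lunit D f) \<bullet>\<^bsub>D'\<^esub> dcomp F (hidH D (rgtH D f)) f
           \<bullet>\<^bsub>D'\<^esub> (dunit F (rgtH D f) \<ast>\<^bsub>D'\<^esub> vid D' (dhor F f))
         = lunit D' (dhor F f)"
    and runit_coherent: "f \<in> hor D
      \<Longrightarrow> dsqr F (runit D f) \<bullet>\<^bsub>D'\<^esub> dcomp F f (hidH D (lftH D f))
           \<bullet>\<^bsub>D'\<^esub> (vid D' (dhor F f) \<ast>\<^bsub>D'\<^esub> dunit F (lftH D f))
         = runit D' (dhor F f)"
    and dobj_ext: "dobj F \<in> extensional (obj D)"
    and dver_ext: "dver F \<in> extensional (ver D)"
    and dhor_ext: "dhor F \<in> extensional (hor D)"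
    and dsqr_ext: "dsqr F \<in> extensional (sqr D)"
    and dcomp_ext: "case_prod (dcomp F) \<in> extensional (Ob (dbl_pairs D))"
    and dunit_ext: "dunit F \<in> extensional (obj D)"

definition id_dblfun ::
  "('o, 'v, 'h, 's) dblcat \<Rightarrow> ('o, 'v, 'h, 's, 'o, 'v, 'h, 's) dblfun" where
  "id_dblfun D = \<lparr>
     dobj = (\<lambda>a \<in> obj D. a),
     dver = (\<lambda>u \<in> ver D. u),
     dhor = (\<lambda>f \<in> hor D. f),
     dsqr = (\<lambda>\<Phi> \<in> sqr D. \<Phi>),
     dcomp = curry (\<lambda>(g, f) \<in> Ob (dbl_pairs D). vid D (g \<otimes>\<^bsub>D\<^esub> f)),
     dunit = (\<lambda>a \<in> obj D. vid D (hidH D a))\<rparr>"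

definition comp_dblfun ::
  "('o, 'v, 'h, 's) dblcat \<Rightarrow> ('p, 'w, 'k, 'r) dblcat
    \<Rightarrow> ('o1, 'v1, 'h1, 's1, 'p, 'w, 'k, 'r) dblfun
    \<Rightarrow> ('o, 'v, 'h, 's, 'o1, 'v1, 'h1, 's1) dblfun
    \<Rightarrow> ('o, 'v, 'h, 's, 'p, 'w, 'k, 'r) dblfun" where
  "comp_dblfun D D'' F' F = \<lparr>
     dobj = compose (obj D) (dobj F') (dobj F),
     dver = compose (ver D) (dver F') (dver F),
     dhor = compose (hor D) (dhor F') (dhor F),
     dsqr = compose (sqr D) (dsqr F') (dsqr F),
     dcomp = curry (\<lambda>(g, f) \<in> Ob (dbl_pairs D).
       dsqr F' (dcomp F g f) \<bullet>\<^bsub>D''\<^esub> dcomp F' (dhor F g) (dhor F f)),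
     dunit = (\<lambda>a \<in> obj D. dsqr F' (dunit F a) \<bullet>\<^bsub>D''\<^esub> dunit F' (dobj F a))\<rparr>"


section \<open>The decorated horizontal bicategory\<close>

definition Hstar :: "('o, 'v, 'h, 's) dblcat \<Rightarrow> ('o, 'h, 's, 'v) decbicat" where
  "Hstar D = \<lparr>
     Cell0 = obj D,
     Cells = (Sqr D)\<lparr>Ar := globular D\<rparr>,
     src1 = lftH D,
     trg1 = rgtH D,
     unit1 = hidH D,
     comp1 = hcmpH D,
     hcomp2 = hcmpS D,
     bassoc = assoc D,
     blunit = lunit D,
     brunit = runit D,
     Deco = Ver D\<rparr>"

definition Hstar_map ::
  "('o, 'v, 'h, 's) dblcat \<Rightarrow> ('o, 'v, 'h, 's, 'p, 'w, 'k, 'r) dblfun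
    \<Rightarrow> ('o, 'h, 's, 'p, 'k, 'r, 'v, 'w) decpseudofun" where
  "Hstar_map D F = \<lparr>
     map0 = dobj F,
     map1 = dhor F,
     map2 = restrict (dsqr F) (globular D),
     pcomp = dcomp F,
     punit = dunit F,
     mapD = dver F\<rparr>"


section \<open>The free globularly generated double category\<close>

datatype ('v, 't) sqexp =
  Two 't
| HId 'v
| Vert "('v, 't) sqexp" "('v, 't) sqexp"
| Horz "('v, 't) sqexp" "('v, 't) sqexp"

primrec etop :: "('o, 'h, 't, 'v) decbicat \<Rightarrow> ('v, 't) sqexp \<Rightarrow> 'h" where
  "etop B (Two \<phi>) = top2 B \<phi>"
| "etop B (HId u) = unit1 B (Dom (Deco B) u)"
| "etop B (Vert \<Psi> \<Phi>) = etop B \<Phi>"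
| "etop B (Horz \<Psi> \<Phi>) = etop B \<Psi> \<odot>\<^bsub>B\<^esub> etop B \<Phi>"

primrec ebot :: "('o, 'h, 't, 'v) decbicat \<Rightarrow> ('v, 't) sqexp \<Rightarrow> 'h" where
  "ebot B (Two \<phi>) = bot2 B \<phi>"
| "ebot B (HId u) = unit1 B (Cod (Deco B) u)"
| "ebot B (Vert \<Psi> \<Phi>) = ebot B \<Psi>"
| "ebot B (Horz \<Psi> \<Phi>) = ebot B \<Psi> \<odot>\<^bsub>B\<^esub> ebot B \<Phi>"

primrec elft :: "('o, 'h, 't, 'v) decbicat \<Rightarrow> ('v, 't) sqexp \<Rightarrow> 'v" where
  "elft B (Two \<phi>) = Idn (Deco B) (src1 B (top2 B \<phi>))"
| "elft B (HId u) = u"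
| "elft B (Vert \<Psi> \<Phi>) = Cmp (Deco B) (elft B \<Psi>) (elft B \<Phi>)"
| "elft B (Horz \<Psi> \<Phi>) = elft B \<Phi>"

primrec ergt :: "('o, 'h, 't, 'v) decbicat \<Rightarrow> ('v, 't) sqexp \<Rightarrow> 'v" where
  "ergt B (Two \<phi>) = Idn (Deco B) (trg1 B (top2 B \<phi>))"
| "ergt B (HId u) = u"
| "ergt B (Vert \<Psi> \<Phi>) = Cmp (Deco B) (ergt B \<Psi>) (ergt B \<Phi>)"
| "ergt B (Horz \<Psi> \<Phi>) = ergt B \<Psi>"

inductive_set sqexps :: "('o, 'h, 't, 'v) decbicat \<Rightarrow> ('v, 't) sqexp set"
  for B :: "('o, 'h, 't, 'v) decbicat" where
  Two: "\<phi> \<in> Cell2 B \<Longrightarrow> Two \<phi> \<in> sqexps B"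
| HId: "u \<in> Ar (Deco B) \<Longrightarrow> HId u \<in> sqexps B"
| Vert: "\<Phi> \<in> sqexps B \<Longrightarrow> \<Psi> \<in> sqexps B \<Longrightarrow> ebot B \<Phi> = etop B \<Psi> \<Longrightarrow> Vert \<Psi> \<Phi> \<in> sqexps B"
| Horz: "\<Phi> \<in> sqexps B \<Longrightarrow> \<Psi> \<in> sqexps B \<Longrightarrow> ergt B \<Phi> = elft B \<Psi> \<Longrightarrow> Horz \<Psi> \<Phi> \<in> sqexps B"

inductive_set sqrel :: "('o, 'h, 't, 'v) decbicat \<Rightarrow> (('v, 't) sqexp \<times> ('v, 't) sqexp) set"
  for B :: "('o, 'h, 't, 'v) decbicat" (structure) where
  refl: "\<Phi> \<in> sqexps B \<Longrightarrow> (\<Phi>, \<Phi>) \<in> sqrel B"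
| sym: "(\<Phi>, \<Psi>) \<in> sqrel B \<Longrightarrow> (\<Psi>, \<Phi>) \<in> sqrel B"
| trans: "(\<Phi>, \<Psi>) \<in> sqrel B \<Longrightarrow> (\<Psi>, \<Theta>) \<in> sqrel B \<Longrightarrow> (\<Phi>, \<Theta>) \<in> sqrel B"
| Vert_cong: "(\<Phi>, \<Phi>') \<in> sqrel B \<Longrightarrow> (\<Psi>, \<Psi>') \<in> sqrel B
    \<Longrightarrow> Vert \<Psi> \<Phi> \<in> sqexps B \<Longrightarrow> Vert \<Psi>' \<Phi>' \<in> sqexps B \<Longrightarrow> (Vert \<Psi> \<Phi>, Vert \<Psi>' \<Phi>') \<in> sqrel B"
| Horz_cong: "(\<Phi>, \<Phi>') \<in> sqrel B \<Longrightarrow> (\<Psi>, \<Psi>') \<in> sqrel B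
    \<Longrightarrow> Horz \<Psi> \<Phi> \<in> sqexps B \<Longrightarrow> Horz \<Psi>' \<Phi>' \<in> sqexps B \<Longrightarrow> (Horz \<Psi> \<Phi>, Horz \<Psi>' \<Phi>') \<in> sqrel B"
| HId_Idn: "a \<in> Cell0 B \<Longrightarrow> (HId (Idn (Deco B) a), Two (id2 B (unit1 B a))) \<in> sqrel B"
| Vert_assoc: "Vert \<Theta> (Vert \<Psi> \<Phi>) \<in> sqexps B
    \<Longrightarrow> (Vert (Vert \<Theta> \<Psi>) \<Phi>, Vert \<Theta> (Vert \<Psi> \<Phi>)) \<in> sqrel B"
| Vert_id_top: "\<Phi> \<in> sqexps B \<Longrightarrow> (Vert \<Phi> (Two (id2 B (etop B \<Phi>))), \<Phi>) \<in> sqrel B"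
| Vert_id_bot: "\<Phi> \<in> sqexps B \<Longrightarrow> (Vert (Two (id2 B (ebot B \<Phi>))) \<Phi>, \<Phi>) \<in> sqrel B"
| interchange: "Horz (Vert \<Psi>2 \<Psi>1) (Vert \<Phi>2 \<Phi>1) \<in> sqexps B
    \<Longrightarrow> Vert (Horz \<Psi>2 \<Phi>2) (Horz \<Psi>1 \<Phi>1) \<in> sqexps B
    \<Longrightarrow> (Horz (Vert \<Psi>2 \<Psi>1) (Vert \<Phi>2 \<Phi>1), Vert (Horz \<Psi>2 \<Phi>2) (Horz \<Psi>1 \<Phi>1)) \<in> sqrel B"
| Vert_Two: "\<phi> \<in> Cell2 B \<Longrightarrow> \<psi> \<in> Cell2 B \<Longrightarrow> bot2 B \<phi> = top2 B \<psi>
    \<Longrightarrow> (Vert (Two \<psi>) (Two \<phi>), Two (\<psi> \<cdot> \<phi>)) \<in> sqrel B"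
| Vert_HId: "u \<in> Ar (Deco B) \<Longrightarrow> w \<in> Ar (Deco B) \<Longrightarrow> Cod (Deco B) u = Dom (Deco B) w
    \<Longrightarrow> (Vert (HId w) (HId u), HId (Cmp (Deco B) w u)) \<in> sqrel B"
| Horz_Two: "\<phi> \<in> Cell2 B \<Longrightarrow> \<psi> \<in> Cell2 B \<Longrightarrow> trg1 B (top2 B \<phi>) = src1 B (top2 B \<psi>)
    \<Longrightarrow> (Horz (Two \<psi>) (Two \<phi>), Two (\<psi> \<star> \<phi>)) \<in> sqrel B"
| lunit_natural: "\<Phi> \<in> sqexps B
    \<Longrightarrow> (Vert (Two (blunit B (ebot B \<Phi>))) (Horz (HId (ergt B \<Phi>)) \<Phi>),
         Vert \<Phi> (Two (blunit B (etop B \<Phi>)))) \<in> sqrel B"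
| runit_natural: "\<Phi> \<in> sqexps B
    \<Longrightarrow> (Vert (Two (brunit B (ebot B \<Phi>))) (Horz \<Phi> (HId (elft B \<Phi>))),
         Vert \<Phi> (Two (brunit B (etop B \<Phi>)))) \<in> sqrel B"
| assoc_natural: "Horz (Horz \<Theta> \<Psi>) \<Phi> \<in> sqexps B
    \<Longrightarrow> (Vert (Two (bassoc B (ebot B \<Theta>) (ebot B \<Psi>) (ebot B \<Phi>))) (Horz (Horz \<Theta> \<Psi>) \<Phi>),
         Vert (Horz \<Theta> (Horz \<Psi> \<Phi>)) (Two (bassoc B (etop B \<Theta>) (etop B \<Psi>) (etop B \<Phi>)))) \<in> sqrel B"

text \<open>
  The squares of the free double category are the equivalence classes of \<^const>\<open>sqrel\<close>. They are
  passed through a naming function \<open>nm\<close>, injective on the classes, which serves only to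
  move them into a prescribed type; with \<open>nm = id\<close> the squares are literally the classes.
\<close>

definition sqclass ::
  "(('v, 't) sqexp set \<Rightarrow> 's) \<Rightarrow> ('o, 'h, 't, 'v) decbicat \<Rightarrow> ('v, 't) sqexp \<Rightarrow> 's" where
  "sqclass nm B \<Phi> = nm (sqrel B `` {\<Phi>})"

definition sqrep ::
  "(('v, 't) sqexp set \<Rightarrow> 's) \<Rightarrow> ('o, 'h, 't, 'v) decbicat \<Rightarrow> 's \<Rightarrow> ('v, 't) sqexp" where
  "sqrep nm B K = (SOME \<Phi>. \<Phi> \<in> sqexps B \<and> sqclass nm B \<Phi> = K)"

definition free_dblcat ::
  "(('v, 't) sqexp set \<Rightarrow> 's) \<Rightarrow> ('o, 'h, 't, 'v) decbicat \<Rightarrow> ('o, 'v, 'h, 's) dblcat" where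
  "free_dblcat nm B = \<lparr>
     Ver = Deco B,
     Sqr = \<lparr>
       Ob = Cell1 B,
       Ar = nm ` (sqexps B // sqrel B),
       Dom = (\<lambda>K. etop B (sqrep nm B K)),
       Cod = (\<lambda>K. ebot B (sqrep nm B K)),
       Idn = (\<lambda>f. sqclass nm B (Two (id2 B f))),
       Cmp = (\<lambda>K L. sqclass nm B (Vert (sqrep nm B K) (sqrep nm B L)))\<rparr>,
     lftH = src1 B,
     lftS = (\<lambda>K. elft B (sqrep nm B K)),
     rgtH = trg1 B,
     rgtS = (\<lambda>K. ergt B (sqrep nm B K)),
     hidH = unit1 B,
     hidS = (\<lambda>u. sqclass nm B (HId u)),
     hcmpH = comp1 B,
     hcmpS = (\<lambda>K L. sqclass nm B (Horz (sqrep nm B K) (sqrep nm B L))),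
     assoc = (\<lambda>h g f. sqclass nm B (Two (bassoc B h g f))),
     lunit = (\<lambda>f. sqclass nm B (Two (blunit B f))),
     runit = (\<lambda>f. sqclass nm B (Two (brunit B f)))\<rparr>"

definition free_incl ::
  "(('v, 't) sqexp set \<Rightarrow> 's) \<Rightarrow> ('o, 'h, 't, 'v) decbicat
    \<Rightarrow> ('o, 'h, 't, 'o, 'h, 's, 'v, 'v) decpseudofun" where
  "free_incl nm B = \<lparr>
     map0 = (\<lambda>a \<in> Cell0 B. a),
     map1 = (\<lambda>f \<in> Cell1 B. f),
     map2 = (\<lambda>\<phi> \<in> Cell2 B. sqclass nm B (Two \<phi>)),
     pcomp = curry (\<lambda>(g, f) \<in> Ob (bicat_pairs B). sqclass nm B (Two (id2 B (g \<odot>\<^bsub>B\<^esub> f)))),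
     punit = (\<lambda>a \<in> Cell0 B. sqclass nm B (Two (id2 B (unit1 B a)))),
     mapD = (\<lambda>u \<in> Ar (Deco B). u)\<rparr>"


section \<open>The categories of decorated bicategories and of double categories\<close>

text \<open>
  An arbitrary type \<open>'u\<close> plays the role of the universe: the small structures are those all of
  whose carriers are subsets of \<open>'u\<close>. Arrows carry their domain and codomain. When \<open>'u\<close> is
  infinite, expressions over \<open>'u\<close> can be coded injectively in \<open>'u\<close>, and each
  equivalence class of expressions is named by the code of one of its elements; so the
  free double category of a small decorated bicategory is again small.
\<close>

type_synonym 'u small_dblcat = "('u, 'u, 'u, 'u) dblcat"
type_synonym 'u small_decbicat = "('u, 'u, 'u, 'u) decbicat"
type_synonym 'u small_dblfun =
  "'u small_dblcat \<times> ('u, 'u, 'u, 'u, 'u, 'u, 'u, 'u) dblfun \<times> 'u small_dblcat"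
type_synonym 'u small_dpf =
  "'u small_decbicat \<times> ('u, 'u, 'u, 'u, 'u, 'u, 'u, 'u) decpseudofun \<times> 'u small_decbicat"

definition bCat :: "('u small_decbicat, 'u small_dpf) cat" where
  "bCat = \<lparr>
     Ob = {B. decorated_bicategory B},
     Ar = {(B, G, B'). decorated_pseudofunctor B B' G},
     Dom = (\<lambda>(B, G, B'). B),
     Cod = (\<lambda>(B, G, B'). B'),
     Idn = (\<lambda>B. (B, id_dpf B, B)),
     Cmp = (\<lambda>(B1, G', B'') (B, G, B'). (B, comp_dpf B B'' G' G, B''))\<rparr>"

definition dCat :: "('u small_dblcat, 'u small_dblfun) cat" where
  "dCat = \<lparr>
     Ob = {D. double_category D},
     Ar = {(D, F, D'). double_functor D D' F},
     Dom = (\<lambda>(D, F, D'). D),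
     Cod = (\<lambda>(D, F, D'). D'),
     Idn = (\<lambda>D. (D, id_dblfun D, D)),
     Cmp = (\<lambda>(D1, F', D'') (D, F, D'). (D, comp_dblfun D D'' F' F, D''))\<rparr>"

definition gCat :: "('u small_dblcat, 'u small_dblfun) cat" where
  "gCat = full_subcategory dCat {D. globularly_generated D}"

definition Hstar_arr :: "'u small_dblfun \<Rightarrow> 'u small_dpf" where
  "Hstar_arr = (\<lambda>(D, F, D'). (Hstar D, Hstar_map D F, Hstar D'))"

definition sqname :: "('u, 'u) sqexp set \<Rightarrow> 'u" where
  "sqname K = (SOME code. inj code) (SOME \<Phi>. \<Phi> \<in> K)"

definition Q_obj :: "'u small_decbicat \<Rightarrow> 'u small_dblcat" where
  "Q_obj = free_dblcat sqname"

definition j_arr :: "'u small_decbicat \<Rightarrow> 'u small_dpf" where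
  "j_arr B = (B, free_incl sqname B, Hstar (Q_obj B))"

definition Q_arr :: "'u small_dpf \<Rightarrow> 'u small_dblfun" where
  "Q_arr G = (THE F. F \<in> hom gCat (Q_obj (Dom bCat G)) (Q_obj (Cod bCat G)) \<and>
     Cmp bCat (Hstar_arr F) (j_arr (Dom bCat G)) = Cmp bCat (j_arr (Cod bCat G)) G)"

end

theory Submission
  imports Defs
begin

text \<open>
  A square of the free double category is a class of expressions, so a double functor out of it that
  extends a pseudofunctor \<open>G\<close> on \<open>B\<close> has no freedom: naturality of the comparison cells forces its value
  on \<open>HId u\<close> and on horizontal composites, which gives uniqueness. Conversely these forced
  values define an evaluation of expressions; it respects every generating relation because, after
  right multiplication by a suitable comparison isomorphism, each relation becomes an axiom of the target
  double category combined with a coherence condition on \<open>G\<close>. The inclusions \<open>j\<close> are thus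
  universal arrows. Faithfulness of \<open>H\<^sup>*\<close> is the same uniqueness argument, by induction on the generation
  of squares.
\<close>

section \<open>Categories and functors\<close>

text \<open>Squares with non-identity edges are invisible to \<open>Hstar\<close>, so a
  pseudofunctor says nothing about them directly; they are reached only through the comparison
  cells. These are invertible but need not be identities. Evaluation therefore preserves vertical
  composition strictly, but on \<open>HId\<close> and \<open>Horz\<close> it has to conjugate by
  comparison cells. Multiplying on the right suits this shape: a comparison cell moves from the top
  of an evaluated expression to the bottom of its image, and no inverse is left over. Arrows are
  equal only if all their data coincide, comparison cells included. The extension must thus restrict
  to \<open>G\<close> itself and not merely up to isomorphism; this is possible because the
  comparison cells of the inclusion are identities. A second obstacle is size: the classes of
  expressions must be moved back into the universe type. The naming map is kept abstract and enters
  only through its injectivity on classes.\<close>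

context category
begin

lemma Idn_Ar [simp]: "a \<in> Ob C \<Longrightarrow> Idn C a \<in> Ar C"
  and Dom_Idn [simp]: "a \<in> Ob C \<Longrightarrow> Dom C (Idn C a) = a"
  and Cod_Idn [simp]: "a \<in> Ob C \<Longrightarrow> Cod C (Idn C a) = a"
  using Idn_hom[of a] by (auto simp: hom_def)

lemma Cmp_Ar [simp]: "f \<in> Ar C \<Longrightarrow> g \<in> Ar C \<Longrightarrow> Dom C g = Cod C f \<Longrightarrow> Cmp C g f \<in> Ar C"
  and Dom_Cmp [simp]: "f \<in> Ar C \<Longrightarrow> g \<in> Ar C \<Longrightarrow> Dom C g = Cod C f \<Longrightarrow> Dom C (Cmp C g f) = Dom C f"
  and Cod_Cmp [simp]: "f \<in> Ar C \<Longrightarrow> g \<in> Ar C \<Longrightarrow> Dom C g = Cod C f \<Longrightarrow> Cod C (Cmp C g f) = Cod C g"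
  using Cmp_hom[of f g] by (auto simp: hom_def)

lemmas in_Ob [simp] = Dom_Ob Cod_Ob

lemma Idn_right [simp]: "f \<in> Ar C \<Longrightarrow> Dom C f = a \<Longrightarrow> Cmp C f (Idn C a) = f"
  using Cmp_Idn_right by blast

lemma Idn_left [simp]: "f \<in> Ar C \<Longrightarrow> Cod C f = a \<Longrightarrow> Cmp C (Idn C a) f = f"
  using Cmp_Idn_left by blast

text \<open>Composites are normalised to right-nested form, where \<open>x\<close> after
  \<open>y\<close> is no longer a subterm of a longer composite. Composing the equation with an
  arbitrary \<open>k\<close> turns it into a rewrite rule that fires inside such chains;
  \<open>Cmp_reassoc3\<close> does the same for three factors.\<close>

lemma Cmp_reassoc:
  assumes "Cmp C x y = e" "x \<in> Ar C" "y \<in> Ar C" "Dom C x = Cod C y" "k \<in> Ar C" "Dom C y = Cod C k"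
  shows "Cmp C x (Cmp C y k) = Cmp C e k"
  using assms Cmp_assoc[of k y x] by simp

lemma Cmp_reassoc3:
  assumes "Cmp C x (Cmp C y z) = e" "x \<in> Ar C" "y \<in> Ar C" "z \<in> Ar C" "Dom C x = Cod C y" "Dom C y
    = Cod C z"
    "k \<in> Ar C" "Dom C z = Cod C k"
  shows "Cmp C x (Cmp C y (Cmp C z k)) = Cmp C e k"
  using assms Cmp_assoc[of k z y] Cmp_assoc[of k "Cmp C y z" x] by simp

lemma isosD:
  assumes "p \<in> isos C a b"
  shows "p \<in> Ar C" "Dom C p = a" "Cod C p = b" "a \<in> Ob C" "b \<in> Ob C"
  using assms by (auto simp: isos_def hom_def)

lemma isosE:
  assumes "p \<in> isos C a b"
  obtains q where "q \<in> Ar C" "Dom C q = b" "Cod C q = a" "Cmp C q p = Idn C a" "Cmp C p q = Idn C b"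
  using assms by (auto simp: isos_def hom_def)

lemma isosI:
  assumes "p \<in> Ar C" "Dom C p = a" "Cod C p = b" "q \<in> Ar C" "Dom C q = b" "Cod C q = a"
    and "Cmp C q p = Idn C a" "Cmp C p q = Idn C b"
  shows "p \<in> isos C a b"
  using assms unfolding isos_def hom_def by blast

lemma Idn_isos: "a \<in> Ob C \<Longrightarrow> Idn C a \<in> isos C a a"
  by (rule isosI[where q = "Idn C a"]) auto

text \<open>Compose with an inverse of \<open>p\<close> on the right. This is how comparison cells
  are stripped from equations later.\<close>

lemma isos_right_cancel:
  assumes p: "p \<in> isos C a b" and xy: "x \<in> Ar C" "y \<in> Ar C" "Dom C x = b" "Dom C y = b"
    and eq: "Cmp C x p = Cmp C y p"
  shows "x = y"
proof -
  obtain q where q: "q \<in> Ar C" "Dom C q = b" "Cod C q = a" "Cmp C p q = Idn C b"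
    using p by (rule isosE)
  have "x = Cmp C x (Cmp C p q)" using q xy by simp
  also have "\<dots> = Cmp C (Cmp C x p) q" using q xy isosD[OF p] by (simp add: Cmp_assoc)
  also have "\<dots> = Cmp C y (Cmp C p q)" using q xy isosD[OF p] by (simp add: eq Cmp_assoc)
  also have "\<dots> = y" using q xy by simp
  finally show ?thesis .
qed

lemma Cmp_isos:
  assumes f: "f \<in> isos C a b" and g: "g \<in> isos C b c"
  shows "Cmp C g f \<in> isos C a c"
proof -
  obtain f' where f': "f' \<in> Ar C" "Dom C f' = b" "Cod C f' = a" "Cmp C f' f = Idn C a" "Cmp C f f'
    = Idn C b"
    using f by (rule isosE)
  obtain g' where g': "g' \<in> Ar C" "Dom C g' = c" "Cod C g' = b" "Cmp C g' g = Idn C b" "Cmp C g g'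
    = Idn C c"
    using g by (rule isosE)
  note [simp] = isosD[OF f] isosD[OF g] f' g'
  have "Cmp C (Cmp C f' g') (Cmp C g f) = Cmp C f' (Cmp C (Cmp C g' g) f)"
    \<comment> \<open>Associativity alone has to identify the two sides, so the inverse pair is kept
      from collapsing on just one of them.\<close>
    by (subst Cmp_assoc, simp_all del: g'(4), subst Cmp_assoc, simp_all del: g'(4))
  moreover have "Cmp C (Cmp C g f) (Cmp C f' g') = Cmp C g (Cmp C (Cmp C f f') g')"
    by (subst Cmp_assoc, simp_all del: f'(5), subst Cmp_assoc, simp_all del: f'(5))
  ultimately show ?thesis
    by (intro isosI[where q = "Cmp C f' g'"]) auto
qed

end

context cat_functor
begin

lemma Fa_Ar [simp]: "f \<in> Ar A \<Longrightarrow> Fa f \<in> Ar B"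
  and Dom_Fa [simp]: "f \<in> Ar A \<Longrightarrow> Dom B (Fa f) = Fo (Dom A f)"
  and Cod_Fa [simp]: "f \<in> Ar A \<Longrightarrow> Cod B (Fa f) = Fo (Cod A f)"
  using map_hom[of f] by (auto simp: hom_def)

lemma map_isos:
  assumes "f \<in> isos A a b"
  shows "Fa f \<in> isos B (Fo a) (Fo b)"
proof -
  obtain g where g: "g \<in> Ar A" "Dom A g = b" "Cod A g = a" "Cmp A g f = Idn A a" "Cmp A f g = Idn A b"
    using assms by (rule dom.isosE)
  note f = dom.isosD[OF assms]
  show ?thesis
    using map_Cmp[of f g] map_Cmp[of g f] f g by (intro cod.isosI[where q = "Fa g"]) (auto simp: map_Idn)
qed

end

text \<open>Stated with \<open>compose\<close>, which is \<open>undefined\<close> off the carrier,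
  because composite pseudofunctors and double functors are built from it.\<close>

lemma cat_functor_compose:
  assumes "cat_functor A B Fo Fa" "cat_functor B C Go Ga"
  shows "cat_functor A C (compose (Ob A) Go Fo) (compose (Ar A) Ga Fa)"
proof -
  interpret F: cat_functor A B Fo Fa by fact
  interpret G: cat_functor B C Go Ga by fact
  show ?thesis
    by unfold_locales
      (auto simp: compose_def hom_def F.map_Idn G.map_Idn F.map_Cmp G.map_Cmp F.map_Ob G.map_Ob)
qed

lemma cat_functor_id:
  assumes "category A"
  shows "cat_functor A A (\<lambda>a \<in> Ob A. a) (\<lambda>f \<in> Ar A. f)"
proof -
  interpret category A by fact
  show ?thesis by unfold_locales (auto simp: hom_def)
qed

lemma composable_pairs_simps [simp]:
  "(g, f) \<in> Ob (composable_pairs C P R) \<longleftrightarrow> g \<in> Ob C \<and> f \<in> Ob C \<and> P g f"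
  "(\<psi>, \<phi>) \<in> Ar (composable_pairs C P R) \<longleftrightarrow> \<psi> \<in> Ar C \<and> \<phi> \<in> Ar C \<and> R \<psi> \<phi>"
  "Dom (composable_pairs C P R) (\<psi>, \<phi>) = (Dom C \<psi>, Dom C \<phi>)"
  "Cod (composable_pairs C P R) (\<psi>, \<phi>) = (Cod C \<psi>, Cod C \<phi>)"
  "Idn (composable_pairs C P R) (g, f) = (Idn C g, Idn C f)"
  "Cmp (composable_pairs C P R) (\<psi>', \<phi>') (\<psi>, \<phi>) = (Cmp C \<psi>' \<psi>, Cmp C \<phi>' \<phi>)"
  by (auto simp: composable_pairs_def)

text \<open>The hypotheses make \<open>P\<close> and \<open>R\<close> stable under boundaries,
  identities and composition, so the pairs form a subcategory of the product of \<open>C\<close>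
  with itself.\<close>

lemma category_composable_pairs:
  assumes "category C"
    and "\<And>\<psi> \<phi>. \<psi> \<in> Ar C \<Longrightarrow> \<phi> \<in> Ar C \<Longrightarrow> R \<psi> \<phi> \<Longrightarrow> P (Dom C \<psi>) (Dom C \<phi>) \<and> P (Cod C \<psi>) (Cod C \<phi>)"
    and "\<And>g f. g \<in> Ob C \<Longrightarrow> f \<in> Ob C \<Longrightarrow> P g f \<Longrightarrow> R (Idn C g) (Idn C f)"
    and "\<And>\<psi>' \<phi>' \<psi> \<phi>. \<psi> \<in> Ar C \<Longrightarrow> \<phi> \<in> Ar C \<Longrightarrow> R \<psi> \<phi> \<Longrightarrow> \<psi>' \<in> Ar C \<Longrightarrow> \<phi>' \<in> Ar C \<Longrightarrow> R \<psi>' \<phi>'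
      \<Longrightarrow> Dom C \<psi>' = Cod C \<psi> \<Longrightarrow> Dom C \<phi>' = Cod C \<phi> \<Longrightarrow> R (Cmp C \<psi>' \<psi>) (Cmp C \<phi>' \<phi>)"
  shows "category (composable_pairs C P R)"
proof -
  interpret category C by fact
  show ?thesis by unfold_locales (auto simp: hom_def Cmp_assoc assms(2-))
qed

lemma category_full_subcategory:
  assumes "category C"
  shows "category (full_subcategory C S)"
proof -
  interpret category C by fact
  show ?thesis
    by (rule category.intro) (auto simp: full_subcategory_def hom_def Cmp_assoc)
qed

section \<open>Decorated bicategories\<close>

sublocale bicategory \<subseteq> cells: category "Cells B"
  by (rule cells)

lemma bicat_pairs_simps [simp]:
  "(g, f) \<in> Ob (bicat_pairs B) \<longleftrightarrow> g \<in> Cell1 B \<and> f \<in> Cell1 B \<and> src1 B g = trg1 B f"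
  "(\<psi>, \<phi>) \<in> Ar (bicat_pairs B) \<longleftrightarrow>
     \<psi> \<in> Cell2 B \<and> \<phi> \<in> Cell2 B \<and> src1 B (top2 B \<psi>) = trg1 B (top2 B \<phi>)"
  "Dom (bicat_pairs B) (\<psi>, \<phi>) = (top2 B \<psi>, top2 B \<phi>)"
  "Cod (bicat_pairs B) (\<psi>, \<phi>) = (bot2 B \<psi>, bot2 B \<phi>)"
  "Idn (bicat_pairs B) (g, f) = (id2 B g, id2 B f)"
  "Cmp (bicat_pairs B) (\<psi>', \<phi>') (\<psi>, \<phi>) = (vcomp2 B \<psi>' \<psi>, vcomp2 B \<phi>' \<phi>)"
  by (auto simp: bicat_pairs_def)

context bicategory
begin

declare src1_Cell0 [simp] trg1_Cell0 [simp] parallel_src [simp] parallel_trg [simp]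
  unit1_Cell1 [simp] src1_unit1 [simp] trg1_unit1 [simp] src1_comp1 [simp] trg1_comp1 [simp]
  bassoc_natural [simp] blunit_natural [simp] brunit_natural [simp]

lemma comp1_Cell1 [simp]: "f \<in> Cell1 B \<Longrightarrow> g \<in> Cell1 B \<Longrightarrow> src1 B g = trg1 B f \<Longrightarrow> g \<odot> f \<in> Cell1 B"
  using cat_functor.map_Ob[OF comp_functor, of "(g, f)"] by simp

lemma
  assumes "\<phi> \<in> Cell2 B" "\<psi> \<in> Cell2 B" "src1 B (top2 B \<psi>) = trg1 B (top2 B \<phi>)"
  shows hcomp2_Cell2 [simp]: "\<psi> \<star> \<phi> \<in> Cell2 B"
    and top2_hcomp2 [simp]: "top2 B (\<psi> \<star> \<phi>) = top2 B \<psi> \<odot> top2 B \<phi>"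
    and bot2_hcomp2 [simp]: "bot2 B (\<psi> \<star> \<phi>) = bot2 B \<psi> \<odot> bot2 B \<phi>"
  using cat_functor.map_hom[OF comp_functor, of "(\<psi>, \<phi>)"] assms by (auto simp: hom_def)

lemma hcomp2_id2:
  "f \<in> Cell1 B \<Longrightarrow> g \<in> Cell1 B \<Longrightarrow> src1 B g = trg1 B f \<Longrightarrow> id2 B g \<star> id2 B f = id2 B (g \<odot> f)"
  using cat_functor.map_Idn[OF comp_functor, of "(g, f)"] by simp

lemma interchange2:
  assumes "\<phi> \<in> Cell2 B" "\<psi> \<in> Cell2 B" "src1 B (top2 B \<psi>) = trg1 B (top2 B \<phi>)"
    and "\<phi>' \<in> Cell2 B" "\<psi>' \<in> Cell2 B" "top2 B \<psi>' = bot2 B \<psi>" "top2 B \<phi>' = bot2 B \<phi>"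
  shows "(\<psi>' \<cdot> \<psi>) \<star> (\<phi>' \<cdot> \<phi>) = (\<psi>' \<star> \<phi>') \<cdot> (\<psi> \<star> \<phi>)"
  using cat_functor.map_Cmp[OF comp_functor, of "(\<psi>, \<phi>)" "(\<psi>', \<phi>')"] assms by simp

lemma whisker_right_vcomp2:
  assumes "\<psi> \<in> Cell2 B" "\<psi>' \<in> Cell2 B" "top2 B \<psi>' = bot2 B \<psi>" "f \<in> Cell1 B" "src1 B (top2 B \<psi>)
    = trg1 B f"
  shows "(\<psi>' \<cdot> \<psi>) \<star> id2 B f = (\<psi>' \<star> id2 B f) \<cdot> (\<psi> \<star> id2 B f)"
  using interchange2[of "id2 B f" \<psi> "id2 B f" \<psi>'] assms by simp

lemma whisker_left_vcomp2:
  assumes "\<phi> \<in> Cell2 B" "\<phi>' \<in> Cell2 B" "top2 B \<phi>' = bot2 B \<phi>" "g \<in> Cell1 B" "src1 B g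
    = trg1 B (top2 B \<phi>)"
  shows "id2 B g \<star> (\<phi>' \<cdot> \<phi>) = (id2 B g \<star> \<phi>') \<cdot> (id2 B g \<star> \<phi>)"
  using interchange2[of \<phi> "id2 B g" \<phi>' "id2 B g"] assms by simp

lemma
  assumes "f \<in> Cell1 B" "g \<in> Cell1 B" "h \<in> Cell1 B" "src1 B g = trg1 B f" "src1 B h = trg1 B g"
  shows bassoc_Cell2 [simp]: "bassoc B h g f \<in> Cell2 B"
    and top2_bassoc [simp]: "top2 B (bassoc B h g f) = (h \<odot> g) \<odot> f"
    and bot2_bassoc [simp]: "bot2 B (bassoc B h g f) = h \<odot> (g \<odot> f)"
  using cells.isosD[OF bassoc_iso[OF assms]] by auto

lemma
  assumes "f \<in> Cell1 B"
  shows blunit_Cell2 [simp]: "blunit B f \<in> Cell2 B"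
    and top2_blunit [simp]: "top2 B (blunit B f) = unit1 B (trg1 B f) \<odot> f"
    and bot2_blunit [simp]: "bot2 B (blunit B f) = f"
    and brunit_Cell2 [simp]: "brunit B f \<in> Cell2 B"
    and top2_brunit [simp]: "top2 B (brunit B f) = f \<odot> unit1 B (src1 B f)"
    and bot2_brunit [simp]: "bot2 B (brunit B f) = f"
  using cells.isosD[OF blunit_iso[OF assms]] cells.isosD[OF brunit_iso[OF assms]] by auto

text \<open>Two inverses form an inverse in the category of composable pairs, and horizontal
  composition, being a functor on it, preserves isomorphisms.\<close>

lemma hcomp2_isos:
  assumes \<phi>: "\<phi> \<in> isos (Cells B) f f'" and \<psi>: "\<psi> \<in> isos (Cells B) g g'" and "src1 B g = trg1 B f"
  shows "\<psi> \<star> \<phi> \<in> isos (Cells B) (g \<odot> f) (g' \<odot> f')"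
proof -
  have "(\<psi>, \<phi>) \<in> isos (bicat_pairs B) (g, f) (g', f')"
  proof -
    interpret P: category "bicat_pairs B"
      using comp_functor by (simp add: cat_functor_def)
    obtain \<phi>' where "\<phi>' \<in> Cell2 B" "top2 B \<phi>' = f'" "bot2 B \<phi>' = f" "\<phi>' \<cdot> \<phi> = id2 B f" "\<phi> \<cdot> \<phi>'
      = id2 B f'"
      using \<phi> by (rule cells.isosE)
    moreover obtain \<psi>' where "\<psi>' \<in> Cell2 B" "top2 B \<psi>' = g'" "bot2 B \<psi>' = g"
      "\<psi>' \<cdot> \<psi> = id2 B g" "\<psi> \<cdot> \<psi>' = id2 B g'"
      using \<psi> by (rule cells.isosE)
    \<comment> \<open>The pair of inverses starts at the codomains; since 2-cells have parallel
      boundaries, these are composable too.\<close>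
    moreover have "src1 B g' = trg1 B f'"
      using assms(3) parallel_src[of \<psi>] parallel_trg[of \<phi>] cells.isosD[OF \<phi>] cells.isosD[OF \<psi>] by simp
    ultimately show ?thesis
      using cells.isosD[OF \<phi>] cells.isosD[OF \<psi>] assms(3)
      by (intro P.isosI[where q = "(\<psi>', \<phi>')"]) auto
  qed
  from cat_functor.map_isos[OF comp_functor this] show ?thesis by simp
qed

end

context pseudofunctor
begin

sublocale map12: cat_functor "Cells B" "Cells B'" "map1 G" "map2 G"
  by (rule map12)

declare map0_Cell0 [simp] src1_map1 [simp] trg1_map1 [simp] map12.map_Ob [simp]

lemma
  assumes "f \<in> Cell1 B" "g \<in> Cell1 B" "src1 B g = trg1 B f"
  shows pcomp_Cell2 [simp]: "pcomp G g f \<in> Cell2 B'"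
    and top2_pcomp [simp]: "top2 B' (pcomp G g f) = map1 G g \<odot>\<^bsub>B'\<^esub> map1 G f"
    and bot2_pcomp [simp]: "bot2 B' (pcomp G g f) = map1 G (g \<odot> f)"
  using cod.cells.isosD[OF pcomp_iso[OF assms]] by auto

lemma
  assumes "a \<in> Cell0 B"
  shows punit_Cell2 [simp]: "punit G a \<in> Cell2 B'"
    and top2_punit [simp]: "top2 B' (punit G a) = unit1 B' (map0 G a)"
    and bot2_punit [simp]: "bot2 B' (punit G a) = map1 G (unit1 B a)"
  using cod.cells.isosD[OF punit_iso[OF assms]] by auto

end

declare (in decorated_bicategory) Ob_Deco [simp]

lemma (in decorated_bicategory) Deco_Cell0 [simp]:
  "u \<in> Ar (Deco B) \<Longrightarrow> Dom (Deco B) u \<in> Cell0 B"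
  "u \<in> Ar (Deco B) \<Longrightarrow> Cod (Deco B) u \<in> Cell0 B"
  using deco.Dom_Ob deco.Cod_Ob by auto

sublocale decorated_pseudofunctor \<subseteq> deco: cat_functor "Deco B" "Deco B'" "map0 G" "mapD G"
  by (rule decoration)

section \<open>Identities and composites of decorated pseudofunctors; the category
  \<open>bCat\<close>\<close>

lemma decorated_pseudofunctor_id:
  assumes "decorated_bicategory B"
  shows "decorated_pseudofunctor B B (id_dpf B)"
proof -
  interpret decorated_bicategory B by fact
  show ?thesis
    by unfold_locales
      (auto simp: id_dpf_def hom_def cells.Idn_isos hcomp2_id2 extensional_def bassoc_natural)
qed

text \<open>Each comparison cell of the composite is a \<open>G'\<close>-image of one of
  \<open>G\<close> after one of \<open>G'\<close>. In every coherence equation, naturality of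
  \<open>pcomp G'\<close> first gathers the \<open>G'\<close>-images; then the equation for
  \<open>G\<close>, mapped by \<open>G'\<close>, and the equation for \<open>G'\<close> apply one
  after the other.\<close>

lemma decorated_pseudofunctor_comp:
  assumes "decorated_pseudofunctor B B' G" "decorated_pseudofunctor B' B'' G'"
  shows "decorated_pseudofunctor B B'' (comp_dpf B B'' G' G)"
proof -
  interpret G: decorated_pseudofunctor B B' G by fact
  interpret G': decorated_pseudofunctor B' B'' G' by fact
  let ?H = "comp_dpf B B'' G' G"
  note [simp] = G'.cod.cells.Cmp_assoc
  have [simp]:
    "\<And>a. a \<in> Cell0 B \<Longrightarrow> map0 ?H a = map0 G' (map0 G a)"
    "\<And>f. f \<in> Cell1 B \<Longrightarrow> map1 ?H f = map1 G' (map1 G f)"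
    "\<And>\<phi>. \<phi> \<in> Cell2 B \<Longrightarrow> map2 ?H \<phi> = map2 G' (map2 G \<phi>)"
    "\<And>g f. f \<in> Cell1 B \<Longrightarrow> g \<in> Cell1 B \<Longrightarrow> src1 B g = trg1 B f
      \<Longrightarrow> pcomp ?H g f = vcomp2 B'' (map2 G' (pcomp G g f)) (pcomp G' (map1 G g) (map1 G f))"
    "\<And>a. a \<in> Cell0 B \<Longrightarrow> punit ?H a = vcomp2 B'' (map2 G' (punit G a)) (punit G' (map0 G a))"
    "\<And>u. u \<in> Ar (Deco B) \<Longrightarrow> mapD ?H u = mapD G' (mapD G u)"
    by (auto simp: comp_dpf_def compose_def)
  note whisker [simp] = G'.cod.whisker_right_vcomp2 G'.cod.whisker_left_vcomp2
  have assoc: "map2 ?H (bassoc B h g f) \<cdot>\<^bsub>B''\<^esub> pcomp ?H (h \<odot>\<^bsub>B\<^esub> g) f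
           \<cdot>\<^bsub>B''\<^esub> (pcomp ?H h g \<star>\<^bsub>B''\<^esub> id2 B'' (map1 ?H f))
         = pcomp ?H h (g \<odot>\<^bsub>B\<^esub> f) \<cdot>\<^bsub>B''\<^esub> (id2 B'' (map1 ?H h) \<star>\<^bsub>B''\<^esub> pcomp ?H g f)
           \<cdot>\<^bsub>B''\<^esub> bassoc B'' (map1 ?H h) (map1 ?H g) (map1 ?H f)"
    if "f \<in> Cell1 B" "g \<in> Cell1 B" "h \<in> Cell1 B" "src1 B g = trg1 B f" "src1 B h = trg1 B g" for f g h
  proof -
    note [simp] = that
    \<comment> \<open>\<open>n1\<close> and \<open>n2\<close> slide comparison cells of
      \<open>G'\<close> past images of those of \<open>G\<close>; \<open>c1\<close> is the coherence
      of \<open>G\<close> under \<open>G'\<close>, and \<open>c2\<close> is the coherence of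
      \<open>G'\<close> at the images.\<close>
    have n1: "pcomp G' (map1 G (h \<odot>\<^bsub>B\<^esub> g)) (map1 G f)
      \<cdot>\<^bsub>B''\<^esub> (map2 G' (pcomp G h g) \<star>\<^bsub>B''\<^esub> id2 B'' (map1 G' (map1 G f)))
      = map2 G' (pcomp G h g \<star>\<^bsub>B'\<^esub> id2 B' (map1 G f))
        \<cdot>\<^bsub>B''\<^esub> pcomp G' (map1 G h \<odot>\<^bsub>B'\<^esub> map1 G g) (map1 G f)"
      using G'.pcomp_natural[of "id2 B' (map1 G f)" "pcomp G h g"] by (simp add: G'.map12.map_Idn)
    have n2: "pcomp G' (map1 G h) (map1 G (g \<odot>\<^bsub>B\<^esub> f))
      \<cdot>\<^bsub>B''\<^esub> (id2 B'' (map1 G' (map1 G h)) \<star>\<^bsub>B''\<^esub> map2 G' (pcomp G g f))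
      = map2 G' (id2 B' (map1 G h) \<star>\<^bsub>B'\<^esub> pcomp G g f)
        \<cdot>\<^bsub>B''\<^esub> pcomp G' (map1 G h) (map1 G g \<odot>\<^bsub>B'\<^esub> map1 G f)"
      using G'.pcomp_natural[of "pcomp G g f" "id2 B' (map1 G h)"] by (simp add: G'.map12.map_Idn)
    have c1: "map2 G' (map2 G (bassoc B h g f)) \<cdot>\<^bsub>B''\<^esub> (map2 G' (pcomp G (h \<odot>\<^bsub>B\<^esub> g) f)
           \<cdot>\<^bsub>B''\<^esub> map2 G' (pcomp G h g \<star>\<^bsub>B'\<^esub> id2 B' (map1 G f)))
         = map2 G' (pcomp G h (g \<odot>\<^bsub>B\<^esub> f)) \<cdot>\<^bsub>B''\<^esub> (map2 G' (id2 B' (map1 G h) \<star>\<^bsub>B'\<^esub> pcomp G g f)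
           \<cdot>\<^bsub>B''\<^esub> map2 G' (bassoc B' (map1 G h) (map1 G g) (map1 G f)))"
      using arg_cong[OF G.bassoc_coherent[of f g h], of "map2 G'"] by (simp add: G'.map12.map_Cmp)
    have c2: "map2 G' (bassoc B' (map1 G h) (map1 G g) (map1 G f))
      \<cdot>\<^bsub>B''\<^esub> (pcomp G' (map1 G h \<odot>\<^bsub>B'\<^esub> map1 G g) (map1 G f)
           \<cdot>\<^bsub>B''\<^esub> (pcomp G' (map1 G h) (map1 G g) \<star>\<^bsub>B''\<^esub> id2 B'' (map1 G' (map1 G f))))
         = pcomp G' (map1 G h) (map1 G g \<odot>\<^bsub>B'\<^esub> map1 G f)
           \<cdot>\<^bsub>B''\<^esub> ((id2 B'' (map1 G' (map1 G h)) \<star>\<^bsub>B''\<^esub> pcomp G' (map1 G g) (map1 G f))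
           \<cdot>\<^bsub>B''\<^esub> bassoc B'' (map1 G' (map1 G h)) (map1 G' (map1 G g)) (map1 G' (map1 G f)))"
      using G'.bassoc_coherent[of "map1 G f" "map1 G g" "map1 G h"] by simp
    show ?thesis
      by (simp add: G'.cod.cells.Cmp_reassoc[OF n1] G'.cod.cells.Cmp_reassoc3[OF c1] c2 G'.cod.cells.Cmp_reassoc[OF n2])
  qed
  have lunit: "map2 ?H (blunit B f) \<cdot>\<^bsub>B''\<^esub> pcomp ?H (unit1 B (trg1 B f)) f
           \<cdot>\<^bsub>B''\<^esub> (punit ?H (trg1 B f) \<star>\<^bsub>B''\<^esub> id2 B'' (map1 ?H f))
         = blunit B'' (map1 ?H f)" if "f \<in> Cell1 B" for f
  proof -
    note [simp] = that
    let ?a = "trg1 B f"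
    have n: "pcomp G' (map1 G (unit1 B ?a)) (map1 G f)
      \<cdot>\<^bsub>B''\<^esub> (map2 G' (punit G ?a) \<star>\<^bsub>B''\<^esub> id2 B'' (map1 G' (map1 G f)))
      = map2 G' (punit G ?a \<star>\<^bsub>B'\<^esub> id2 B' (map1 G f)) \<cdot>\<^bsub>B''\<^esub> pcomp G' (unit1 B' (map0 G ?a)) (map1 G f)"
      using G'.pcomp_natural[of "id2 B' (map1 G f)" "punit G ?a"] by (simp add: G'.map12.map_Idn)
    have c1: "map2 G' (map2 G (blunit B f)) \<cdot>\<^bsub>B''\<^esub> (map2 G' (pcomp G (unit1 B ?a) f)
           \<cdot>\<^bsub>B''\<^esub> map2 G' (punit G ?a \<star>\<^bsub>B'\<^esub> id2 B' (map1 G f))) = map2 G' (blunit B' (map1 G f))"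
      using arg_cong[OF G.blunit_coherent[of f], of "map2 G'"] by (simp add: G'.map12.map_Cmp)
    show ?thesis
      using G'.blunit_coherent[of "map1 G f"]
      by (simp add: G'.cod.cells.Cmp_reassoc[OF n] G'.cod.cells.Cmp_reassoc3[OF c1])
  qed
  have runit: "map2 ?H (brunit B f) \<cdot>\<^bsub>B''\<^esub> pcomp ?H f (unit1 B (src1 B f))
           \<cdot>\<^bsub>B''\<^esub> (id2 B'' (map1 ?H f) \<star>\<^bsub>B''\<^esub> punit ?H (src1 B f))
         = brunit B'' (map1 ?H f)" if "f \<in> Cell1 B" for f
  proof -
    note [simp] = that
    let ?a = "src1 B f"
    have n: "pcomp G' (map1 G f) (map1 G (unit1 B ?a))
      \<cdot>\<^bsub>B''\<^esub> (id2 B'' (map1 G' (map1 G f)) \<star>\<^bsub>B''\<^esub> map2 G' (punit G ?a))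
      = map2 G' (id2 B' (map1 G f) \<star>\<^bsub>B'\<^esub> punit G ?a) \<cdot>\<^bsub>B''\<^esub> pcomp G' (map1 G f) (unit1 B' (map0 G ?a))"
      using G'.pcomp_natural[of "punit G ?a" "id2 B' (map1 G f)"] by (simp add: G'.map12.map_Idn)
    have c1: "map2 G' (map2 G (brunit B f)) \<cdot>\<^bsub>B''\<^esub> (map2 G' (pcomp G f (unit1 B ?a))
           \<cdot>\<^bsub>B''\<^esub> map2 G' (id2 B' (map1 G f) \<star>\<^bsub>B'\<^esub> punit G ?a)) = map2 G' (brunit B' (map1 G f))"
      using arg_cong[OF G.brunit_coherent[of f], of "map2 G'"] by (simp add: G'.map12.map_Cmp)
    show ?thesis
      using G'.brunit_coherent[of "map1 G f"]
      by (simp add: G'.cod.cells.Cmp_reassoc[OF n] G'.cod.cells.Cmp_reassoc3[OF c1])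
  qed
  have natural: "pcomp ?H (bot2 B \<psi>) (bot2 B \<phi>) \<cdot>\<^bsub>B''\<^esub> (map2 ?H \<psi> \<star>\<^bsub>B''\<^esub> map2 ?H \<phi>)
         = map2 ?H (\<psi> \<star>\<^bsub>B\<^esub> \<phi>) \<cdot>\<^bsub>B''\<^esub> pcomp ?H (top2 B \<psi>) (top2 B \<phi>)"
    if "\<phi> \<in> Cell2 B" "\<psi> \<in> Cell2 B" "src1 B (top2 B \<psi>) = trg1 B (top2 B \<phi>)" for \<phi> \<psi>
  proof -
    note [simp] = that
    have "map2 G' (pcomp G (bot2 B \<psi>) (bot2 B \<phi>)) \<cdot>\<^bsub>B''\<^esub> map2 G' (map2 G \<psi> \<star>\<^bsub>B'\<^esub> map2 G \<phi>)
         = map2 G' (map2 G (\<psi> \<star>\<^bsub>B\<^esub> \<phi>)) \<cdot>\<^bsub>B''\<^esub> map2 G' (pcomp G (top2 B \<psi>) (top2 B \<phi>))"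
      using arg_cong[OF G.pcomp_natural[of \<phi> \<psi>], of "map2 G'"] by (simp add: G'.map12.map_Cmp)
    from G'.cod.cells.Cmp_reassoc[OF this] show ?thesis
      using G'.pcomp_natural[of "map2 G \<phi>" "map2 G \<psi>"] by simp
  qed
  have functors: "cat_functor (Cells B) (Cells B'') (map1 ?H) (map2 ?H)"
    "cat_functor (Deco B) (Deco B'') (map0 ?H) (mapD ?H)"
    using cat_functor_compose[OF G.map12 G'.map12] cat_functor_compose[OF G.decoration G'.decoration]
    by (simp_all add: comp_dpf_def)
  have iso: "pcomp ?H g f \<in> isos (Cells B'') (map1 ?H g \<odot>\<^bsub>B''\<^esub> map1 ?H f) (map1 ?H (g \<odot>\<^bsub>B\<^esub> f))"
    if "f \<in> Cell1 B" "g \<in> Cell1 B" "src1 B g = trg1 B f" for f g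
    using that G'.cod.cells.Cmp_isos[OF G'.pcomp_iso G'.map12.map_isos[OF G.pcomp_iso]] by simp
  have iso': "punit ?H a \<in> isos (Cells B'') (unit1 B'' (map0 ?H a)) (map1 ?H (unit1 B a))"
    if "a \<in> Cell0 B" for a
    using that G'.cod.cells.Cmp_isos[OF G'.punit_iso G'.map12.map_isos[OF G.punit_iso]] by simp
  have ext: "map0 ?H \<in> extensional (Cell0 B)" "map1 ?H \<in> extensional (Cell1 B)"
    "map2 ?H \<in> extensional (Cell2 B)" "case_prod (pcomp ?H) \<in> extensional (Ob (bicat_pairs B))"
    "punit ?H \<in> extensional (Cell0 B)" "mapD ?H \<in> extensional (Ar (Deco B))"
    by (simp_all add: comp_dpf_def)
  show ?thesis
    by (intro_locales; (unfold pseudofunctor_axioms_def decorated_pseudofunctor_axioms_def)?)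
      (use functors iso iso' natural assoc lunit runit ext in simp_all)
qed

text \<open>\<open>pcomp\<close> is curried while its extensionality is stated on pairs, so
  \<open>extensional_arb\<close> does not apply to it directly.\<close>

lemma (in pseudofunctor) pcomp_undefined:
  "\<not> (g \<in> Cell1 B \<and> f \<in> Cell1 B \<and> src1 B g = trg1 B f) \<Longrightarrow> pcomp G g f = undefined"
  using pcomp_ext by (auto simp: extensional_def)

lemma compose_id_right: "F \<in> extensional A \<Longrightarrow> compose A F (\<lambda>x \<in> A. x) = F"
  by (auto simp: compose_def extensional_def)

lemma compose_id_left:
  "F \<in> extensional A \<Longrightarrow> (\<And>x. x \<in> A \<Longrightarrow> F x \<in> A') \<Longrightarrow> compose A (\<lambda>x \<in> A'. x) F = F"
  by (auto simp: compose_def extensional_def)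


text \<open>The equality is strict because all data are \<open>undefined\<close> off the carriers;
  on comparison cells it is a unit law, as \<open>map2 G\<close> preserves identities.\<close>

lemma comp_dpf_id_right:
  assumes "decorated_pseudofunctor B B' G"
  shows "comp_dpf B B' G (id_dpf B) = G"
proof -
  interpret decorated_pseudofunctor B B' G by fact
  show ?thesis
    using map0_ext map1_ext map2_ext punit_ext mapD_ext
    by (intro decpseudofun.equality ext)
      (auto simp: comp_dpf_def id_dpf_def compose_def map12.map_Idn pcomp_undefined dest: extensional_arb)
qed

lemma comp_dpf_id_left:
  assumes "decorated_pseudofunctor B B' G"
  shows "comp_dpf B B' (id_dpf B') G = G"
proof -
  interpret decorated_pseudofunctor B B' G by fact
  show ?thesis
    using map0_ext map1_ext map2_ext punit_ext mapD_ext
    by (intro decpseudofun.equality ext)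
      (auto simp: comp_dpf_def id_dpf_def compose_def pcomp_undefined dest: extensional_arb)
qed

text \<open>On comparison cells this amounts to \<open>map2 H\<close> preserving the vertical
  composite of a \<open>G\<close>-image and a comparison cell of \<open>G\<close>.\<close>

lemma comp_dpf_assoc:
  assumes "decorated_pseudofunctor A B F" "decorated_pseudofunctor B C G" "decorated_pseudofunctor C D H"
  shows "comp_dpf A D (comp_dpf B D H G) F = comp_dpf A D H (comp_dpf A C G F)"
proof -
  interpret F: decorated_pseudofunctor A B F by fact
  interpret G: decorated_pseudofunctor B C G by fact
  interpret H: decorated_pseudofunctor C D H by fact
  show ?thesis
    by (intro decpseudofun.equality ext)
      (auto simp: comp_dpf_def compose_def H.map12.map_Cmp H.cod.cells.Cmp_assoc)
qed

lemma category_bCat: "category bCat"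
proof unfold_locales
  fix f g h :: "'u small_dpf"
  show "f \<in> Ar bCat \<Longrightarrow> Dom bCat f \<in> Ob bCat" "f \<in> Ar bCat \<Longrightarrow> Cod bCat f \<in> Ob bCat"
    by (auto simp: bCat_def decorated_pseudofunctor_def)
  show "B \<in> Ob bCat \<Longrightarrow> Idn bCat B \<in> hom bCat B B" for B :: "'u small_decbicat"
    by (auto simp: bCat_def hom_def decorated_pseudofunctor_id)
  show "f \<in> Ar bCat \<Longrightarrow> Cmp bCat f (Idn bCat (Dom bCat f)) = f"
    "f \<in> Ar bCat \<Longrightarrow> Cmp bCat (Idn bCat (Cod bCat f)) f = f"
    by (auto simp: bCat_def comp_dpf_id_right comp_dpf_id_left)
  show "f \<in> Ar bCat \<Longrightarrow> g \<in> Ar bCat \<Longrightarrow> Dom bCat g = Cod bCat f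
    \<Longrightarrow> Cmp bCat g f \<in> hom bCat (Dom bCat f) (Cod bCat g)"
    by (auto simp: bCat_def hom_def intro: decorated_pseudofunctor_comp)
  show "f \<in> Ar bCat \<Longrightarrow> g \<in> Ar bCat \<Longrightarrow> h \<in> Ar bCat \<Longrightarrow> Dom bCat g = Cod bCat f \<Longrightarrow> Dom bCat h = Cod bCat g
    \<Longrightarrow> Cmp bCat (Cmp bCat h g) f = Cmp bCat h (Cmp bCat g f)"
    by (auto simp: bCat_def comp_dpf_assoc)
qed

section \<open>Double categories and the functor \<open>H\<^sup>*\<close>\<close>

sublocale double_category \<subseteq> sqrs: category "Sqr D" + vers: category "Ver D"
  using lft by (simp_all add: cat_functor_def)

sublocale double_category \<subseteq> lft: cat_functor "Sqr D" "Ver D" "lftH D" "lftS D"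
  by (rule lft)

sublocale double_category \<subseteq> rgt: cat_functor "Sqr D" "Ver D" "rgtH D" "rgtS D"
  by (rule rgt)

sublocale double_category \<subseteq> hid: cat_functor "Ver D" "Sqr D" "hidH D" "hidS D"
  by (rule hid)

lemma dbl_pairs_simps [simp]:
  "(g, f) \<in> Ob (dbl_pairs D) \<longleftrightarrow> g \<in> hor D \<and> f \<in> hor D \<and> lftH D g = rgtH D f"
  "(\<psi>, \<phi>) \<in> Ar (dbl_pairs D) \<longleftrightarrow> \<psi> \<in> sqr D \<and> \<phi> \<in> sqr D \<and> lftS D \<psi> = rgtS D \<phi>"
  "Dom (dbl_pairs D) (\<psi>, \<phi>) = (sqtop D \<psi>, sqtop D \<phi>)"
  "Cod (dbl_pairs D) (\<psi>, \<phi>) = (sqbot D \<psi>, sqbot D \<phi>)"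
  "Idn (dbl_pairs D) (g, f) = (vid D g, vid D f)"
  "Cmp (dbl_pairs D) (\<psi>', \<phi>') (\<psi>, \<phi>) = (vcmp D \<psi>' \<psi>, vcmp D \<phi>' \<phi>)"
  by (auto simp: dbl_pairs_def)

lemma Hstar_simps [simp]:
  "Cell0 (Hstar D) = obj D" "Cell1 (Hstar D) = hor D" "Cell2 (Hstar D) = globular D"
  "top2 (Hstar D) = sqtop D" "bot2 (Hstar D) = sqbot D" "id2 (Hstar D) = vid D"
  "vcomp2 (Hstar D) = vcmp D" "src1 (Hstar D) = lftH D" "trg1 (Hstar D) = rgtH D"
  "unit1 (Hstar D) = hidH D" "comp1 (Hstar D) = hcmpH D" "hcomp2 (Hstar D) = hcmpS D"
  "bassoc (Hstar D) = assoc D" "blunit (Hstar D) = lunit D" "brunit (Hstar D) = runit D"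
  "Deco (Hstar D) = Ver D"
  by (simp_all add: Hstar_def)

section \<open>Globular squares and the horizontal bicategory of a double category\<close>

context double_category
begin

declare lft.map_Ob [simp] rgt.map_Ob [simp] hid.map_Ob [simp]
  lft.map_Idn [simp] rgt.map_Idn [simp] hid.map_Idn [simp]
  lft.map_Cmp [simp] rgt.map_Cmp [simp]
  lftH_hidH [simp] rgtH_hidH [simp] lftS_hidS [simp] rgtS_hidS [simp]
  lftH_hcmpH [simp] rgtH_hcmpH [simp] lftS_hcmpS [simp] rgtS_hcmpS [simp]

lemma hcmpH_hor [simp]: "f \<in> hor D \<Longrightarrow> g \<in> hor D \<Longrightarrow> lftH D g = rgtH D f \<Longrightarrow> g \<otimes> f \<in> hor D"
  using cat_functor.map_Ob[OF hcmp, of "(g, f)"] by simp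

lemma
  assumes "\<Phi> \<in> sqr D" "\<Psi> \<in> sqr D" "lftS D \<Psi> = rgtS D \<Phi>"
  shows hcmpS_sqr [simp]: "\<Psi> \<ast> \<Phi> \<in> sqr D"
    and sqtop_hcmpS [simp]: "sqtop D (\<Psi> \<ast> \<Phi>) = sqtop D \<Psi> \<otimes> sqtop D \<Phi>"
    and sqbot_hcmpS [simp]: "sqbot D (\<Psi> \<ast> \<Phi>) = sqbot D \<Psi> \<otimes> sqbot D \<Phi>"
  using cat_functor.map_hom[OF hcmp, of "(\<Psi>, \<Phi>)"] assms by (auto simp: hom_def)

lemma hcmpS_vid:
  "f \<in> hor D \<Longrightarrow> g \<in> hor D \<Longrightarrow> lftH D g = rgtH D f \<Longrightarrow> vid D g \<ast> vid D f = vid D (g \<otimes> f)"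
  using cat_functor.map_Idn[OF hcmp, of "(g, f)"] by simp

lemma interchange:
  assumes "\<Phi> \<in> sqr D" "\<Psi> \<in> sqr D" "lftS D \<Psi> = rgtS D \<Phi>"
    and "\<Phi>' \<in> sqr D" "\<Psi>' \<in> sqr D" "lftS D \<Psi>' = rgtS D \<Phi>'" "sqtop D \<Psi>' = sqbot D \<Psi>" "sqtop D \<Phi>'
      = sqbot D \<Phi>"
  shows "(\<Psi>' \<bullet> \<Psi>) \<ast> (\<Phi>' \<bullet> \<Phi>) = (\<Psi>' \<ast> \<Phi>') \<bullet> (\<Psi> \<ast> \<Phi>)"
  using cat_functor.map_Cmp[OF hcmp, of "(\<Psi>, \<Phi>)" "(\<Psi>', \<Phi>')"] assms by simp

lemma globular_sqr [simp]: "\<Phi> \<in> globular D \<Longrightarrow> \<Phi> \<in> sqr D"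
  by (simp add: globular_def)

text \<open>Globularity only says that the edge is the identity of some object; the domain of the
  edge determines which one.\<close>

lemma globular_lftS [simp]:
  assumes "\<Phi> \<in> globular D"
  shows "lftS D \<Phi> = Idn (Ver D) (lftH D (sqtop D \<Phi>))"
proof -
  have \<Phi>: "\<Phi> \<in> sqr D" "lftS D \<Phi> \<in> Idn (Ver D) ` obj D"
    using assms unfolding globular_def by blast+
  then obtain a where a: "a \<in> obj D" "lftS D \<Phi> = Idn (Ver D) a"
    by blast
  have "Dom (Ver D) (Idn (Ver D) a) = lftH D (sqtop D \<Phi>)"
    using lft.Dom_Fa[OF \<Phi>(1)] unfolding a(2) .
  then show ?thesis
    unfolding a(2) vers.Dom_Idn[OF a(1)] by (rule arg_cong)
qed

lemma globular_rgtS [simp]: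
  assumes "\<Phi> \<in> globular D"
  shows "rgtS D \<Phi> = Idn (Ver D) (rgtH D (sqtop D \<Phi>))"
proof -
  have \<Phi>: "\<Phi> \<in> sqr D" "rgtS D \<Phi> \<in> Idn (Ver D) ` obj D"
    using assms unfolding globular_def by blast+
  then obtain a where a: "a \<in> obj D" "rgtS D \<Phi> = Idn (Ver D) a"
    by blast
  have "Dom (Ver D) (Idn (Ver D) a) = rgtH D (sqtop D \<Phi>)"
    using rgt.Dom_Fa[OF \<Phi>(1)] unfolding a(2) .
  then show ?thesis
    unfolding a(2) vers.Dom_Idn[OF a(1)] by (rule arg_cong)
qed

lemma globularI:
  "\<Phi> \<in> sqr D \<Longrightarrow> lftS D \<Phi> = Idn (Ver D) a \<Longrightarrow> rgtS D \<Phi> = Idn (Ver D) b \<Longrightarrow> a \<in> obj D \<Longrightarrow> b \<in> obj D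
    \<Longrightarrow> \<Phi> \<in> globular D"
  unfolding globular_def by blast

text \<open>An identity edge has equal ends, hence top and bottom are parallel, as a bicategory
  demands of its 2-cells.\<close>

lemma globular_bot [simp]:
  assumes \<Phi>: "\<Phi> \<in> globular D"
  shows "lftH D (sqbot D \<Phi>) = lftH D (sqtop D \<Phi>)" "rgtH D (sqbot D \<Phi>) = rgtH D (sqtop D \<Phi>)"
  using lft.Cod_Fa[OF globular_sqr[OF \<Phi>]] rgt.Cod_Fa[OF globular_sqr[OF \<Phi>]]
  by (simp_all only: globular_lftS[OF \<Phi>] globular_rgtS[OF \<Phi>] globular_sqr[OF \<Phi>]
      vers.Cod_Idn lft.map_Ob rgt.map_Ob sqrs.Dom_Ob)

lemma vid_globular [simp]: "f \<in> hor D \<Longrightarrow> vid D f \<in> globular D"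
  by (rule globularI[where a = "lftH D f" and b = "rgtH D f"]) auto

lemma vcmp_globular [simp]:
  "\<Phi> \<in> globular D \<Longrightarrow> \<Psi> \<in> globular D \<Longrightarrow> sqtop D \<Psi> = sqbot D \<Phi> \<Longrightarrow> \<Psi> \<bullet> \<Phi> \<in> globular D"
  by (rule globularI[where a = "lftH D (sqtop D \<Phi>)" and b = "rgtH D (sqtop D \<Phi>)"]) auto

lemma hcmp_globular [simp]:
  "\<Phi> \<in> globular D \<Longrightarrow> \<Psi> \<in> globular D \<Longrightarrow> lftH D (sqtop D \<Psi>) = rgtH D (sqtop D \<Phi>) \<Longrightarrow> \<Psi> \<ast> \<Phi> \<in> globular D"
  by (rule globularI[where a = "lftH D (sqtop D \<Phi>)" and b = "rgtH D (sqtop D \<Psi>)"]) auto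

lemma
  assumes "f \<in> hor D" "g \<in> hor D" "h \<in> hor D" "lftH D g = rgtH D f" "lftH D h = rgtH D g"
  shows assoc_globular [simp]: "assoc D h g f \<in> globular D"
    and sqtop_assoc [simp]: "sqtop D (assoc D h g f) = (h \<otimes> g) \<otimes> f"
    and sqbot_assoc [simp]: "sqbot D (assoc D h g f) = h \<otimes> (g \<otimes> f)"
  using assoc_iso[OF assms] by (auto dest: sqrs.isosD)

lemma
  assumes "f \<in> hor D"
  shows lunit_globular [simp]: "lunit D f \<in> globular D"
    and sqtop_lunit [simp]: "sqtop D (lunit D f) = hidH D (rgtH D f) \<otimes> f"
    and sqbot_lunit [simp]: "sqbot D (lunit D f) = f"
    and runit_globular [simp]: "runit D f \<in> globular D"
    and sqtop_runit [simp]: "sqtop D (runit D f) = f \<otimes> hidH D (lftH D f)"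
    and sqbot_runit [simp]: "sqbot D (runit D f) = f"
  using lunit_iso[OF assms] runit_iso[OF assms] by (auto dest: sqrs.isosD)

text \<open>The point is that an inverse of a globular square is globular: applying the edge
  functors to \<open>\<Psi> \<bullet> \<Phi> = vid D f\<close>, where the edges of
  \<open>\<Phi>\<close> are identities, shows that those of \<open>\<Psi>\<close> are identities as
  well.\<close>

lemma globular_isos:
  "\<Phi> \<in> isos (Cells (Hstar D)) f g \<longleftrightarrow> \<Phi> \<in> globular D \<inter> isos (Sqr D) f g"
proof
  show "\<Phi> \<in> isos (Cells (Hstar D)) f g \<Longrightarrow> \<Phi> \<in> globular D \<inter> isos (Sqr D) f g"
    by (auto simp: isos_def hom_def intro: globular_sqr)
next
  assume \<Phi>: "\<Phi> \<in> globular D \<inter> isos (Sqr D) f g"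
  then obtain \<Psi> where \<Psi>: "\<Psi> \<in> sqr D" "sqtop D \<Psi> = g" "sqbot D \<Psi> = f" "\<Psi> \<bullet> \<Phi> = vid D f" "\<Phi> \<bullet> \<Psi> = vid D g"
    by (auto elim: sqrs.isosE)
  have f: "\<Phi> \<in> globular D" "sqtop D \<Phi> = f" "sqbot D \<Phi> = g" "f \<in> hor D" "g \<in> hor D"
    using \<Phi> by (auto dest: sqrs.isosD)
  have "lftS D \<Psi> = Idn (Ver D) (lftH D f)" "rgtS D \<Psi> = Idn (Ver D) (rgtH D f)"
    using arg_cong[OF \<Psi>(4), of "lftS D"] arg_cong[OF \<Psi>(4), of "rgtS D"] \<Psi>(1-3) f
      globular_bot[of \<Phi>] by simp_all
  then have "\<Psi> \<in> globular D"
    using \<Psi>(1) f by (intro globularI[where a = "lftH D f" and b = "rgtH D f"]) auto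
  then show "\<Phi> \<in> isos (Cells (Hstar D)) f g"
    using \<Phi> \<Psi> f unfolding isos_def hom_def by auto
qed

lemma category_Hstar: "category (Cells (Hstar D))"
  by (rule category.intro) (auto simp: hom_def sqrs.Cmp_assoc)

lemma decorated_bicategory_Hstar: "decorated_bicategory (Hstar D)"
proof -
  have pairs: "category (bicat_pairs (Hstar D))"
    unfolding bicat_pairs_def by (rule category_composable_pairs[OF category_Hstar], simp_all)
  have hcmp': "cat_functor (bicat_pairs (Hstar D)) (Cells (Hstar D)) (\<lambda>(g, f). g \<otimes> f) (\<lambda>(\<Psi>, \<Phi>). \<Psi> \<ast> \<Phi>)"
  proof (intro cat_functor.intro cat_functor_axioms.intro category_Hstar pairs, goal_cases)
    case (1 p) then show ?case by (cases p) simp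
  next
    case (2 p) then show ?case by (cases p) (simp add: hom_def)
  next
    case (3 p) then show ?case by (cases p) (simp add: hcmpS_vid)
  next
    case (4 p q) then show ?case by (cases p, cases q) (simp add: interchange)
  qed
  \<comment> \<open>The edge of a globular square is an identity and \<open>hidS\<close> preserves
    identities, so unitor naturality in \<open>D\<close> specialises to the bicategorical
    form.\<close>
  have "lunit D (sqbot D \<Phi>) \<bullet> (vid D (hidH D (rgtH D (sqtop D \<Phi>))) \<ast> \<Phi>) = \<Phi> \<bullet> lunit D (sqtop D \<Phi>)"
    "runit D (sqbot D \<Phi>) \<bullet> (\<Phi> \<ast> vid D (hidH D (lftH D (sqtop D \<Phi>)))) = \<Phi> \<bullet> runit D (sqtop D \<Phi>)"
    if "\<Phi> \<in> globular D" for \<Phi>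
    using that lunit_natural[of \<Phi>] runit_natural[of \<Phi>] by simp_all
  note natural = assoc_natural this
  show ?thesis
    by (intro decorated_bicategory.intro bicategory.intro decorated_bicategory_axioms.intro category_Hstar)
      (use hcmp' assoc_iso lunit_iso runit_iso natural pentagon triangle
        vers.category_axioms in \<open>simp_all add: globular_isos\<close>)
qed

end

section \<open>The decorated pseudofunctor induced by a double functor, and double functors
  recognised through it\<close>

context double_functor
begin

sublocale F0: cat_functor "Ver D" "Ver D'" "dobj F" "dver F"
  by (rule F0)

sublocale F1: cat_functor "Sqr D" "Sqr D'" "dhor F" "dsqr F"
  by (rule F1)

declare F0.map_Ob [simp] F1.map_Ob [simp] lftH_dhor [simp] rgtH_dhor [simp] lftS_dsqr [simp] rgtS_dsqr [simp]

lemma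
  assumes "f \<in> hor D" "g \<in> hor D" "lftH D g = rgtH D f"
  shows dcomp_globular [simp]: "dcomp F g f \<in> globular D'"
    and sqtop_dcomp [simp]: "sqtop D' (dcomp F g f) = dhor F g \<otimes>\<^bsub>D'\<^esub> dhor F f"
    and sqbot_dcomp [simp]: "sqbot D' (dcomp F g f) = dhor F (g \<otimes> f)"
  using dcomp_iso[OF assms] by (auto dest: cod.sqrs.isosD)

lemma
  assumes "a \<in> obj D"
  shows dunit_globular [simp]: "dunit F a \<in> globular D'"
    and sqtop_dunit [simp]: "sqtop D' (dunit F a) = hidH D' (dobj F a)"
    and sqbot_dunit [simp]: "sqbot D' (dunit F a) = dhor F (hidH D a)"
  using dunit_iso[OF assms] by (auto dest: cod.sqrs.isosD)

lemma dsqr_globular [simp]: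
  assumes "\<Phi> \<in> globular D" shows "dsqr F \<Phi> \<in> globular D'"
  by (rule cod.globularI[where a = "dobj F (lftH D (sqtop D \<Phi>))" and b = "dobj F (rgtH D (sqtop D \<Phi>))"])
    (use assms in \<open>simp_all add: F0.map_Idn\<close>)

lemma Hstar_map_simps [simp]:
  "map0 (Hstar_map D F) = dobj F" "map1 (Hstar_map D F) = dhor F"
  "\<Phi> \<in> globular D \<Longrightarrow> map2 (Hstar_map D F) \<Phi> = dsqr F \<Phi>"
  "pcomp (Hstar_map D F) = dcomp F" "punit (Hstar_map D F) = dunit F" "mapD (Hstar_map D F) = dver F"
  by (simp_all add: Hstar_map_def)

lemma decorated_pseudofunctor_Hstar_map:
  "decorated_pseudofunctor (Hstar D) (Hstar D') (Hstar_map D F)"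
proof -
  interpret H: decorated_bicategory "Hstar D"
    by (rule dom.decorated_bicategory_Hstar)
  interpret H': decorated_bicategory "Hstar D'"
    by (rule cod.decorated_bicategory_Hstar)
  have pairs: "Ob (bicat_pairs (Hstar D)) = Ob (dbl_pairs D)"
    by auto
  have "cat_functor (Cells (Hstar D)) (Cells (Hstar D')) (dhor F) (map2 (Hstar_map D F))"
    by (intro cat_functor.intro cat_functor_axioms.intro H.cells H'.cells)
      (auto simp: hom_def F1.map_Idn F1.map_Cmp)
  moreover have "map2 (Hstar_map D F) \<in> extensional (globular D)"
    by (simp add: Hstar_map_def)
  ultimately show ?thesis
    by (intro decorated_pseudofunctor.intro pseudofunctor.intro pseudofunctor_axioms.intro
        decorated_pseudofunctor_axioms.intro H.bicategory_axioms H'.bicategory_axioms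
        H.decorated_bicategory_axioms H'.decorated_bicategory_axioms)
      (simp_all add: cod.globular_isos dcomp_iso[THEN IntD2] dunit_iso[THEN IntD2] dcomp_natural assoc_coherent lunit_coherent
        runit_coherent dobj_ext dhor_ext dver_ext dcomp_ext dunit_ext F0 pairs)
qed

end

text \<open>All coherence conditions on a double functor live in the horizontal bicategory; only naturality
  with respect to non-globular squares has to be added.\<close>

lemma double_functorI:
  assumes "double_category D" "double_category D'"
    and "decorated_pseudofunctor (Hstar D) (Hstar D') (Hstar_map D F)"
    and F1: "cat_functor (Sqr D) (Sqr D') (dhor F) (dsqr F)"
    and lftS: "\<And>\<Phi>. \<Phi> \<in> sqr D \<Longrightarrow> lftS D' (dsqr F \<Phi>) = dver F (lftS D \<Phi>)"
    and rgtS: "\<And>\<Phi>. \<Phi> \<in> sqr D \<Longrightarrow> rgtS D' (dsqr F \<Phi>) = dver F (rgtS D \<Phi>)"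
    and dcomp_natural: "\<And>\<Phi> \<Psi>. \<Phi> \<in> sqr D \<Longrightarrow> \<Psi> \<in> sqr D \<Longrightarrow> lftS D \<Psi> = rgtS D \<Phi>
      \<Longrightarrow> dcomp F (sqbot D \<Psi>) (sqbot D \<Phi>) \<bullet>\<^bsub>D'\<^esub> (dsqr F \<Psi> \<ast>\<^bsub>D'\<^esub> dsqr F \<Phi>)
         = dsqr F (\<Psi> \<ast>\<^bsub>D\<^esub> \<Phi>) \<bullet>\<^bsub>D'\<^esub> dcomp F (sqtop D \<Psi>) (sqtop D \<Phi>)"
    and dunit_natural: "\<And>u. u \<in> ver D
      \<Longrightarrow> dunit F (Cod (Ver D) u) \<bullet>\<^bsub>D'\<^esub> hidS D' (dver F u)
         = dsqr F (hidS D u) \<bullet>\<^bsub>D'\<^esub> dunit F (Dom (Ver D) u)"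
    and ext: "dsqr F \<in> extensional (sqr D)"
  shows "double_functor D D' F"
proof -
  interpret D: double_category D by fact
  interpret D': double_category D' by fact
  interpret H: decorated_pseudofunctor "Hstar D" "Hstar D'" "Hstar_map D F" by fact
  have [simp]: "map0 (Hstar_map D F) = dobj F" "map1 (Hstar_map D F) = dhor F"
    "\<And>\<Phi>. \<Phi> \<in> globular D \<Longrightarrow> map2 (Hstar_map D F) \<Phi> = dsqr F \<Phi>"
    "pcomp (Hstar_map D F) = dcomp F" "punit (Hstar_map D F) = dunit F" "mapD (Hstar_map D F) = dver F"
    by (simp_all add: Hstar_map_def)
  have pairs: "Ob (bicat_pairs (Hstar D)) = Ob (dbl_pairs D)"
    by auto
  note H_facts = H.decoration H.src1_map1 H.trg1_map1 H.pcomp_iso H.punit_iso H.bassoc_coherent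
    H.blunit_coherent H.brunit_coherent H.map0_ext H.map1_ext H.pcomp_ext H.punit_ext H.mapD_ext
  show ?thesis
    by (intro double_functor.intro double_functor_axioms.intro D.double_category_axioms
        D'.double_category_axioms F1 lftS rgtS dcomp_natural dunit_natural ext)
      (use H_facts in \<open>simp_all add: D'.globular_isos pairs\<close>)
qed

text \<open>Only the factors are assumed to be double functors, because this equation is used to
  prove that the composite is one.\<close>

lemma Hstar_map_comp:
  assumes "double_functor D D' F" "double_functor D' D'' F'"
  shows "Hstar_map D (comp_dblfun D D'' F' F)
    = comp_dpf (Hstar D) (Hstar D'') (Hstar_map D' F') (Hstar_map D F)"
proof -
  interpret F: double_functor D D' F by fact
  interpret F': double_functor D' D'' F' by fact
  show ?thesis
    by (intro decpseudofun.equality ext)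
      (auto simp: Hstar_map_def comp_dpf_def comp_dblfun_def compose_def)
qed

lemma Hstar_map_id:
  assumes "double_category D"
  shows "Hstar_map D (id_dblfun D) = id_dpf (Hstar D)"
proof -
  interpret double_category D by fact
  show ?thesis
    by (intro decpseudofun.equality ext) (auto simp: Hstar_map_def id_dpf_def id_dblfun_def)
qed

text \<open>Only the action on non-globular squares is lost under \<open>Hstar_map\<close>. Laws for
  double functors thus follow from those for pseudofunctors and a comparison of
  \<open>dsqr\<close>.\<close>

lemma Hstar_map_eqD:
  assumes "Hstar_map D F = Hstar_map D F'" "dsqr F = dsqr F'"
  shows "F = F'"
  using assms by (cases F; cases F') (auto simp: Hstar_map_def)

lemma double_functor_comp:
  assumes "double_functor D D' F" "double_functor D' D'' F'"
  shows "double_functor D D'' (comp_dblfun D D'' F' F)"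
proof -
  interpret F: double_functor D D' F by fact
  interpret F': double_functor D' D'' F' by fact
  let ?H = "comp_dblfun D D'' F' F"
  have [simp]:
    "\<And>a. a \<in> obj D \<Longrightarrow> dobj ?H a = dobj F' (dobj F a)"
    "\<And>f. f \<in> hor D \<Longrightarrow> dhor ?H f = dhor F' (dhor F f)"
    "\<And>\<Phi>. \<Phi> \<in> sqr D \<Longrightarrow> dsqr ?H \<Phi> = dsqr F' (dsqr F \<Phi>)"
    "\<And>g f. f \<in> hor D \<Longrightarrow> g \<in> hor D \<Longrightarrow> lftH D g = rgtH D f
      \<Longrightarrow> dcomp ?H g f = dsqr F' (dcomp F g f) \<bullet>\<^bsub>D''\<^esub> dcomp F' (dhor F g) (dhor F f)"
    "\<And>a. a \<in> obj D \<Longrightarrow> dunit ?H a = dsqr F' (dunit F a) \<bullet>\<^bsub>D''\<^esub> dunit F' (dobj F a)"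
    "\<And>u. u \<in> ver D \<Longrightarrow> dver ?H u = dver F' (dver F u)"
    by (auto simp: comp_dblfun_def compose_def)
  \<comment> \<open>The shared vertical edge has one domain and one codomain; hence the tops are
    composable and so are the bottoms.\<close>
  have pair: "lftH D (sqtop D \<Psi>) = rgtH D (sqtop D \<Phi>)" "lftH D (sqbot D \<Psi>) = rgtH D (sqbot D \<Phi>)"
    if "\<Phi> \<in> sqr D" "\<Psi> \<in> sqr D" "lftS D \<Psi> = rgtS D \<Phi>" for \<Phi> \<Psi>
    using that by (metis F.dom.lft.Dom_Fa F.dom.rgt.Dom_Fa, metis F.dom.lft.Cod_Fa F.dom.rgt.Cod_Fa)
  show ?thesis
  proof (rule double_functorI)
    show "double_category D" "double_category D''" ..
    show "decorated_pseudofunctor (Hstar D) (Hstar D'') (Hstar_map D ?H)"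
      unfolding Hstar_map_comp[OF assms]
      by (rule decorated_pseudofunctor_comp[OF F.decorated_pseudofunctor_Hstar_map
            F'.decorated_pseudofunctor_Hstar_map])
    show "cat_functor (Sqr D) (Sqr D'') (dhor ?H) (dsqr ?H)"
      using cat_functor_compose[OF F.F1 F'.F1] by (simp add: comp_dblfun_def)
    show "dsqr ?H \<in> extensional (sqr D)"
      by (simp add: comp_dblfun_def)
  next
    fix \<Phi> \<Psi> assume \<Phi>\<Psi> [simp]: "\<Phi> \<in> sqr D" "\<Psi> \<in> sqr D" "lftS D \<Psi> = rgtS D \<Phi>"
    note [simp] = pair[OF \<Phi>\<Psi>] F'.cod.sqrs.Cmp_assoc
    \<comment> \<open>Naturality of \<open>F\<close> is mapped by \<open>F'\<close>; naturality of
      \<open>F'\<close> at the image squares then finishes.\<close>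
    have "dsqr F' (dcomp F (sqbot D \<Psi>) (sqbot D \<Phi>)) \<bullet>\<^bsub>D''\<^esub> dsqr F' (dsqr F \<Psi> \<ast>\<^bsub>D'\<^esub> dsqr F \<Phi>)
       = dsqr F' (dsqr F (\<Psi> \<ast>\<^bsub>D\<^esub> \<Phi>)) \<bullet>\<^bsub>D''\<^esub> dsqr F' (dcomp F (sqtop D \<Psi>) (sqtop D \<Phi>))"
      using arg_cong[OF F.dcomp_natural[OF \<Phi>\<Psi>], of "dsqr F'"] by (simp add: F'.F1.map_Cmp)
    from F'.cod.sqrs.Cmp_reassoc[OF this]
    show "dcomp ?H (sqbot D \<Psi>) (sqbot D \<Phi>) \<bullet>\<^bsub>D''\<^esub> (dsqr ?H \<Psi> \<ast>\<^bsub>D''\<^esub> dsqr ?H \<Phi>)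
         = dsqr ?H (\<Psi> \<ast>\<^bsub>D\<^esub> \<Phi>) \<bullet>\<^bsub>D''\<^esub> dcomp ?H (sqtop D \<Psi>) (sqtop D \<Phi>)"
      using F'.dcomp_natural[of "dsqr F \<Phi>" "dsqr F \<Psi>"] by simp
  next
    fix u assume u [simp]: "u \<in> ver D"
    note [simp] = F'.cod.sqrs.Cmp_assoc
    have "dsqr F' (dunit F (Cod (Ver D) u)) \<bullet>\<^bsub>D''\<^esub> dsqr F' (hidS D' (dver F u))
       = dsqr F' (dsqr F (hidS D u)) \<bullet>\<^bsub>D''\<^esub> dsqr F' (dunit F (Dom (Ver D) u))"
      using arg_cong[OF F.dunit_natural[OF u], of "dsqr F'"] by (simp add: F'.F1.map_Cmp)
    from F'.cod.sqrs.Cmp_reassoc[OF this]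
    show "dunit ?H (Cod (Ver D) u) \<bullet>\<^bsub>D''\<^esub> hidS D'' (dver ?H u)
         = dsqr ?H (hidS D u) \<bullet>\<^bsub>D''\<^esub> dunit ?H (Dom (Ver D) u)"
      using F'.dunit_natural[of "dver F u"] by simp
  qed simp_all
qed

lemma double_functor_id:
  assumes "double_category D"
  shows "double_functor D D (id_dblfun D)"
proof -
  interpret double_category D by fact
  have [simp]:
    "\<And>f g. f \<in> hor D \<Longrightarrow> g \<in> hor D \<Longrightarrow> lftH D g = rgtH D f \<Longrightarrow> dcomp (id_dblfun D) g f = vid D (g \<otimes>\<^bsub>D\<^esub> f)"
    "\<And>a. a \<in> obj D \<Longrightarrow> dunit (id_dblfun D) a = vid D (hidH D a)"
    by (auto simp: id_dblfun_def)
  have pair: "lftH D (sqtop D \<Psi>) = rgtH D (sqtop D \<Phi>)" "lftH D (sqbot D \<Psi>) = rgtH D (sqbot D \<Phi>)"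
    if "\<Phi> \<in> sqr D" "\<Psi> \<in> sqr D" "lftS D \<Psi> = rgtS D \<Phi>" for \<Phi> \<Psi>
    using that by (metis lft.Dom_Fa rgt.Dom_Fa, metis lft.Cod_Fa rgt.Cod_Fa)
  show ?thesis
  proof (rule double_functorI)
    show "decorated_pseudofunctor (Hstar D) (Hstar D) (Hstar_map D (id_dblfun D))"
      unfolding Hstar_map_id[OF assms]
        by (rule decorated_pseudofunctor_id[OF decorated_bicategory_Hstar])
    show "cat_functor (Sqr D) (Sqr D) (dhor (id_dblfun D)) (dsqr (id_dblfun D))"
      using cat_functor_id[OF sqrs.category_axioms] by (simp add: id_dblfun_def)
  qed (auto simp: assms pair, auto simp: id_dblfun_def)
qed

lemma comp_dblfun_id_right:
  assumes "double_functor D D' F"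
  shows "comp_dblfun D D' F (id_dblfun D) = F"
proof -
  interpret double_functor D D' F by fact
  show ?thesis
  proof (rule Hstar_map_eqD)
    show "Hstar_map D (comp_dblfun D D' F (id_dblfun D)) = Hstar_map D F"
      by (simp add: Hstar_map_comp[OF double_functor_id assms] dom.double_category_axioms Hstar_map_id
          comp_dpf_id_right[OF decorated_pseudofunctor_Hstar_map])
  qed (simp add: comp_dblfun_def id_dblfun_def compose_id_right dsqr_ext)
qed

lemma comp_dblfun_id_left:
  assumes "double_functor D D' F"
  shows "comp_dblfun D D' (id_dblfun D') F = F"
proof -
  interpret double_functor D D' F by fact
  show ?thesis
  proof (rule Hstar_map_eqD)
    show "Hstar_map D (comp_dblfun D D' (id_dblfun D') F) = Hstar_map D F"
      by (simp add: Hstar_map_comp[OF assms double_functor_id] cod.double_category_axioms Hstar_map_id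
          comp_dpf_id_left[OF decorated_pseudofunctor_Hstar_map])
  qed (simp add: comp_dblfun_def id_dblfun_def compose_id_left dsqr_ext)
qed

lemma comp_dblfun_assoc:
  assumes "double_functor A B F" "double_functor B C G" "double_functor C D H"
  shows "comp_dblfun A D (comp_dblfun B D H G) F = comp_dblfun A D H (comp_dblfun A C G F)"
proof (rule Hstar_map_eqD)
  note [simp] = assms double_functor_comp[OF assms(1,2)] double_functor_comp[OF assms(2,3)]
  show "Hstar_map A (comp_dblfun A D (comp_dblfun B D H G) F)
    = Hstar_map A (comp_dblfun A D H (comp_dblfun A C G F))"
    by (simp add: Hstar_map_comp[of A B F D] Hstar_map_comp[of B C G D] Hstar_map_comp[of A C _ D] Hstar_map_comp[of A B F C]
        comp_dpf_assoc[OF assms[THEN double_functor.decorated_pseudofunctor_Hstar_map]])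
  interpret double_functor A B F by fact
  show "dsqr (comp_dblfun A D (comp_dblfun B D H G) F) = dsqr (comp_dblfun A D H (comp_dblfun A C G F))"
    by (auto simp: comp_dblfun_def compose_def)
qed

section \<open>The categories \<open>dCat\<close> and \<open>gCat\<close>, and the functor to
  \<open>bCat\<close>\<close>

lemma category_dCat: "category dCat"
proof (rule category.intro)
  fix f g h :: "'u small_dblfun"
  show "f \<in> Ar dCat \<Longrightarrow> Dom dCat f \<in> Ob dCat" "f \<in> Ar dCat \<Longrightarrow> Cod dCat f \<in> Ob dCat"
    by (auto simp: dCat_def double_functor_def)
  show "D \<in> Ob dCat \<Longrightarrow> Idn dCat D \<in> hom dCat D D" for D :: "'u small_dblcat"
    by (auto simp: dCat_def hom_def double_functor_id)
  show "f \<in> Ar dCat \<Longrightarrow> Cmp dCat f (Idn dCat (Dom dCat f)) = f"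
    "f \<in> Ar dCat \<Longrightarrow> Cmp dCat (Idn dCat (Cod dCat f)) f = f"
    by (auto simp: dCat_def comp_dblfun_id_right comp_dblfun_id_left)
  show "f \<in> Ar dCat \<Longrightarrow> g \<in> Ar dCat \<Longrightarrow> Dom dCat g = Cod dCat f
    \<Longrightarrow> Cmp dCat g f \<in> hom dCat (Dom dCat f) (Cod dCat g)"
    by (auto simp: dCat_def hom_def intro: double_functor_comp)
  show "f \<in> Ar dCat \<Longrightarrow> g \<in> Ar dCat \<Longrightarrow> h \<in> Ar dCat \<Longrightarrow> Dom dCat g = Cod dCat f \<Longrightarrow> Dom dCat h = Cod dCat g
    \<Longrightarrow> Cmp dCat (Cmp dCat h g) f = Cmp dCat h (Cmp dCat g f)"
    by (auto simp: dCat_def comp_dblfun_assoc)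
qed

lemma category_gCat: "category gCat"
  unfolding gCat_def by (rule category_full_subcategory[OF category_dCat])

lemma gCat_simps [simp]:
  "D \<in> Ob gCat \<longleftrightarrow> double_category D \<and> globularly_generated D"
  "(D, F, D') \<in> Ar gCat \<longleftrightarrow> double_functor D D' F \<and> globularly_generated D \<and> globularly_generated D'"
  "Dom gCat (D, F, D') = D" "Cod gCat (D, F, D') = D'"
  "Idn gCat D = (D, id_dblfun D, D)"
  "Cmp gCat (D1, F', D'') (D, F, D') = (D, comp_dblfun D D'' F' F, D'')"
  by (auto simp: gCat_def full_subcategory_def dCat_def)

lemma bCat_simps [simp]:
  "B \<in> Ob bCat \<longleftrightarrow> decorated_bicategory B"
  "(B, G, B') \<in> Ar bCat \<longleftrightarrow> decorated_pseudofunctor B B' G"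
  "Dom bCat (B, G, B') = B" "Cod bCat (B, G, B') = B'"
  "Idn bCat B = (B, id_dpf B, B)"
  "Cmp bCat (B1, G', B'') (B, G, B') = (B, comp_dpf B B'' G' G, B'')"
  by (auto simp: bCat_def)

lemma cat_functor_Hstar: "cat_functor gCat bCat Hstar Hstar_arr"
proof (intro cat_functor.intro cat_functor_axioms.intro category_gCat category_bCat)
  fix f g :: "'a small_dblfun"
  obtain D F D' where f: "f = (D, F, D')" by (cases f)
  obtain E G E' where g: "g = (E, G, E')" by (cases g)
  show "f \<in> Ar gCat \<Longrightarrow> Hstar_arr f \<in> hom bCat (Hstar (Dom gCat f)) (Hstar (Cod gCat f))"
    by (simp add: f Hstar_arr_def hom_def double_functor.decorated_pseudofunctor_Hstar_map)
  show "f \<in> Ar gCat \<Longrightarrow> g \<in> Ar gCat \<Longrightarrow> Dom gCat g = Cod gCat f \<Longrightarrow>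
    Hstar_arr (Cmp gCat g f) = Cmp bCat (Hstar_arr g) (Hstar_arr f)"
    by (auto simp: f g Hstar_arr_def Hstar_map_comp)
qed (auto simp: Hstar_arr_def Hstar_map_id double_category.decorated_bicategory_Hstar)

text \<open>The set of squares on which two double functors with the same comparison cells agree is closed
  under both compositions, because the comparison cells are invertible.\<close>

locale agreeing_double_functors =
  F: double_functor D D' F + F': double_functor D D' F' for D D' F F' +
  assumes dver_eq: "dver F = dver F'" and dhor_eq: "dhor F = dhor F'" and dobj_eq: "dobj F = dobj F'"
    and dcomp_eq: "dcomp F = dcomp F'" and dunit_eq: "dunit F = dunit F'"
begin

lemma agree_hidS:
  assumes "u \<in> ver D"
  shows "dsqr F (hidS D u) = dsqr F' (hidS D u)"
proof (rule F.cod.sqrs.isos_right_cancel)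
  show "dunit F (Dom (Ver D) u)
    \<in> isos (Sqr D') (hidH D' (dobj F (Dom (Ver D) u))) (dhor F (hidH D (Dom (Ver D) u)))"
    using F.dunit_iso[of "Dom (Ver D) u"] assms by simp
  show "dsqr F (hidS D u) \<bullet>\<^bsub>D'\<^esub> dunit F (Dom (Ver D) u) = dsqr F' (hidS D u)
    \<bullet>\<^bsub>D'\<^esub> dunit F (Dom (Ver D) u)"
    using F.dunit_natural[OF assms] F'.dunit_natural[OF assms] by (simp add: dver_eq dunit_eq)
qed (use assms in \<open>simp_all add: dhor_eq\<close>)

lemma agree_vcmp:
  assumes "\<Phi> \<in> sqr D" "\<Psi> \<in> sqr D" "sqtop D \<Psi> = sqbot D \<Phi>" "dsqr F \<Phi> = dsqr F' \<Phi>" "dsqr F \<Psi> = dsqr F' \<Psi>"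
  shows "dsqr F (\<Psi> \<bullet>\<^bsub>D\<^esub> \<Phi>) = dsqr F' (\<Psi> \<bullet>\<^bsub>D\<^esub> \<Phi>)"
  using assms by (simp add: F.F1.map_Cmp F'.F1.map_Cmp)

lemma agree_hcmp:
  assumes \<Phi>\<Psi>: "\<Phi> \<in> sqr D" "\<Psi> \<in> sqr D" "lftS D \<Psi> = rgtS D \<Phi>" and eq: "dsqr F \<Phi> = dsqr F' \<Phi>" "dsqr F \<Psi>
    = dsqr F' \<Psi>"
  shows "dsqr F (\<Psi> \<ast>\<^bsub>D\<^esub> \<Phi>) = dsqr F' (\<Psi> \<ast>\<^bsub>D\<^esub> \<Phi>)"
proof (rule F.cod.sqrs.isos_right_cancel)
  have "lftH D (sqtop D \<Psi>) = rgtH D (sqtop D \<Phi>)"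
    using \<Phi>\<Psi> by (metis F.dom.lft.Dom_Fa F.dom.rgt.Dom_Fa)
  then show "dcomp F (sqtop D \<Psi>) (sqtop D \<Phi>)
    \<in> isos (Sqr D') (dhor F (sqtop D \<Psi>) \<otimes>\<^bsub>D'\<^esub> dhor F (sqtop D \<Phi>))
    (dhor F (sqtop D \<Psi> \<otimes>\<^bsub>D\<^esub> sqtop D \<Phi>))"
    using F.dcomp_iso[of "sqtop D \<Phi>" "sqtop D \<Psi>"] \<Phi>\<Psi> by simp
  show "dsqr F (\<Psi> \<ast>\<^bsub>D\<^esub> \<Phi>) \<bullet>\<^bsub>D'\<^esub> dcomp F (sqtop D \<Psi>) (sqtop D \<Phi>)
    = dsqr F' (\<Psi> \<ast>\<^bsub>D\<^esub> \<Phi>) \<bullet>\<^bsub>D'\<^esub> dcomp F (sqtop D \<Psi>) (sqtop D \<Phi>)"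
    using F.dcomp_natural[OF \<Phi>\<Psi>] F'.dcomp_natural[OF \<Phi>\<Psi>] by (simp add: eq dcomp_eq)
qed (use \<Phi>\<Psi> in \<open>simp_all add: dhor_eq\<close>)

end

section \<open>Faithfulness on globularly generated double categories\<close>

lemma (in double_category) gen_sqr_sqr: "\<Phi> \<in> gen_sqr D \<Longrightarrow> \<Phi> \<in> sqr D"
  by (induction rule: gen_sqr.induct) auto

lemma Hstar_map_faithful:
  assumes F: "double_functor D D' F" and F': "double_functor D D' F'" and gg: "globularly_generated D"
    and eq: "Hstar_map D F = Hstar_map D F'"
  shows "F = F'"
proof (rule Hstar_map_eqD[OF eq])
  interpret F: double_functor D D' F by fact
  interpret F': double_functor D D' F' by fact
  interpret agreeing_double_functors D D' F F'
    using eq by unfold_locales (simp_all add: Hstar_map_def)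
  have "dsqr F \<Phi> = dsqr F' \<Phi>" if "\<Phi> \<in> gen_sqr D" for \<Phi>
    using that
  proof induction
    case (glob \<Phi>) then show ?case using arg_cong[OF eq, of map2]
      by (simp add: Hstar_map_def) (metis restrict_apply')
  next
    case (hid u) then show ?case by (rule agree_hidS)
  next
    case (vcmp \<Phi> \<Psi>) then show ?case by (intro agree_vcmp F.dom.gen_sqr_sqr)
  next
    case (hcmp \<Phi> \<Psi>) then show ?case by (intro agree_hcmp F.dom.gen_sqr_sqr)
  qed
  then show "dsqr F = dsqr F'"
    using gg F.dsqr_ext F'.dsqr_ext unfolding globularly_generated_def
    by (auto intro: extensionalityI)
qed

lemma faithful_Hstar: "faithful gCat Hstar_arr"
  unfolding faithful_def inj_on_def hom_def
  by (auto simp: Hstar_arr_def intro: Hstar_map_faithful)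

section \<open>The free globularly generated double category\<close>

lemma sqexps_simps [simp]:
  "Two \<phi> \<in> sqexps B \<longleftrightarrow> \<phi> \<in> Cell2 B"
  "HId u \<in> sqexps B \<longleftrightarrow> u \<in> Ar (Deco B)"
  "Vert \<Psi> \<Phi> \<in> sqexps B \<longleftrightarrow> \<Phi> \<in> sqexps B \<and> \<Psi> \<in> sqexps B \<and> ebot B \<Phi> = etop B \<Psi>"
  "Horz \<Psi> \<Phi> \<in> sqexps B \<longleftrightarrow> \<Phi> \<in> sqexps B \<and> \<Psi> \<in> sqexps B \<and> ergt B \<Phi> = elft B \<Psi>"
  by (auto intro: sqexps.intros elim: sqexps.cases)

text \<open>Injectivity is demanded only on equivalence classes: a name obtained by choosing an
  element can separate disjoint nonempty sets, but not arbitrary ones.\<close>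

locale named_free_dblcat = decorated_bicategory B
  for B :: "('o, 'h, 't, 'v) decbicat" (structure) +
  fixes nm :: "('v, 't) sqexp set \<Rightarrow> 's"
  assumes inj_nm: "inj_on nm (sqexps B // sqrel B)"
begin

abbreviation Q :: "('o, 'v, 'h, 's) dblcat" where
  "Q \<equiv> free_dblcat nm B"

abbreviation cls :: "('v, 't) sqexp \<Rightarrow> 's" where
  "cls \<equiv> sqclass nm B"

text \<open>All facts are proved together because the top and bottom of a horizontal composite are
  1-cells only when the ends of the operands match, which is read off from the shared edge.\<close>

lemma sqexps_boundary:
  assumes "\<Phi> \<in> sqexps B"
  shows "etop B \<Phi> \<in> Cell1 B \<and> ebot B \<Phi> \<in> Cell1 B \<and> elft B \<Phi> \<in> Ar (Deco B) \<and> ergt B \<Phi> \<in> Ar (Deco B)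
    \<and> Dom (Deco B) (elft B \<Phi>) = src1 B (etop B \<Phi>) \<and> Cod (Deco B) (elft B \<Phi>) = src1 B (ebot B \<Phi>)
    \<and> Dom (Deco B) (ergt B \<Phi>) = trg1 B (etop B \<Phi>) \<and> Cod (Deco B) (ergt B \<Phi>) = trg1 B (ebot B \<Phi>)"
  using assms
proof induction
  case (Horz \<Phi> \<Psi>)
  then have "src1 B (etop B \<Psi>) = trg1 B (etop B \<Phi>)" "src1 B (ebot B \<Psi>) = trg1 B (ebot B \<Phi>)"
    by metis+
  with Horz show ?case by simp
qed auto

lemma
  assumes "\<Phi> \<in> sqexps B"
  shows etop_Cell1 [simp]: "etop B \<Phi> \<in> Cell1 B" and ebot_Cell1 [simp]: "ebot B \<Phi> \<in> Cell1 B"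
    and elft_Deco [simp]: "elft B \<Phi> \<in> Ar (Deco B)" and ergt_Deco [simp]: "ergt B \<Phi> \<in> Ar (Deco B)"
    and Dom_elft [simp]: "Dom (Deco B) (elft B \<Phi>) = src1 B (etop B \<Phi>)"
    and Cod_elft [simp]: "Cod (Deco B) (elft B \<Phi>) = src1 B (ebot B \<Phi>)"
    and Dom_ergt [simp]: "Dom (Deco B) (ergt B \<Phi>) = trg1 B (etop B \<Phi>)"
    and Cod_ergt [simp]: "Cod (Deco B) (ergt B \<Phi>) = trg1 B (ebot B \<Phi>)"
  using sqexps_boundary[OF assms] by auto

lemma
  assumes "\<Phi> \<in> sqexps B" "\<Psi> \<in> sqexps B" "ergt B \<Phi> = elft B \<Psi>"
  shows Horz_etop: "src1 B (etop B \<Psi>) = trg1 B (etop B \<Phi>)"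
    and Horz_ebot: "src1 B (ebot B \<Psi>) = trg1 B (ebot B \<Phi>)"
  using assms Dom_elft Dom_ergt Cod_elft Cod_ergt by metis+

text \<open>This lets tops, bottoms and edges descend to classes, and keeps composability
  independent of representatives.\<close>

lemma sqrel_boundary:
  assumes "(\<Phi>, \<Psi>) \<in> sqrel B"
  shows "\<Phi> \<in> sqexps B \<and> \<Psi> \<in> sqexps B \<and> etop B \<Phi> = etop B \<Psi> \<and> ebot B \<Phi> = ebot B \<Psi>
    \<and> elft B \<Phi> = elft B \<Psi> \<and> ergt B \<Phi> = ergt B \<Psi>"
  using assms
proof induction
  case (assoc_natural \<Theta> \<Psi> \<Phi>)
  then have "\<Phi> \<in> sqexps B" "\<Psi> \<in> sqexps B" "\<Theta> \<in> sqexps B" "ergt B \<Phi> = elft B \<Psi>" "ergt B \<Psi> = elft B \<Theta>"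
    by auto
  with Horz_etop[of \<Phi> \<Psi>] Horz_ebot[of \<Phi> \<Psi>] Horz_etop[of \<Psi> \<Theta>] Horz_ebot[of \<Psi> \<Theta>] show ?case
    by simp
next
  case (Vert_assoc \<Theta> \<Psi> \<Phi>)
  then show ?case by (simp add: deco.Cmp_assoc)
next
  case (Vert_Two \<phi> \<psi>)
  \<comment> \<open>The formal composite has as edges products of identities at the ends of
    \<open>\<phi>\<close> and \<open>\<psi>\<close>; parallelism of \<open>\<phi>\<close> makes
    these the same objects.\<close>
  then show ?case using parallel_src[of \<phi>] parallel_trg[of \<phi>] by simp
qed auto

section \<open>Calculation with classes of expressions\<close>

lemma equiv_sqrel: "equiv (sqexps B) (sqrel B)"
  by (rule equivI)
    (use sqrel_boundary in \<open>auto intro!: refl_onI symI transI intro: sqrel.refl sqrel.sym sqrel.trans\<close>)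

lemma cls_eq_iff:
  assumes "\<Phi> \<in> sqexps B" "\<Psi> \<in> sqexps B"
  shows "cls \<Phi> = cls \<Psi> \<longleftrightarrow> (\<Phi>, \<Psi>) \<in> sqrel B"
  unfolding sqclass_def inj_on_eq_iff[OF inj_nm quotientI[OF assms(1)] quotientI[OF assms(2)]]
  using eq_equiv_class_iff[OF equiv_sqrel assms] .

lemma cls_eqI: "(\<Phi>, \<Psi>) \<in> sqrel B \<Longrightarrow> cls \<Phi> = cls \<Psi>"
  using cls_eq_iff sqrel_boundary by blast

lemma sqr_free: "sqr Q = cls ` sqexps B"
  by (auto simp: free_dblcat_def sqclass_def quotient_def)

lemma cls_sqr [simp]: "\<Phi> \<in> sqexps B \<Longrightarrow> cls \<Phi> \<in> sqr Q"
  by (simp add: sqr_free)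

lemma sqrE:
  assumes "K \<in> sqr Q"
  obtains \<Phi> where "\<Phi> \<in> sqexps B" "K = cls \<Phi>"
  using assms by (auto simp: sqr_free)

text \<open>The operations of \<open>free_dblcat\<close> act on chosen representatives. This relates
  the choice to any given expression, after which all computation can be done with
  \<open>cls\<close>.\<close>

lemma sqrel_sqrep:
  assumes "\<Phi> \<in> sqexps B"
  shows "(sqrep nm B (cls \<Phi>), \<Phi>) \<in> sqrel B"
proof -
  have "sqrep nm B (cls \<Phi>) \<in> sqexps B \<and> cls (sqrep nm B (cls \<Phi>)) = cls \<Phi>"
    unfolding sqrep_def by (rule someI[of _ \<Phi>]) (use assms in simp)
  then show ?thesis
    using assms cls_eq_iff by blast
qed

lemma free_simps [simp]:
  "Ver Q = Deco B" "hor Q = Cell1 B" "vid Q f = cls (Two (id2 B f))" "lftH Q = src1 B" "rgtH Q = trg1 B"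
  "hidH Q = unit1 B" "hidS Q u = cls (HId u)" "hcmpH Q = comp1 B"
  "assoc Q h g f = cls (Two (bassoc B h g f))" "lunit Q f = cls (Two (blunit B f))"
  "runit Q f = cls (Two (brunit B f))"
  by (simp_all add: free_dblcat_def)

lemma
  assumes "\<Phi> \<in> sqexps B"
  shows sqtop_cls [simp]: "sqtop Q (cls \<Phi>) = etop B \<Phi>" and sqbot_cls [simp]: "sqbot Q (cls \<Phi>) = ebot B \<Phi>"
    and lftS_cls [simp]: "lftS Q (cls \<Phi>) = elft B \<Phi>" and rgtS_cls [simp]: "rgtS Q (cls \<Phi>) = ergt B \<Phi>"
  using sqrel_boundary[OF sqrel_sqrep[OF assms]] by (simp_all add: free_dblcat_def)

text \<open>Representatives of composable classes are again composable by
  \<open>sqrel_boundary\<close>, so the congruence rule applies.\<close>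

lemma vcmp_cls [simp]:
  assumes "\<Phi> \<in> sqexps B" "\<Psi> \<in> sqexps B" "ebot B \<Phi> = etop B \<Psi>"
  shows "vcmp Q (cls \<Psi>) (cls \<Phi>) = cls (Vert \<Psi> \<Phi>)"
proof -
  note r = sqrel_sqrep[OF assms(1)] sqrel_sqrep[OF assms(2)]
  show ?thesis
    using assms sqrel_boundary[OF r(1)] sqrel_boundary[OF r(2)]
    by (auto simp: free_dblcat_def intro!: cls_eqI sqrel.Vert_cong r)
qed

lemma hcmpS_cls [simp]:
  assumes "\<Phi> \<in> sqexps B" "\<Psi> \<in> sqexps B" "ergt B \<Phi> = elft B \<Psi>"
  shows "hcmpS Q (cls \<Psi>) (cls \<Phi>) = cls (Horz \<Psi> \<Phi>)"
proof -
  note r = sqrel_sqrep[OF assms(1)] sqrel_sqrep[OF assms(2)]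
  show ?thesis
    using assms sqrel_boundary[OF r(1)] sqrel_boundary[OF r(2)]
    by (auto simp: free_dblcat_def intro!: cls_eqI sqrel.Horz_cong r)
qed

lemma cls_Vert_Two [simp]:
  "\<phi> \<in> Cell2 B \<Longrightarrow> \<psi> \<in> Cell2 B \<Longrightarrow> top2 B \<psi> = bot2 B \<phi> \<Longrightarrow> cls (Vert (Two \<psi>) (Two \<phi>)) = cls (Two (\<psi> \<cdot> \<phi>))"
  by (rule cls_eqI[OF sqrel.Vert_Two]) simp_all

lemma cls_Horz_Two [simp]:
  "\<phi> \<in> Cell2 B \<Longrightarrow> \<psi> \<in> Cell2 B \<Longrightarrow> src1 B (top2 B \<psi>) = trg1 B (top2 B \<phi>)
    \<Longrightarrow> cls (Horz (Two \<psi>) (Two \<phi>)) = cls (Two (\<psi> \<star> \<phi>))"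
  by (rule cls_eqI[OF sqrel.Horz_Two]) simp_all

lemma cls_HId_Idn [simp]: "a \<in> Cell0 B \<Longrightarrow> cls (HId (Idn (Deco B) a)) = cls (Two (id2 B (unit1 B a)))"
  by (rule cls_eqI[OF sqrel.HId_Idn])

section \<open>The double category axioms and generation by globular squares\<close>

lemma category_Sqr_free: "category (Sqr Q)"
  by (rule category.intro)
    (auto elim!: sqrE simp: hom_def
      intro!: cls_eqI sqrel.Vert_id_top sqrel.Vert_id_bot sqrel.Vert_assoc)

lemma isos_cls_Two:
  assumes "\<phi> \<in> isos (Cells B) f g"
  shows "cls (Two \<phi>) \<in> isos (Sqr Q) f g"
proof -
  interpret S: category "Sqr Q" by (rule category_Sqr_free)
  obtain \<psi> where "\<psi> \<in> Cell2 B" "top2 B \<psi> = g" "bot2 B \<psi> = f" "\<psi> \<cdot> \<phi> = id2 B f" "\<phi> \<cdot> \<psi> = id2 B g"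
    using assms by (rule cells.isosE)
  with cells.isosD[OF assms] show ?thesis
    by (intro S.isosI[where q = "cls (Two \<psi>)"]) simp_all
qed

lemma cls_Two_globular [simp]: "\<phi> \<in> Cell2 B \<Longrightarrow> cls (Two \<phi>) \<in> globular Q"
  by (simp add: globular_def)

lemma category_dbl_pairs_free: "category (dbl_pairs Q)"
  unfolding dbl_pairs_def
  by (rule category_composable_pairs[OF category_Sqr_free])
    (auto elim!: sqrE simp: Horz_etop Horz_ebot)

text \<open>Interchange and naturality of the structure cells are imposed as relations. Pentagon and
  triangle only involve classes of 2-cells and descend from \<open>B\<close>, because
  \<open>Two\<close> carries both compositions of \<open>B\<close> to those of
  \<open>Q\<close>.\<close>

lemma double_category_free: "double_category Q"
proof (intro double_category.intro)
  note cat = category_Sqr_free deco.category_axioms category_dbl_pairs_free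
  show "cat_functor (Sqr Q) (Ver Q) (lftH Q) (lftS Q)" "cat_functor (Sqr Q) (Ver Q) (rgtH Q) (rgtS Q)"
    by (intro cat_functor.intro cat_functor_axioms.intro; use cat in \<open>auto elim!: sqrE simp: hom_def\<close>)+
  show "cat_functor (Ver Q) (Sqr Q) (hidH Q) (hidS Q)"
    by (intro cat_functor.intro cat_functor_axioms.intro)
      (use cat in \<open>auto simp: hom_def intro!: cls_eqI sqrel.sym[OF sqrel.Vert_HId]\<close>)
  show "cat_functor (dbl_pairs Q) (Sqr Q) (\<lambda>(g, f). hcmpH Q g f) (\<lambda>(\<Psi>, \<Phi>). hcmpS Q \<Psi> \<Phi>)"
  proof (intro cat_functor.intro cat_functor_axioms.intro cat, goal_cases)
    case (1 p) then show ?case by (cases p) simp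
  next
    case (2 p) then show ?case by (cases p) (auto elim!: sqrE simp: hom_def)
  next
    case (3 p) then show ?case by (cases p) (simp add: hcomp2_id2)
  next
    case (4 p q) then show ?case
      by (cases p, cases q) (auto elim!: sqrE simp: Horz_etop Horz_ebot intro!: cls_eqI sqrel.interchange)
  qed
  show "assoc Q h g f \<in> globular Q \<inter> isos (Sqr Q) (hcmpH Q (hcmpH Q h g) f) (hcmpH Q h (hcmpH Q g f))"
    if "f \<in> hor Q" "g \<in> hor Q" "h \<in> hor Q" "lftH Q g = rgtH Q f" "lftH Q h = rgtH Q g" for f g h
    using that by (simp add: isos_cls_Two bassoc_iso)
  show "lunit Q f \<in> globular Q \<inter> isos (Sqr Q) (hcmpH Q (hidH Q (rgtH Q f)) f) f"
    "runit Q f \<in> globular Q \<inter> isos (Sqr Q) (hcmpH Q f (hidH Q (lftH Q f))) f" if "f \<in> hor Q" for f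
    using that by (simp_all add: isos_cls_Two blunit_iso brunit_iso)
  show "vcmp Q (assoc Q (sqbot Q \<Theta>) (sqbot Q \<Psi>) (sqbot Q \<Phi>)) (hcmpS Q (hcmpS Q \<Theta> \<Psi>) \<Phi>)
     = vcmp Q (hcmpS Q \<Theta> (hcmpS Q \<Psi> \<Phi>)) (assoc Q (sqtop Q \<Theta>) (sqtop Q \<Psi>) (sqtop Q \<Phi>))"
    if "\<Phi> \<in> sqr Q" "\<Psi> \<in> sqr Q" "\<Theta> \<in> sqr Q" "lftS Q \<Psi> = rgtS Q \<Phi>" "lftS Q \<Theta> = rgtS Q \<Psi>" for \<Phi> \<Psi> \<Theta>
    using that by (auto elim!: sqrE simp: Horz_etop Horz_ebot intro!: cls_eqI sqrel.assoc_natural)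
  show "vcmp Q (lunit Q (sqbot Q \<Phi>)) (hcmpS Q (hidS Q (rgtS Q \<Phi>)) \<Phi>) = vcmp Q \<Phi> (lunit Q (sqtop Q \<Phi>))"
    "vcmp Q (runit Q (sqbot Q \<Phi>)) (hcmpS Q \<Phi> (hidS Q (lftS Q \<Phi>))) = vcmp Q \<Phi> (runit Q (sqtop Q \<Phi>))"
    if "\<Phi> \<in> sqr Q" for \<Phi>
    using that by (auto elim!: sqrE intro!: cls_eqI sqrel.lunit_natural sqrel.runit_natural)
  show "vcmp Q (hcmpS Q (vid Q g) (lunit Q f)) (assoc Q g (hidH Q (lftH Q g)) f)
    = hcmpS Q (runit Q g) (vid Q f)"
    if "f \<in> hor Q" "g \<in> hor Q" "lftH Q g = rgtH Q f" for f g
    using that triangle[of f g] by simp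
qed (auto elim!: sqrE simp: pentagon)

sublocale Q: double_category Q
  by (rule double_category_free)

text \<open>Structural induction phrased with the operations of \<open>Q\<close>, so that closure
  properties of sets of squares in a double category can serve as the induction steps.\<close>

lemma cls_induct [consumes 1, case_names Two HId Vert Horz]:
  assumes "\<Phi> \<in> sqexps B"
    and "\<And>\<phi>. \<phi> \<in> Cell2 B \<Longrightarrow> P (cls (Two \<phi>))"
    and "\<And>u. u \<in> Ar (Deco B) \<Longrightarrow> P (hidS Q u)"
    and "\<And>\<Phi> \<Psi>. \<Phi> \<in> sqr Q \<Longrightarrow> \<Psi> \<in> sqr Q \<Longrightarrow> sqtop Q \<Psi> = sqbot Q \<Phi> \<Longrightarrow> P \<Phi> \<Longrightarrow> P \<Psi> \<Longrightarrow> P (vcmp Q \<Psi> \<Phi>)"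
    and "\<And>\<Phi> \<Psi>. \<Phi> \<in> sqr Q \<Longrightarrow> \<Psi> \<in> sqr Q \<Longrightarrow> lftS Q \<Psi> = rgtS Q \<Phi> \<Longrightarrow> P \<Phi> \<Longrightarrow> P \<Psi> \<Longrightarrow> P (hcmpS Q \<Psi> \<Phi>)"
  shows "P (cls \<Phi>)"
  using assms(1)
proof induction
  case (Two \<phi>) then show ?case by (rule assms(2))
next
  case (HId u) then show ?case using assms(3)[of u] by simp
next
  case (Vert \<Phi> \<Psi>) then show ?case using assms(4)[of "cls \<Phi>" "cls \<Psi>"] by simp
next
  case (Horz \<Phi> \<Psi>) then show ?case using assms(5)[of "cls \<Phi>" "cls \<Psi>"] by simp
qed

lemma globularly_generated_free: "globularly_generated Q"
proof -
  have "cls \<Phi> \<in> gen_sqr Q" if "\<Phi> \<in> sqexps B" for \<Phi>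
    using that
  proof (induction rule: cls_induct)
    case (Two \<phi>) then show ?case by (intro gen_sqr.glob) simp
  next
    case (HId u) then show ?case by (intro gen_sqr.hid) simp
  qed (auto intro: gen_sqr.vcmp gen_sqr.hcmp)
  then show ?thesis
    by (auto simp: globularly_generated_def sqr_free)
qed

lemma decorated_pseudofunctor_free_incl: "decorated_pseudofunctor B (Hstar Q) (free_incl nm B)"
proof -
  interpret H: decorated_bicategory "Hstar Q" by (rule Q.decorated_bicategory_Hstar)
  have [simp]:
    "\<And>a. a \<in> Cell0 B \<Longrightarrow> map0 (free_incl nm B) a = a"
    "\<And>f. f \<in> Cell1 B \<Longrightarrow> map1 (free_incl nm B) f = f"
    "\<And>\<phi>. \<phi> \<in> Cell2 B \<Longrightarrow> map2 (free_incl nm B) \<phi> = cls (Two \<phi>)"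
    "\<And>g f. f \<in> Cell1 B \<Longrightarrow> g \<in> Cell1 B \<Longrightarrow> src1 B g = trg1 B f
      \<Longrightarrow> pcomp (free_incl nm B) g f = cls (Two (id2 B (g \<odot> f)))"
    "\<And>a. a \<in> Cell0 B \<Longrightarrow> punit (free_incl nm B) a = cls (Two (id2 B (unit1 B a)))"
    "\<And>u. u \<in> Ar (Deco B) \<Longrightarrow> mapD (free_incl nm B) u = u"
    by (simp_all add: free_incl_def)
  have "cat_functor (Cells B) (Cells (Hstar Q)) (map1 (free_incl nm B)) (map2 (free_incl nm B))"
    by (intro cat_functor.intro cat_functor_axioms.intro cells.category_axioms H.cells.category_axioms)
      (simp_all add: hom_def)
  moreover have "cat_functor (Deco B) (Deco (Hstar Q)) (map0 (free_incl nm B)) (mapD (free_incl nm B))"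
    using cat_functor_id[OF deco.category_axioms] by (simp add: free_incl_def)
  moreover have "map0 (free_incl nm B) \<in> extensional (Cell0 B)" "map1 (free_incl nm B)
    \<in> extensional (Cell1 B)"
    "map2 (free_incl nm B) \<in> extensional (Cell2 B)" "punit (free_incl nm B) \<in> extensional (Cell0 B)"
    "case_prod (pcomp (free_incl nm B)) \<in> extensional (Ob (bicat_pairs B))"
    "mapD (free_incl nm B) \<in> extensional (Ar (Deco B))"
    by (simp_all add: free_incl_def)
  ultimately show ?thesis
    by (intro decorated_pseudofunctor.intro pseudofunctor.intro pseudofunctor_axioms.intro
        decorated_pseudofunctor_axioms.intro bicategory_axioms H.bicategory_axioms
        decorated_bicategory_axioms H.decorated_bicategory_axioms)
      (simp_all add: Q.globular_isos isos_cls_Two cells.Idn_isos hcomp2_id2)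
qed

text \<open>The two double functors agree on 2-cells because the comparison cells of the inclusion are identities.\<close>

lemma free_double_functor_unique:
  assumes F: "double_functor Q D F" and F': "double_functor Q D F'"
    and eq: "comp_dpf B (Hstar D) (Hstar_map Q F) (free_incl nm B)
      = comp_dpf B (Hstar D) (Hstar_map Q F') (free_incl nm B)"
  shows "F = F'"
proof -
  interpret F: double_functor Q D F by fact
  interpret F': double_functor Q D F' by fact
  have dobj: "dobj F a = dobj F' a" if "a \<in> Cell0 B" for a
    using fun_cong[OF arg_cong[OF eq, of map0], of a] that
    by (simp add: comp_dpf_def free_incl_def compose_def)
  have dhor: "dhor F f = dhor F' f" if "f \<in> Cell1 B" for f
    using fun_cong[OF arg_cong[OF eq, of map1], of f] that
    by (simp add: comp_dpf_def free_incl_def compose_def)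
  have dver: "dver F u = dver F' u" if "u \<in> Ar (Deco B)" for u
    using fun_cong[OF arg_cong[OF eq, of mapD], of u] that
    by (simp add: comp_dpf_def free_incl_def compose_def)
  have dsqr: "dsqr F (cls (Two \<phi>)) = dsqr F' (cls (Two \<phi>))" if "\<phi> \<in> Cell2 B" for \<phi>
    using fun_cong[OF arg_cong[OF eq, of map2], of \<phi>] that
    by (simp add: comp_dpf_def free_incl_def compose_def)
  \<comment> \<open>A comparison cell of the composite with the inclusion is the image of an
    identity square after a cell of \<open>F\<close>; by this step it is the cell of
    \<open>F\<close> itself.\<close>
  have vid: "dsqr F (cls (Two (id2 B f))) = vid D (dhor F f)" "dsqr F' (cls (Two (id2 B f)))
    = vid D (dhor F' f)"
    if "f \<in> Cell1 B" for f
    using that F.F1.map_Idn[of f] F'.F1.map_Idn[of f] by simp_all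
  have dcomp: "dcomp F g f = dcomp F' g f" if "g \<in> Cell1 B" "f \<in> Cell1 B" "src1 B g = trg1 B f" for g f
    using fun_cong[OF fun_cong[OF arg_cong[OF eq, of pcomp], of g], of f] that
    by (simp add: comp_dpf_def free_incl_def vid)
  have dunit: "dunit F a = dunit F' a" if "a \<in> Cell0 B" for a
    using fun_cong[OF arg_cong[OF eq, of punit], of a] that
    by (simp add: comp_dpf_def free_incl_def vid)
  interpret agreeing_double_functors Q D F F'
  proof
    show "dver F = dver F'" "dhor F = dhor F'" "dobj F = dobj F'" "dunit F = dunit F'"
      using F.dver_ext F'.dver_ext F.dhor_ext F'.dhor_ext F.dobj_ext F'.dobj_ext F.dunit_ext F'.dunit_ext
      by (auto intro!: extensionalityI dver dhor dobj dunit)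
    have "case_prod (dcomp F) = case_prod (dcomp F')"
      using F.dcomp_ext F'.dcomp_ext by (rule extensionalityI) (auto intro: dcomp)
    then show "dcomp F = dcomp F'"
      by (metis curry_case_prod)
  qed
  have "dsqr F (cls \<Phi>) = dsqr F' (cls \<Phi>)" if "\<Phi> \<in> sqexps B" for \<Phi>
    using that
  proof (induction rule: cls_induct)
    case (Two \<phi>) then show ?case by (rule dsqr)
  next
    case (HId u) then show ?case by (intro agree_hidS) simp
  next
    case (Vert \<Phi> \<Psi>) then show ?case by (intro agree_vcmp)
  next
    case (Horz \<Phi> \<Psi>) then show ?case by (intro agree_hcmp)
  qed
  then have "dsqr F = dsqr F'"
    using F.dsqr_ext F'.dsqr_ext by (auto intro!: extensionalityI simp: sqr_free)
  then show ?thesis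
    by (simp add: dver_eq dhor_eq dobj_eq dcomp_eq dunit_eq)
qed

end

section \<open>Coding expressions in an infinite universe\<close>

lemma ex_inj_sqexp: "\<exists>code :: ('u, 'u) sqexp \<Rightarrow> 'u::infinite. inj code"
proof -
  \<comment> \<open>An infinite type is equinumerous with its square, which gives a pairing; an
    embedding of the naturals supplies the constructor tags.\<close>
  obtain p :: "'u \<times> 'u \<Rightarrow> 'u" where "bij_betw p (UNIV \<times> UNIV) UNIV"
    using card_of_Times_same_infinite[OF infinite_UNIV] card_of_ordIso by blast
  then have p: "inj p"
    by (simp add: bij_betw_def)
  obtain e :: "nat \<Rightarrow> 'u" where e: "inj e"
    using infinite_countable_subset[OF infinite_UNIV] by blast
  \<comment> \<open>The tags \<open>e 0\<close> to \<open>e 3\<close> tell the four constructors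
    apart; the recursor passes subexpressions first and their codes \<open>c\<close>,
    \<open>d\<close> last, and only the codes are used.\<close>
  define code where "code = rec_sqexp (\<lambda>t. p (e 0, t)) (\<lambda>v. p (e 1, v))
    (\<lambda>_ _ c d. p (e 2, p (c, d))) (\<lambda>_ _ c d. p (e 3, p (c, d)))"
  have [simp]: "p x = p y \<longleftrightarrow> x = y" "e i = e j \<longleftrightarrow> i = j" for x y i j
    using p e by (auto dest: injD)
  have "code \<Phi> = code \<Psi> \<Longrightarrow> \<Phi> = \<Psi>" for \<Phi> \<Psi>
  proof (induction \<Phi> arbitrary: \<Psi>)
    case (Two t) then show ?case by (cases \<Psi>) (auto simp: code_def)
  next
    case (HId v) then show ?case by (cases \<Psi>) (auto simp: code_def)
  next
    case (Vert \<Phi>1 \<Phi>2) then show ?case by (cases \<Psi>) (auto simp: code_def)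
  next
    case (Horz \<Phi>1 \<Phi>2) then show ?case by (cases \<Psi>) (auto simp: code_def)
  qed
  then show ?thesis
    by (intro exI[of _ code] injI)
qed

text \<open>Equal names give equal chosen elements, and two classes with a common element
  coincide.\<close>

lemma inj_on_sqname:
  fixes A :: "('u::infinite, 'u) sqexp set"
  assumes "equiv A r"
  shows "inj_on sqname (A // r)"
proof (rule inj_onI)
  fix K L :: "('u, 'u) sqexp set"
  assume K: "K \<in> A // r" and L: "L \<in> A // r" and eq: "sqname K = sqname L"
  have "inj (SOME code :: ('u, 'u) sqexp \<Rightarrow> 'u. inj code)"
    by (rule someI_ex[OF ex_inj_sqexp])
  then have "(SOME \<Phi>. \<Phi> \<in> K) = (SOME \<Phi>. \<Phi> \<in> L)"
    using eq unfolding sqname_def by (rule injD)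
  moreover have "(SOME \<Phi>. \<Phi> \<in> K) \<in> K" "(SOME \<Phi>. \<Phi> \<in> L) \<in> L"
    using in_quotient_imp_non_empty[OF assms] K L by (auto simp: some_in_eq)
  ultimately show "K = L"
    using quotient_disj[OF assms K L] by auto
qed

section \<open>The universal property\<close>

text \<open>\<open>isos\<close> asserts only that an inverse exists, while evaluation has to name
  one.\<close>

definition inv_of :: "('a, 'm) cat \<Rightarrow> 'm \<Rightarrow> 'm" where
  "inv_of C p = (SOME q. q \<in> hom C (Cod C p) (Dom C p) \<and> Cmp C q p = Idn C (Dom C p) \<and> Cmp C p q
    = Idn C (Cod C p))"

lemma (in category) inv_of:
  assumes "p \<in> isos C a b"
  shows "inv_of C p \<in> Ar C" "Dom C (inv_of C p) = b" "Cod C (inv_of C p) = a"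
    "Cmp C (inv_of C p) p = Idn C a" "Cmp C p (inv_of C p) = Idn C b"
proof -
  have "\<exists>q. q \<in> hom C (Cod C p) (Dom C p) \<and> Cmp C q p = Idn C (Dom C p) \<and> Cmp C p q = Idn C (Cod C p)"
    using assms by (auto simp: isos_def hom_def)
  from someI_ex[OF this, folded inv_of_def]
  show "inv_of C p \<in> Ar C" "Dom C (inv_of C p) = b" "Cod C (inv_of C p) = a"
    "Cmp C (inv_of C p) p = Idn C a" "Cmp C p (inv_of C p) = Idn C b"
    using isosD[OF assms] by (auto simp: hom_def)
qed

section \<open>Evaluation of expressions along a pseudofunctor into \<open>Hstar D\<close>\<close>

locale free_extension = named_free_dblcat B nm + D: double_category D + G: decorated_pseudofunctor B
  "Hstar D" G
  for B :: "('o, 'h, 't, 'v) decbicat" (structure) and nm :: "('v, 't) sqexp set \<Rightarrow> 's"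
    and D :: "('p, 'w, 'k, 'r) dblcat"
    and G :: "('o, 'h, 't, 'p, 'k, 'r, 'v, 'w) decpseudofun"
begin

lemmas G_simps [simp] =
  G.pcomp_Cell2[unfolded Hstar_simps] G.top2_pcomp[unfolded Hstar_simps] G.bot2_pcomp[unfolded Hstar_simps]
  G.punit_Cell2[unfolded Hstar_simps] G.top2_punit[unfolded Hstar_simps] G.bot2_punit[unfolded Hstar_simps]
  G.src1_map1[unfolded Hstar_simps] G.trg1_map1[unfolded Hstar_simps] G.map0_Cell0[unfolded Hstar_simps]
  G.map12.map_Ob[unfolded Hstar_simps] G.map12.Fa_Ar[unfolded Hstar_simps]
  G.map12.Dom_Fa[unfolded Hstar_simps] G.map12.Cod_Fa[unfolded Hstar_simps]
  G.map12.map_Idn[unfolded Hstar_simps] G.map12.map_Cmp[unfolded Hstar_simps]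
  G.deco.Fa_Ar[unfolded Hstar_simps] G.deco.Dom_Fa[unfolded Hstar_simps] G.deco.Cod_Fa[unfolded Hstar_simps]
  G.deco.map_Idn[unfolded Hstar_simps] G.deco.map_Cmp[unfolded Hstar_simps]

text \<open>Inverses are taken in the horizontal bicategory, so they are globular from the
  start.\<close>

abbreviation ginv :: "'r \<Rightarrow> 'r" where
  "ginv \<equiv> inv_of (Cells (Hstar D))"

lemma
  assumes "f \<in> Cell1 B" "g \<in> Cell1 B" "src1 B g = trg1 B f"
  shows pcomp_isos: "pcomp G g f \<in> isos (Sqr D) (map1 G g \<otimes>\<^bsub>D\<^esub> map1 G f) (map1 G (g \<odot> f))"
    and ginv_pcomp [simp]: "ginv (pcomp G g f) \<in> globular D"
      "sqtop D (ginv (pcomp G g f)) = map1 G (g \<odot> f)"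
      "sqbot D (ginv (pcomp G g f)) = map1 G g \<otimes>\<^bsub>D\<^esub> map1 G f"
      "ginv (pcomp G g f) \<bullet>\<^bsub>D\<^esub> pcomp G g f = vid D (map1 G g \<otimes>\<^bsub>D\<^esub> map1 G f)"
  using G.pcomp_iso[OF assms] G.cod.cells.inv_of[OF G.pcomp_iso[OF assms]]
  by (auto simp: D.globular_isos)

lemma
  assumes "a \<in> Cell0 B"
  shows punit_isos: "punit G a \<in> isos (Sqr D) (hidH D (map0 G a)) (map1 G (unit1 B a))"
    and ginv_punit [simp]: "ginv (punit G a) \<in> globular D"
      "sqtop D (ginv (punit G a)) = map1 G (unit1 B a)"
      "sqbot D (ginv (punit G a)) = hidH D (map0 G a)"
      "ginv (punit G a) \<bullet>\<^bsub>D\<^esub> punit G a = vid D (hidH D (map0 G a))"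
      "punit G a \<bullet>\<^bsub>D\<^esub> ginv (punit G a) = vid D (map1 G (unit1 B a))"
  using G.punit_iso[OF assms] G.cod.cells.inv_of[OF G.punit_iso[OF assms]]
  by (auto simp: D.globular_isos)

text \<open>The clauses for \<open>HId\<close> and \<open>Horz\<close> are the naturality equations
  of \<open>dunit\<close> and \<open>dcomp\<close> solved for the value of the square part.\<close>

primrec ev :: "('v, 't) sqexp \<Rightarrow> 'r" where
  "ev (Two \<phi>) = map2 G \<phi>"
| "ev (HId u) = punit G (Cod (Deco B) u) \<bullet>\<^bsub>D\<^esub> (hidS D (mapD G u) \<bullet>\<^bsub>D\<^esub> ginv (punit G (Dom (Deco B) u)))"
| "ev (Vert \<Psi> \<Phi>) = ev \<Psi> \<bullet>\<^bsub>D\<^esub> ev \<Phi>"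
| "ev (Horz \<Psi> \<Phi>) = pcomp G (ebot B \<Psi>) (ebot B \<Phi>) \<bullet>\<^bsub>D\<^esub>
     ((ev \<Psi> \<ast>\<^bsub>D\<^esub> ev \<Phi>) \<bullet>\<^bsub>D\<^esub> ginv (pcomp G (etop B \<Psi>) (etop B \<Phi>)))"

text \<open>Composing with globular cells changes tops and bottoms but not the vertical
  edges.\<close>

lemma ev_boundary:
  assumes "\<Phi> \<in> sqexps B"
  shows "ev \<Phi> \<in> sqr D \<and> sqtop D (ev \<Phi>) = map1 G (etop B \<Phi>) \<and> sqbot D (ev \<Phi>) = map1 G (ebot B \<Phi>)
    \<and> lftS D (ev \<Phi>) = mapD G (elft B \<Phi>) \<and> rgtS D (ev \<Phi>) = mapD G (ergt B \<Phi>)"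
  using assms
proof induction
  case (Horz \<Phi> \<Psi>)
  with Horz_etop[of \<Phi> \<Psi>] Horz_ebot[of \<Phi> \<Psi>] show ?case by simp
qed auto

lemma
  assumes "\<Phi> \<in> sqexps B"
  shows ev_sqr [simp]: "ev \<Phi> \<in> sqr D"
    and sqtop_ev [simp]: "sqtop D (ev \<Phi>) = map1 G (etop B \<Phi>)"
    and sqbot_ev [simp]: "sqbot D (ev \<Phi>) = map1 G (ebot B \<Phi>)"
    and lftS_ev [simp]: "lftS D (ev \<Phi>) = mapD G (elft B \<Phi>)"
    and rgtS_ev [simp]: "rgtS D (ev \<Phi>) = mapD G (ergt B \<Phi>)"
  using ev_boundary[OF assms] by auto

text \<open>Together with \<open>ev_Horz_natural\<close> this is the inverse-free description of
  \<open>ev\<close>; the defining clauses then leave the simpset.\<close>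

lemma ev_HId_natural:
  assumes "u \<in> Ar (Deco B)"
  shows "ev (HId u) \<bullet>\<^bsub>D\<^esub> punit G (Dom (Deco B) u) = punit G (Cod (Deco B) u) \<bullet>\<^bsub>D\<^esub> hidS D (mapD G u)"
  using assms by (simp add: D.sqrs.Cmp_assoc)

lemma ev_Horz_natural:
  assumes "\<Phi> \<in> sqexps B" "\<Psi> \<in> sqexps B" "ergt B \<Phi> = elft B \<Psi>"
  shows "ev (Horz \<Psi> \<Phi>) \<bullet>\<^bsub>D\<^esub> pcomp G (etop B \<Psi>) (etop B \<Phi>)
    = pcomp G (ebot B \<Psi>) (ebot B \<Phi>) \<bullet>\<^bsub>D\<^esub> (ev \<Psi> \<ast>\<^bsub>D\<^esub> ev \<Phi>)"
  using assms Horz_etop[OF assms] Horz_ebot[OF assms] by (simp add: D.sqrs.Cmp_assoc)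

declare ev.simps(2,4) [simp del]

section \<open>Evaluation respects the generating relations\<close>

lemma ev_HId_Idn:
  assumes "a \<in> Cell0 B"
  shows "ev (HId (Idn (Deco B) a)) = vid D (map1 G (unit1 B a))"
  \<comment> \<open>\<open>hidS\<close> sends the identity to an identity square, so the comparison
    cell meets its own inverse.\<close>
  using assms by (simp add: ev.simps)

lemma ev_interchange:
  assumes H: "Horz (Vert \<Psi>2 \<Psi>1) (Vert \<Phi>2 \<Phi>1) \<in> sqexps B" and V: "Vert (Horz \<Psi>2 \<Phi>2) (Horz \<Psi>1 \<Phi>1)
    \<in> sqexps B"
  shows "ev (Horz (Vert \<Psi>2 \<Psi>1) (Vert \<Phi>2 \<Phi>1)) = ev (Vert (Horz \<Psi>2 \<Phi>2) (Horz \<Psi>1 \<Phi>1))"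
proof -
  have exps [simp]: "\<Psi>1 \<in> sqexps B" "\<Psi>2 \<in> sqexps B" "\<Phi>1 \<in> sqexps B" "\<Phi>2 \<in> sqexps B"
    "ebot B \<Psi>1 = etop B \<Psi>2" "ebot B \<Phi>1 = etop B \<Phi>2" "ergt B \<Phi>1 = elft B \<Psi>1" "ergt B \<Phi>2 = elft B \<Psi>2"
    using H V by auto
  note [simp] = Horz_etop[of \<Phi>1 \<Psi>1] Horz_etop[of \<Phi>2 \<Psi>2] Horz_ebot[of \<Phi>2 \<Psi>2]
  let ?p = "pcomp G (etop B \<Psi>1) (etop B \<Phi>1)"
  show ?thesis
  proof (rule D.sqrs.isos_right_cancel[OF pcomp_isos])
    have "ev (Horz (Vert \<Psi>2 \<Psi>1) (Vert \<Phi>2 \<Phi>1)) \<bullet>\<^bsub>D\<^esub> ?p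
      = pcomp G (ebot B \<Psi>2) (ebot B \<Phi>2) \<bullet>\<^bsub>D\<^esub> ((ev \<Psi>2 \<bullet>\<^bsub>D\<^esub> ev \<Psi>1) \<ast>\<^bsub>D\<^esub> (ev \<Phi>2 \<bullet>\<^bsub>D\<^esub> ev \<Phi>1))"
      using ev_Horz_natural[of "Vert \<Phi>2 \<Phi>1" "Vert \<Psi>2 \<Psi>1"] by simp
    also have "\<dots> = pcomp G (ebot B \<Psi>2) (ebot B \<Phi>2) \<bullet>\<^bsub>D\<^esub> ((ev \<Psi>2 \<ast>\<^bsub>D\<^esub> ev \<Phi>2) \<bullet>\<^bsub>D\<^esub> (ev \<Psi>1 \<ast>\<^bsub>D\<^esub> ev \<Phi>1))"
      by (simp add: D.interchange)
    also have "\<dots> = ev (Vert (Horz \<Psi>2 \<Phi>2) (Horz \<Psi>1 \<Phi>1)) \<bullet>\<^bsub>D\<^esub> ?p"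
      \<comment> \<open>The comparison cell passes through the upper and then the lower horizontal
        composite.\<close>
      using D.sqrs.Cmp_reassoc[OF ev_Horz_natural[of \<Phi>2 \<Psi>2], of "ev \<Psi>1
        \<ast>\<^bsub>D\<^esub> ev \<Phi>1"] ev_Horz_natural[of \<Phi>1 \<Psi>1]
      by (simp add: D.sqrs.Cmp_assoc)
    finally show "ev (Horz (Vert \<Psi>2 \<Psi>1) (Vert \<Phi>2 \<Phi>1)) \<bullet>\<^bsub>D\<^esub> ?p = ev (Vert (Horz \<Psi>2 \<Phi>2) (Horz \<Psi>1 \<Phi>1))
      \<bullet>\<^bsub>D\<^esub> ?p" .
  qed simp_all
qed

lemma ev_Horz_Two:
  assumes [simp]: "\<phi> \<in> Cell2 B" "\<psi> \<in> Cell2 B" "trg1 B (top2 B \<phi>) = src1 B (top2 B \<psi>)"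
  shows "ev (Horz (Two \<psi>) (Two \<phi>)) = map2 G (\<psi> \<star> \<phi>)"
proof (rule D.sqrs.isos_right_cancel[OF pcomp_isos[of "top2 B \<phi>" "top2 B \<psi>"]])
  show "ev (Horz (Two \<psi>) (Two \<phi>)) \<bullet>\<^bsub>D\<^esub> pcomp G (top2 B \<psi>) (top2 B \<phi>)
    = map2 G (\<psi> \<star> \<phi>) \<bullet>\<^bsub>D\<^esub> pcomp G (top2 B \<psi>) (top2 B \<phi>)"
    using ev_Horz_natural[of "Two \<phi>" "Two \<psi>"] G.pcomp_natural[of \<phi> \<psi>] by simp
qed simp_all

lemma ev_lunit:
  assumes [simp]: "\<Phi> \<in> sqexps B"
  shows "map2 G (blunit B (ebot B \<Phi>)) \<bullet>\<^bsub>D\<^esub> ev (Horz (HId (ergt B \<Phi>)) \<Phi>) = ev \<Phi>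
    \<bullet>\<^bsub>D\<^esub> map2 G (blunit B (etop B \<Phi>))"
proof -
  let ?u = "ergt B \<Phi>" and ?x = "etop B \<Phi>" and ?y = "ebot B \<Phi>"
  let ?X = "vid D (map1 G ?x)" and ?Y = "vid D (map1 G ?y)"
  \<comment> \<open>The composite comparison cell from the unitor coherence of \<open>G\<close>;
    multiplying by it turns \<open>map2 G\<close> of a unitor into a unitor of
    \<open>D\<close>.\<close>
  let ?p = "pcomp G (unit1 B (trg1 B ?x)) ?x \<bullet>\<^bsub>D\<^esub> (punit G (trg1 B ?x) \<ast>\<^bsub>D\<^esub> ?X)"
  have p: "?p
    \<in> isos (Sqr D) (hidH D (map0 G (trg1 B ?x)) \<otimes>\<^bsub>D\<^esub> map1 G ?x) (map1 G (unit1 B (trg1 B ?x) \<odot> ?x))"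
    using G.cod.hcomp2_isos[OF G.cod.cells.Idn_isos[of "map1 G ?x"] G.punit_iso[of "trg1 B ?x"]]
      pcomp_isos[of ?x "unit1 B (trg1 B ?x)"] by (auto simp: D.globular_isos intro: D.sqrs.Cmp_isos)
  have n1: "ev (Horz (HId ?u) \<Phi>) \<bullet>\<^bsub>D\<^esub> pcomp G (unit1 B (trg1 B ?x)) ?x
    = pcomp G (unit1 B (trg1 B ?y)) ?y \<bullet>\<^bsub>D\<^esub> (ev (HId ?u) \<ast>\<^bsub>D\<^esub> ev \<Phi>)"
    using ev_Horz_natural[of \<Phi> "HId ?u"] by simp
  \<comment> \<open>By interchange both sides are one horizontal composite; its factors agree by
    \<open>ev_HId_natural\<close> and by unit laws.\<close>
  have n2: "(ev (HId ?u) \<ast>\<^bsub>D\<^esub> ev \<Phi>) \<bullet>\<^bsub>D\<^esub> (punit G (trg1 B ?x) \<ast>\<^bsub>D\<^esub> ?X)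
    = (punit G (trg1 B ?y) \<ast>\<^bsub>D\<^esub> ?Y) \<bullet>\<^bsub>D\<^esub> (hidS D (mapD G ?u) \<ast>\<^bsub>D\<^esub> ev \<Phi>)"
    using ev_HId_natural[of ?u] by (simp flip: D.interchange)
  have c: "map2 G (blunit B f) \<bullet>\<^bsub>D\<^esub> (pcomp G (unit1 B (trg1 B f)) f \<bullet>\<^bsub>D\<^esub> (punit G (trg1 B f)
    \<ast>\<^bsub>D\<^esub> vid D (map1 G f)))
    = lunit D (map1 G f)" if "f \<in> Cell1 B" for f
    using G.blunit_coherent[OF that] that by (simp add: D.sqrs.Cmp_assoc)
  show ?thesis
  proof (rule D.sqrs.isos_right_cancel[OF p])
    show "map2 G (blunit B ?y) \<bullet>\<^bsub>D\<^esub> ev (Horz (HId ?u) \<Phi>) \<bullet>\<^bsub>D\<^esub> ?p = ev \<Phi> \<bullet>\<^bsub>D\<^esub> map2 G (blunit B ?x)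
      \<bullet>\<^bsub>D\<^esub> ?p"
      using D.lunit_natural[of "ev \<Phi>"]
      by (simp add: D.sqrs.Cmp_assoc D.sqrs.Cmp_reassoc[OF n1] n2 c D.sqrs.Cmp_reassoc3[OF c])
  qed simp_all
qed

lemma ev_runit:
  assumes [simp]: "\<Phi> \<in> sqexps B"
  shows "map2 G (brunit B (ebot B \<Phi>)) \<bullet>\<^bsub>D\<^esub> ev (Horz \<Phi> (HId (elft B \<Phi>))) = ev \<Phi>
    \<bullet>\<^bsub>D\<^esub> map2 G (brunit B (etop B \<Phi>))"
proof -
  let ?u = "elft B \<Phi>" and ?x = "etop B \<Phi>" and ?y = "ebot B \<Phi>"
  let ?X = "vid D (map1 G ?x)" and ?Y = "vid D (map1 G ?y)"
  let ?p = "pcomp G ?x (unit1 B (src1 B ?x)) \<bullet>\<^bsub>D\<^esub> (?X \<ast>\<^bsub>D\<^esub> punit G (src1 B ?x))"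
  have p: "?p
    \<in> isos (Sqr D) (map1 G ?x \<otimes>\<^bsub>D\<^esub> hidH D (map0 G (src1 B ?x))) (map1 G (?x \<odot> unit1 B (src1 B ?x)))"
    using G.cod.hcomp2_isos[OF G.punit_iso[of "src1 B ?x"] G.cod.cells.Idn_isos[of "map1 G ?x"]]
      pcomp_isos[of "unit1 B (src1 B ?x)" ?x] by (auto simp: D.globular_isos intro: D.sqrs.Cmp_isos)
  have n1: "ev (Horz \<Phi> (HId ?u)) \<bullet>\<^bsub>D\<^esub> pcomp G ?x (unit1 B (src1 B ?x))
    = pcomp G ?y (unit1 B (src1 B ?y)) \<bullet>\<^bsub>D\<^esub> (ev \<Phi> \<ast>\<^bsub>D\<^esub> ev (HId ?u))"
    using ev_Horz_natural[of "HId ?u" \<Phi>] by simp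
  have n2: "(ev \<Phi> \<ast>\<^bsub>D\<^esub> ev (HId ?u)) \<bullet>\<^bsub>D\<^esub> (?X \<ast>\<^bsub>D\<^esub> punit G (src1 B ?x))
    = (?Y \<ast>\<^bsub>D\<^esub> punit G (src1 B ?y)) \<bullet>\<^bsub>D\<^esub> (ev \<Phi> \<ast>\<^bsub>D\<^esub> hidS D (mapD G ?u))"
    using ev_HId_natural[of ?u] by (simp flip: D.interchange)
  have c: "map2 G (brunit B f) \<bullet>\<^bsub>D\<^esub> (pcomp G f (unit1 B (src1 B f)) \<bullet>\<^bsub>D\<^esub> (vid D (map1 G f)
    \<ast>\<^bsub>D\<^esub> punit G (src1 B f)))
    = runit D (map1 G f)" if "f \<in> Cell1 B" for f
    using G.brunit_coherent[OF that] that by (simp add: D.sqrs.Cmp_assoc)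
  show ?thesis
  proof (rule D.sqrs.isos_right_cancel[OF p])
    show "map2 G (brunit B ?y) \<bullet>\<^bsub>D\<^esub> ev (Horz \<Phi> (HId ?u)) \<bullet>\<^bsub>D\<^esub> ?p = ev \<Phi> \<bullet>\<^bsub>D\<^esub> map2 G (brunit B ?x)
      \<bullet>\<^bsub>D\<^esub> ?p"
      using D.runit_natural[of "ev \<Phi>"]
      by (simp add: D.sqrs.Cmp_assoc D.sqrs.Cmp_reassoc[OF n1] n2 c D.sqrs.Cmp_reassoc3[OF c])
  qed simp_all
qed

lemma ev_assoc:
  assumes "Horz (Horz \<Theta> \<Psi>) \<Phi> \<in> sqexps B"
  shows "map2 G (bassoc B (ebot B \<Theta>) (ebot B \<Psi>) (ebot B \<Phi>)) \<bullet>\<^bsub>D\<^esub> ev (Horz (Horz \<Theta> \<Psi>) \<Phi>)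
    = ev (Horz \<Theta> (Horz \<Psi> \<Phi>)) \<bullet>\<^bsub>D\<^esub> map2 G (bassoc B (etop B \<Theta>) (etop B \<Psi>) (etop B \<Phi>))"
proof -
  have [simp]: "\<Phi> \<in> sqexps B" "\<Psi> \<in> sqexps B" "\<Theta> \<in> sqexps B" "ergt B \<Phi> = elft B \<Psi>" "ergt B \<Psi> = elft B \<Theta>"
    using assms by auto
  note [simp] = Horz_etop[of \<Phi> \<Psi>] Horz_ebot[of \<Phi> \<Psi>] Horz_etop[of \<Psi> \<Theta>] Horz_ebot[of \<Psi> \<Theta>]
  let ?f = "etop B \<Phi>" and ?g = "etop B \<Psi>" and ?h = "etop B \<Theta>"
  let ?f' = "ebot B \<Phi>" and ?g' = "ebot B \<Psi>" and ?h' = "ebot B \<Theta>"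
  \<comment> \<open>The cell from the associator coherence of \<open>G\<close>. \<open>n1\<close>
    and \<open>n2\<close> carry it through the left bracketing, while \<open>n3\<close> and
    \<open>n4\<close> treat the cell produced by \<open>c\<close> on the right bracketing;
    associator naturality in \<open>D\<close> joins the two.\<close>
  let ?p = "pcomp G (?h \<odot> ?g) ?f \<bullet>\<^bsub>D\<^esub> (pcomp G ?h ?g \<ast>\<^bsub>D\<^esub> vid D (map1 G ?f))"
  have p: "?p \<in> isos (Sqr D) (map1 G ?h \<otimes>\<^bsub>D\<^esub> map1 G ?g \<otimes>\<^bsub>D\<^esub> map1 G ?f) (map1 G (?h \<odot> ?g \<odot> ?f))"
    using G.cod.hcomp2_isos[OF G.cod.cells.Idn_isos[of "map1 G ?f"] G.pcomp_iso[of ?g ?h]]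
      pcomp_isos[of ?f "?h \<odot> ?g"] by (auto simp: D.globular_isos intro: D.sqrs.Cmp_isos)
  have n1: "ev (Horz (Horz \<Theta> \<Psi>) \<Phi>) \<bullet>\<^bsub>D\<^esub> pcomp G (?h \<odot> ?g) ?f
    = pcomp G (?h' \<odot> ?g') ?f' \<bullet>\<^bsub>D\<^esub> (ev (Horz \<Theta> \<Psi>) \<ast>\<^bsub>D\<^esub> ev \<Phi>)"
    using ev_Horz_natural[of \<Phi> "Horz \<Theta> \<Psi>"] by simp
  have n2: "(ev (Horz \<Theta> \<Psi>) \<ast>\<^bsub>D\<^esub> ev \<Phi>) \<bullet>\<^bsub>D\<^esub> (pcomp G ?h ?g \<ast>\<^bsub>D\<^esub> vid D (map1 G ?f))
    = (pcomp G ?h' ?g' \<ast>\<^bsub>D\<^esub> vid D (map1 G ?f')) \<bullet>\<^bsub>D\<^esub> (ev \<Theta> \<ast>\<^bsub>D\<^esub> ev \<Psi> \<ast>\<^bsub>D\<^esub> ev \<Phi>)"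
    using ev_Horz_natural[of \<Psi> \<Theta>] by (simp flip: D.interchange)
  have n3: "ev (Horz \<Theta> (Horz \<Psi> \<Phi>)) \<bullet>\<^bsub>D\<^esub> pcomp G ?h (?g \<odot> ?f)
    = pcomp G ?h' (?g' \<odot> ?f') \<bullet>\<^bsub>D\<^esub> (ev \<Theta> \<ast>\<^bsub>D\<^esub> ev (Horz \<Psi> \<Phi>))"
    using ev_Horz_natural[of "Horz \<Psi> \<Phi>" \<Theta>] by simp
  have n4: "(ev \<Theta> \<ast>\<^bsub>D\<^esub> ev (Horz \<Psi> \<Phi>)) \<bullet>\<^bsub>D\<^esub> (vid D (map1 G ?h) \<ast>\<^bsub>D\<^esub> pcomp G ?g ?f)
    = (vid D (map1 G ?h') \<ast>\<^bsub>D\<^esub> pcomp G ?g' ?f') \<bullet>\<^bsub>D\<^esub> (ev \<Theta> \<ast>\<^bsub>D\<^esub> (ev \<Psi> \<ast>\<^bsub>D\<^esub> ev \<Phi>))"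
    using ev_Horz_natural[of \<Phi> \<Psi>] by (simp flip: D.interchange)
  have c: "map2 G (bassoc B h g f) \<bullet>\<^bsub>D\<^esub> (pcomp G (h \<odot> g) f \<bullet>\<^bsub>D\<^esub> (pcomp G h g \<ast>\<^bsub>D\<^esub> vid D (map1 G f)))
    = pcomp G h (g \<odot> f) \<bullet>\<^bsub>D\<^esub> ((vid D (map1 G h) \<ast>\<^bsub>D\<^esub> pcomp G g f)
      \<bullet>\<^bsub>D\<^esub> assoc D (map1 G h) (map1 G g) (map1 G f))"
    if "f \<in> Cell1 B" "g \<in> Cell1 B" "h \<in> Cell1 B" "src1 B g = trg1 B f" "src1 B h = trg1 B g" for f g h
    using G.bassoc_coherent[OF that] that by (simp add: D.sqrs.Cmp_assoc)
  show ?thesis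
  proof (rule D.sqrs.isos_right_cancel[OF p])
    show "map2 G (bassoc B ?h' ?g' ?f') \<bullet>\<^bsub>D\<^esub> ev (Horz (Horz \<Theta> \<Psi>) \<Phi>) \<bullet>\<^bsub>D\<^esub> ?p
      = ev (Horz \<Theta> (Horz \<Psi> \<Phi>)) \<bullet>\<^bsub>D\<^esub> map2 G (bassoc B ?h ?g ?f) \<bullet>\<^bsub>D\<^esub> ?p"
      using D.assoc_natural[of "ev \<Phi>" "ev \<Psi>" "ev \<Theta>"]
      by (simp add: D.sqrs.Cmp_assoc D.sqrs.Cmp_reassoc[OF n1] n2 c D.sqrs.Cmp_reassoc3[OF c]
          D.sqrs.Cmp_reassoc[OF n3] D.sqrs.Cmp_reassoc[OF n4])
  qed simp_all
qed

lemma ev_sqrel: "(\<Phi>, \<Psi>) \<in> sqrel B \<Longrightarrow> ev \<Phi> = ev \<Psi>"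
proof (induction rule: sqrel.induct)
  case (Horz_cong \<Phi> \<Phi>' \<Psi> \<Psi>')
  then show ?case
    \<comment> \<open>Equal values of \<open>ev\<close> are not enough here: the clause for
      \<open>Horz\<close> also reads the tops and bottoms of its operands.\<close>
    using sqrel_boundary[of \<Phi> \<Phi>'] sqrel_boundary[of \<Psi> \<Psi>'] by (simp add: ev.simps)
next
  case (Vert_HId u w)
  then show ?case
    \<comment> \<open>The inverse cell and the cell at the middle object cancel.\<close>
    by (simp add: ev.simps D.sqrs.Cmp_assoc D.hid.map_Cmp D.sqrs.Cmp_reassoc[OF ginv_punit(4)])
next
  case (interchange \<Psi>2 \<Psi>1 \<Phi>2 \<Phi>1)
  then show ?case by (rule ev_interchange)
next
  case (assoc_natural \<Theta> \<Psi> \<Phi>)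
  then show ?case by (simp only: ev.simps(1,3) ev_assoc)
qed (simp_all add: D.sqrs.Cmp_assoc ev_HId_Idn ev_Horz_Two ev_lunit ev_runit)

text \<open>The inclusion is the identity on objects, vertical morphisms and 1-cells and has
  identity comparison cells, so only \<open>dsqr\<close> is not already given by
  \<open>G\<close>.\<close>

definition extension :: "('o, 'v, 'h, 's, 'p, 'w, 'k, 'r) dblfun" where
  "extension = \<lparr>
     dobj = map0 G,
     dver = mapD G,
     dhor = map1 G,
     dsqr = (\<lambda>K \<in> sqr Q. ev (sqrep nm B K)),
     dcomp = pcomp G,
     dunit = punit G\<rparr>"

lemma extension_simps [simp]:
  "dobj extension = map0 G" "dver extension = mapD G" "dhor extension = map1 G" "dcomp extension
    = pcomp G" "dunit extension = punit G"
  by (simp_all add: extension_def)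

lemma dsqr_extension_cls [simp]: "\<Phi> \<in> sqexps B \<Longrightarrow> dsqr extension (cls \<Phi>) = ev \<Phi>"
  using ev_sqrel[OF sqrel_sqrep] by (simp add: extension_def)

text \<open>\<open>ev_sqrel\<close> makes \<open>dsqr\<close> independent of representatives,
  \<open>ev_Horz_natural\<close> and \<open>ev_HId_natural\<close> are the naturality axioms, and
  the coherence axioms are those of \<open>G\<close>.\<close>

lemma double_functor_extension: "double_functor Q D extension"
proof (intro double_functor.intro double_functor_axioms.intro double_category_free D.double_category_axioms)
  note G_facts = G.bassoc_coherent[unfolded Hstar_simps] G.blunit_coherent[unfolded Hstar_simps]
    G.brunit_coherent[unfolded Hstar_simps]
  show "cat_functor (Ver Q) (Ver D) (dobj extension) (dver extension)"
    using G.decoration by simp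
  show "cat_functor (Sqr Q) (Sqr D) (dhor extension) (dsqr extension)"
    by (intro cat_functor.intro cat_functor_axioms.intro category_Sqr_free D.sqrs.category_axioms)
      (auto elim!: sqrE simp: hom_def)
  show "dcomp extension (sqbot Q \<Psi>) (sqbot Q \<Phi>) \<bullet>\<^bsub>D\<^esub> (dsqr extension \<Psi> \<ast>\<^bsub>D\<^esub> dsqr extension \<Phi>)
     = dsqr extension (\<Psi> \<ast>\<^bsub>Q\<^esub> \<Phi>) \<bullet>\<^bsub>D\<^esub> dcomp extension (sqtop Q \<Psi>) (sqtop Q \<Phi>)"
    if "\<Phi> \<in> sqr Q" "\<Psi> \<in> sqr Q" "lftS Q \<Psi> = rgtS Q \<Phi>" for \<Phi> \<Psi>
    using that by (auto elim!: sqrE simp: ev_Horz_natural)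
  show "dunit extension (Cod (Ver Q) u) \<bullet>\<^bsub>D\<^esub> hidS D (dver extension u) = dsqr extension (hidS Q u)
    \<bullet>\<^bsub>D\<^esub> dunit extension (Dom (Ver Q) u)"
    if "u \<in> ver Q" for u
    using that by (simp add: ev_HId_natural)
  show "dsqr extension (assoc Q h g f) \<bullet>\<^bsub>D\<^esub> dcomp extension (h \<otimes>\<^bsub>Q\<^esub> g) f \<bullet>\<^bsub>D\<^esub> (dcomp extension h g
    \<ast>\<^bsub>D\<^esub> vid D (dhor extension f))
     = dcomp extension h (g \<otimes>\<^bsub>Q\<^esub> f) \<bullet>\<^bsub>D\<^esub> (vid D (dhor extension h) \<ast>\<^bsub>D\<^esub> dcomp extension g f)
       \<bullet>\<^bsub>D\<^esub> assoc D (dhor extension h) (dhor extension g) (dhor extension f)"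
    if "f \<in> hor Q" "g \<in> hor Q" "h \<in> hor Q" "lftH Q g = rgtH Q f" "lftH Q h = rgtH Q g" for f g h
    using that G_facts(1)[of f g h] by simp
  show "dsqr extension (lunit Q f) \<bullet>\<^bsub>D\<^esub> dcomp extension (hidH Q (rgtH Q f)) f
    \<bullet>\<^bsub>D\<^esub> (dunit extension (rgtH Q f) \<ast>\<^bsub>D\<^esub> vid D (dhor extension f))
     = lunit D (dhor extension f)"
    "dsqr extension (runit Q f) \<bullet>\<^bsub>D\<^esub> dcomp extension f (hidH Q (lftH Q f))
      \<bullet>\<^bsub>D\<^esub> (vid D (dhor extension f) \<ast>\<^bsub>D\<^esub> dunit extension (lftH Q f))
     = runit D (dhor extension f)"
    if "f \<in> hor Q" for f
    using that G_facts(2,3)[of f] by simp_all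
  have "Ob (dbl_pairs Q) = Ob (bicat_pairs B)" by auto
  then show "case_prod (dcomp extension) \<in> extensional (Ob (dbl_pairs Q))"
    using G.pcomp_ext by simp
  show "dsqr extension \<in> extensional (sqr Q)" by (simp add: extension_def)
qed (use G.map0_ext G.map1_ext G.mapD_ext G.punit_ext in \<open>auto elim!: sqrE simp: pcomp_isos punit_isos\<close>)

lemma extension_free_incl: "comp_dpf B (Hstar D) (Hstar_map Q extension) (free_incl nm B) = G"
  using G.map0_ext G.map1_ext G.map2_ext G.punit_ext G.mapD_ext
  by (intro decpseudofun.equality ext)
    (auto simp: comp_dpf_def free_incl_def Hstar_map_def compose_def G.pcomp_undefined dest: extensional_arb)

end

section \<open>The adjunction\<close>

text \<open>Universal arrows yield an adjunction whose transposition sends \<open>f\<close> to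
  \<open>Ua f\<close> after \<open>\<eta> x\<close>. \<open>Fa\<close> is prescribed by a definite
  description, the shape of \<open>Q_arr\<close>, so its functoriality is derived here from
  uniqueness.\<close>

lemma left_adjointI:
  fixes X :: "('x, 'n) cat" and A :: "('a, 'm) cat"
  assumes U: "cat_functor A X Uo Ua"
    and Fo: "\<And>x. x \<in> Ob X \<Longrightarrow> Fo x \<in> Ob A"
    and \<eta>: "\<And>x. x \<in> Ob X \<Longrightarrow> \<eta> x \<in> hom X x (Uo (Fo x))"
    and univ: "\<And>x a g. x \<in> Ob X \<Longrightarrow> a \<in> Ob A \<Longrightarrow> g \<in> hom X x (Uo a)
      \<Longrightarrow> \<exists>!f. f \<in> hom A (Fo x) a \<and> Cmp X (Ua f) (\<eta> x) = g"
    and Fa: "\<And>k. k \<in> Ar X \<Longrightarrow> Fa k = (THE f. f \<in> hom A (Fo (Dom X k)) (Fo (Cod X k)) \<and>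
      Cmp X (Ua f) (\<eta> (Dom X k)) = Cmp X (\<eta> (Cod X k)) k)"
  shows "left_adjoint X A Fo Fa Uo Ua"
proof -
  interpret U: cat_functor A X Uo Ua by fact
  have \<eta>_Ar [simp]: "\<eta> x \<in> Ar X" "Dom X (\<eta> x) = x" "Cod X (\<eta> x) = Uo (Fo x)" if "x \<in> Ob X" for x
    using \<eta>[OF that] by (auto simp: hom_def)
  note [simp] = Fo U.map_Ob
  have Fa_univ: "Fa k \<in> hom A (Fo (Dom X k)) (Fo (Cod X k)) \<and>
      Cmp X (Ua (Fa k)) (\<eta> (Dom X k)) = Cmp X (\<eta> (Cod X k)) k" if "k \<in> Ar X" for k
    \<comment> \<open>The description is proper by the universal property at the arrow
      \<open>Cmp X (\<eta> (Cod X k)) k\<close>.\<close>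
    unfolding Fa[OF that] by (rule theI', rule univ) (use that in \<open>auto simp: hom_def\<close>)
  have Fa_Ar [simp]: "Fa k \<in> Ar A" "Dom A (Fa k) = Fo (Dom X k)" "Cod A (Fa k) = Fo (Cod X k)"
    and Fa_\<eta>: "Cmp X (Ua (Fa k)) (\<eta> (Dom X k)) = Cmp X (\<eta> (Cod X k)) k" if "k \<in> Ar X" for k
    using Fa_univ[OF that] by (auto simp: hom_def)
  \<comment> \<open>Arrows out of \<open>Fo x\<close> are separated by restriction along
    \<open>\<eta> x\<close>; both functor laws and injectivity of the transposition reduce to
    this.\<close>
  have unique: "f = f'" if "x \<in> Ob X" "f \<in> Ar A" "f' \<in> Ar A" "Dom A f = Fo x" "Dom A f' = Fo x"
    "Cod A f = Cod A f'"
    "Cmp X (Ua f) (\<eta> x) = Cmp X (Ua f') (\<eta> x)" for x f f'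
  proof -
    have "Cmp X (Ua f) (\<eta> x) \<in> hom X x (Uo (Cod A f))"
      using that by (simp add: hom_def)
    from univ[OF that(1) _ this] show ?thesis
      using that by (auto simp: hom_def)
  qed
  have F: "cat_functor X A Fo Fa"
  proof (intro cat_functor.intro cat_functor_axioms.intro U.dom.category_axioms U.cod.category_axioms)
    show "Fa (Idn X x) = Idn A (Fo x)" if "x \<in> Ob X" for x
      using that Fa_\<eta>[of "Idn X x"] by (intro unique[of x]) (auto simp: U.map_Idn)
    show "Fa (Cmp X g f) = Cmp A (Fa g) (Fa f)" if [simp]: "f \<in> Ar X" "g \<in> Ar X" "Dom X g = Cod X f"
      for f g
    proof (rule unique[of "Dom X f"])
      have "Cmp X (Ua (Fa (Cmp X g f))) (\<eta> (Dom X f)) = Cmp X (Cmp X (\<eta> (Cod X g)) g) f"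
        using Fa_\<eta>[of "Cmp X g f"] by (simp add: U.cod.Cmp_assoc)
      also have "\<dots> = Cmp X (Ua (Fa g)) (Cmp X (\<eta> (Cod X f)) f)"
        unfolding Fa_\<eta>[of g, symmetric, OF that(2)] by (simp add: U.cod.Cmp_assoc)
      also have "\<dots> = Cmp X (Ua (Cmp A (Fa g) (Fa f))) (\<eta> (Dom X f))"
        unfolding Fa_\<eta>[of f, symmetric, OF that(1)] by (simp add: U.cod.Cmp_assoc U.map_Cmp)
      finally show "Cmp X (Ua (Fa (Cmp X g f))) (\<eta> (Dom X f))
        = Cmp X (Ua (Cmp A (Fa g) (Fa f))) (\<eta> (Dom X f))" .
    qed simp_all
  qed (simp_all add: hom_def)
  let ?\<theta> = "\<lambda>x a f. Cmp X (Ua f) (\<eta> x)"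
  have "bij_betw (?\<theta> x a) (hom A (Fo x) a) (hom X x (Uo a))" if [simp]: "x \<in> Ob X" "a \<in> Ob A" for x a
  proof (rule bij_betw_imageI)
    show "inj_on (?\<theta> x a) (hom A (Fo x) a)"
      by (rule inj_onI) (auto simp: hom_def intro: unique[of x])
    show "?\<theta> x a ` hom A (Fo x) a = hom X x (Uo a)"
      using univ[OF that] by (fastforce simp: hom_def image_iff)
  qed
  moreover have "?\<theta> x' a' (Cmp A h (Cmp A f (Fa k))) = Cmp X (Ua h) (Cmp X (?\<theta> x a f) k)"
    if "k \<in> hom X x' x" "f \<in> hom A (Fo x) a" "h \<in> hom A a a'" for x x' a a' k f h
  proof -
    have [simp]: "k \<in> Ar X" "Dom X k = x'" "Cod X k = x" "f \<in> Ar A" "Dom A f = Fo x" "Cod A f = a"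
      "h \<in> Ar A" "Dom A h = a" "Cod A h = a'" "x \<in> Ob X" "x' \<in> Ob X"
      using that U.cod.in_Ob[of k] by (auto simp: hom_def)
    show ?thesis
      using Fa_\<eta>[of k] by (simp add: U.cod.Cmp_assoc U.map_Cmp)
  qed
  ultimately show ?thesis
    unfolding left_adjoint_def using F U by (intro conjI exI[of _ ?\<theta>]) auto
qed

lemma named_free_dblcat_sqname:
  fixes B :: "'u::infinite small_decbicat"
  assumes "decorated_bicategory B"
  shows "named_free_dblcat B sqname"
proof -
  interpret decorated_bicategory B by fact
  \<comment> \<open>\<open>equiv_sqrel\<close> lives in a locale that presupposes an injective
    naming. The identity naming unlocks it, and \<open>sqrel\<close> does not depend on the naming,
    so the fact can be used to justify \<open>sqname\<close>.\<close>
  interpret named_free_dblcat B "\<lambda>K. K"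
    by unfold_locales simp
  show ?thesis
    by unfold_locales (rule inj_on_sqname[OF equiv_sqrel])
qed

lemma Q_obj_universal:
  fixes B :: "'u::infinite small_decbicat"
  assumes B: "decorated_bicategory B" and D: "D \<in> Ob gCat" and G: "G \<in> hom bCat B (Hstar D)"
  shows "\<exists>!F. F \<in> hom gCat (Q_obj B) D \<and> Cmp bCat (Hstar_arr F) (j_arr B) = G"
proof -
  interpret named_free_dblcat B sqname by (rule named_free_dblcat_sqname[OF B])
  obtain G' where G': "G = (B, G', Hstar D)" "decorated_pseudofunctor B (Hstar D) G'"
    using G by (cases G) (auto simp: hom_def)
  interpret G: decorated_pseudofunctor B "Hstar D" G' by (rule G')
  interpret D: double_category D using D by simp
  interpret free_extension B sqname D G' ..
  show ?thesis
  proof (rule ex1I[of _ "(Q, extension, D)"])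
    show "(Q, extension, D)
      \<in> hom gCat (Q_obj B) D \<and> Cmp bCat (Hstar_arr (Q, extension, D)) (j_arr B) = G"
      using D by (simp add: hom_def Q_obj_def Hstar_arr_def j_arr_def G' double_functor_extension extension_free_incl
          globularly_generated_free)
  next
    fix F assume F: "F \<in> hom gCat (Q_obj B) D \<and> Cmp bCat (Hstar_arr F) (j_arr B) = G"
    then obtain F' where F': "F = (Q, F', D)" "double_functor Q D F'"
      by (cases F) (auto simp: hom_def Q_obj_def)
    with F have "comp_dpf B (Hstar D) (Hstar_map Q F') (free_incl sqname B) = G'"
      by (simp add: Hstar_arr_def j_arr_def G'(1))
    then show "F = (Q, extension, D)"
      using free_double_functor_unique[OF F'(2) double_functor_extension]
        by (simp add: F'(1) extension_free_incl)
  qed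
qed

theorem corollary5p6:
  shows "concrete_category gCat bCat
      (Hstar :: 'u::infinite small_dblcat \<Rightarrow> 'u small_decbicat) Hstar_arr \<and>
    left_adjoint bCat gCat
      (Q_obj :: 'u small_decbicat \<Rightarrow> 'u small_dblcat) Q_arr Hstar Hstar_arr"
proof
  show "concrete_category gCat bCat (Hstar :: 'u small_dblcat \<Rightarrow> 'u small_decbicat) Hstar_arr"
    unfolding concrete_category_def using cat_functor_Hstar faithful_Hstar by blast
  show "left_adjoint bCat gCat (Q_obj :: 'u small_decbicat \<Rightarrow> 'u small_dblcat) Q_arr Hstar Hstar_arr"
  proof (rule left_adjointI[where \<eta> = j_arr])
    show "cat_functor gCat bCat (Hstar :: 'u small_dblcat \<Rightarrow> 'u small_decbicat) Hstar_arr"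
      by (rule cat_functor_Hstar)
  next
    fix B :: "'u small_decbicat" assume "B \<in> Ob bCat"
    then interpret named_free_dblcat B sqname by (intro named_free_dblcat_sqname) simp
    show "Q_obj B \<in> Ob gCat" "j_arr B \<in> hom bCat B (Hstar (Q_obj B))"
      using double_category_free globularly_generated_free decorated_pseudofunctor_free_incl
      by (simp_all add: Q_obj_def j_arr_def hom_def)
  next
    fix k :: "'u small_dpf"
    show "Q_arr k = (THE f. f \<in> hom gCat (Q_obj (Dom bCat k)) (Q_obj (Cod bCat k)) \<and>
      Cmp bCat (Hstar_arr f) (j_arr (Dom bCat k)) = Cmp bCat (j_arr (Cod bCat k)) k)"
      \<comment> \<open>\<open>Q_arr\<close> is defined as the arrow induced by the universal
        property, exactly as \<open>left_adjointI\<close> requires.\<close>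
      by (rule Q_arr_def)
  qed (use Q_obj_universal in simp)
qed

end
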